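(* Fix $n\in\mathbb N$. Let $\mathfrak M$ be a countable model of $\mathrm{I}\Sigma_n+\exp$ and $a\in M$. Then there exists a model $\mathfrak N$ of $\mathrm{I}\Sigma_n+\exp$ which is a $\Sigma_{n+1}$-elementary cofinal extension of $\mathfrak M$ such that $[0,a]^{\mathfrak M}=[0,a]^{\mathfrak N}$ and $\mathfrak N\models\Sigma_{n+1}\colon a^eb\to(2)^1_b$ for all $e\in N-\mathbb N$ and all $b\in N$.
   Context: Language of first-order arithmetic. $\exp$ asserts totality of $x\mapsto2^x$; $\mathrm{I}\Sigma_n$ is induction for $\Sigma_n$ formulas with parameters. Numbers $x$ are identified with $\{v:v<x\}$. $\mathfrak N\models\Sigma_{n+1}\colon x\to(2)^1_y$ means there is no injection from $x$ into $y$ whose graph is defined in $\mathfrak N$ by a $\Sigma_{n+1}$ formula with parameters. $[0,a]^{\mathfrak M}$ denotes $\{x\in M: x\le a\}$. A cofinal extension $\mathfrak N\supseteq\mathfrak M$ is one where every element of $N$ is below some element of $M$; $\Sigma_{n+1}$-elementary means $\Sigma_{n+1}$ formulas with parameters from $M$ have the same truth value in both. $N-\mathbb N$ is the set of nonstandard elements of $N$.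
   Formalization: The formal theorem assumes a > 1 and claims the partition property only for b > 0: for nonstandard M the literal claim fails at b = 0 (empty injection from 0 into 0) and at a ≤ 1 (then a^e·b ≤ b, so the identity or empty map is a definable injection). *)

theory Defs
  imports Main "HOL-Library.Countable_Set"
begin

datatype trm = Var nat | Zero | One | Plus trm trm | Times trm trm

datatype fm =
    Eq trm trm
  | Lt trm trm
  | Neg fm
  | Conj fm fm
  | Disj fm fm
  | Ex nat fm
  | All nat fm
  | BEx nat trm fm
  | BAll nat trm fm

fun vars_trm :: "trm \<Rightarrow> nat set" where
  "vars_trm (Var i) = {i}"
| "vars_trm Zero = {}"
| "vars_trm One = {}"
| "vars_trm (Plus s t) = vars_trm s \<union> vars_trm t"
| "vars_trm (Times s t) = vars_trm s \<union> vars_trm t"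

fun fv :: "fm \<Rightarrow> nat set" where
  "fv (Eq s t) = vars_trm s \<union> vars_trm t"
| "fv (Lt s t) = vars_trm s \<union> vars_trm t"
| "fv (Neg p) = fv p"
| "fv (Conj p q) = fv p \<union> fv q"
| "fv (Disj p q) = fv p \<union> fv q"
| "fv (Ex x p) = fv p - {x}"
| "fv (All x p) = fv p - {x}"
| "fv (BEx x t p) = vars_trm t \<union> (fv p - {x})"
| "fv (BAll x t p) = vars_trm t \<union> (fv p - {x})"

inductive delta0 :: "fm \<Rightarrow> bool" where
  "delta0 (Eq s t)"
| "delta0 (Lt s t)"
| "delta0 p \<Longrightarrow> delta0 (Neg p)"
| "delta0 p \<Longrightarrow> delta0 q \<Longrightarrow> delta0 (Conj p q)"
| "delta0 p \<Longrightarrow> delta0 q \<Longrightarrow> delta0 (Disj p q)"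
| "x \<notin> vars_trm t \<Longrightarrow> delta0 p \<Longrightarrow> delta0 (BEx x t p)"
| "x \<notin> vars_trm t \<Longrightarrow> delta0 p \<Longrightarrow> delta0 (BAll x t p)"

inductive sigma_fm :: "nat \<Rightarrow> fm \<Rightarrow> bool" and pi_fm :: "nat \<Rightarrow> fm \<Rightarrow> bool" where
  "delta0 p \<Longrightarrow> sigma_fm 0 p"
| "delta0 p \<Longrightarrow> pi_fm 0 p"
| "pi_fm n p \<Longrightarrow> sigma_fm (Suc n) p"
| "sigma_fm (Suc n) p \<Longrightarrow> sigma_fm (Suc n) (Ex x p)"
| "sigma_fm n p \<Longrightarrow> pi_fm (Suc n) p"
| "pi_fm (Suc n) p \<Longrightarrow> pi_fm (Suc n) (All x p)"

record 'a struc =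
  carrier :: "'a set"
  zero :: 'a
  one :: 'a
  plus :: "'a \<Rightarrow> 'a \<Rightarrow> 'a"
  times :: "'a \<Rightarrow> 'a \<Rightarrow> 'a"
  less :: "'a \<Rightarrow> 'a \<Rightarrow> bool"

definition leq :: "'a struc \<Rightarrow> 'a \<Rightarrow> 'a \<Rightarrow> bool" where
  "leq M x y \<longleftrightarrow> less M x y \<or> x = y"

definition wf_struc :: "'a struc \<Rightarrow> bool" where
  "wf_struc M \<longleftrightarrow> zero M \<in> carrier M \<and> one M \<in> carrier M
     \<and> (\<forall>x\<in>carrier M. \<forall>y\<in>carrier M. plus M x y \<in> carrier M \<and> times M x y \<in> carrier M)"

fun eval :: "'a struc \<Rightarrow> (nat \<Rightarrow> 'a) \<Rightarrow> trm \<Rightarrow> 'a" where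
  "eval M s (Var i) = s i"
| "eval M s Zero = zero M"
| "eval M s One = one M"
| "eval M s (Plus t u) = plus M (eval M s t) (eval M s u)"
| "eval M s (Times t u) = times M (eval M s t) (eval M s u)"

fun sat :: "'a struc \<Rightarrow> fm \<Rightarrow> (nat \<Rightarrow> 'a) \<Rightarrow> bool" where
  "sat M (Eq t u) s \<longleftrightarrow> eval M s t = eval M s u"
| "sat M (Lt t u) s \<longleftrightarrow> less M (eval M s t) (eval M s u)"
| "sat M (Neg p) s \<longleftrightarrow> \<not> sat M p s"
| "sat M (Conj p q) s \<longleftrightarrow> sat M p s \<and> sat M q s"
| "sat M (Disj p q) s \<longleftrightarrow> sat M p s \<or> sat M q s"
| "sat M (Ex x p) s \<longleftrightarrow> (\<exists>d\<in>carrier M. sat M p (s(x := d)))"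
| "sat M (All x p) s \<longleftrightarrow> (\<forall>d\<in>carrier M. sat M p (s(x := d)))"
| "sat M (BEx x t p) s \<longleftrightarrow> (\<exists>d\<in>carrier M. less M d (eval M s t) \<and> sat M p (s(x := d)))"
| "sat M (BAll x t p) s \<longleftrightarrow> (\<forall>d\<in>carrier M. less M d (eval M s t) \<longrightarrow> sat M p (s(x := d)))"

definition assign :: "'a struc \<Rightarrow> (nat \<Rightarrow> 'a) \<Rightarrow> bool" where
  "assign M s \<longleftrightarrow> (\<forall>i. s i \<in> carrier M)"

text \<open>PA^- (the axioms of the nonnegative parts of discretely ordered
  commutative rings, as in Kaye, "Models of Peano Arithmetic"), written out.\<close>
definition PAminus :: "'a struc \<Rightarrow> bool" where
  "PAminus M \<longleftrightarrow> (let D = carrier M; p = plus M; t = times M; l = less M; z = zero M; u = one M in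
     (\<forall>x\<in>D. \<forall>y\<in>D. \<forall>w\<in>D. p (p x y) w = p x (p y w))
   \<and> (\<forall>x\<in>D. \<forall>y\<in>D. p x y = p y x)
   \<and> (\<forall>x\<in>D. \<forall>y\<in>D. \<forall>w\<in>D. t (t x y) w = t x (t y w))
   \<and> (\<forall>x\<in>D. \<forall>y\<in>D. t x y = t y x)
   \<and> (\<forall>x\<in>D. \<forall>y\<in>D. \<forall>w\<in>D. t x (p y w) = p (t x y) (t x w))
   \<and> (\<forall>x\<in>D. p x z = x \<and> t x z = z)
   \<and> (\<forall>x\<in>D. t x u = x)
   \<and> (\<forall>x\<in>D. \<not> l x x)
   \<and> (\<forall>x\<in>D. \<forall>y\<in>D. \<forall>w\<in>D. l x y \<and> l y w \<longrightarrow> l x w)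
   \<and> (\<forall>x\<in>D. \<forall>y\<in>D. l x y \<or> x = y \<or> l y x)
   \<and> (\<forall>x\<in>D. \<forall>y\<in>D. \<forall>w\<in>D. l x y \<longrightarrow> l (p x w) (p y w))
   \<and> (\<forall>x\<in>D. \<forall>y\<in>D. \<forall>w\<in>D. l z w \<and> l x y \<longrightarrow> l (t x w) (t y w))
   \<and> (\<forall>x\<in>D. \<forall>y\<in>D. l x y \<longrightarrow> (\<exists>w\<in>D. p x w = y))
   \<and> l z u \<and> (\<forall>x\<in>D. l z x \<longrightarrow> u = x \<or> l u x)
   \<and> (\<forall>x\<in>D. x = z \<or> l z x))"

definition ISigma :: "nat \<Rightarrow> 'a struc \<Rightarrow> bool" where
  "ISigma n M \<longleftrightarrow> (\<forall>p x s. sigma_fm n p \<longrightarrow> assign M s \<longrightarrow>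
      sat M p (s(x := zero M)) \<longrightarrow>
      (\<forall>y\<in>carrier M. sat M p (s(x := y)) \<longrightarrow> sat M p (s(x := plus M y (one M)))) \<longrightarrow>
      (\<forall>y\<in>carrier M. sat M p (s(x := y))))"

text \<open>Value of a formula at an assignment giving variable i the i-th listed value
  (remaining variables are set to 0; used only for formulas whose free variables
  are among the listed ones).\<close>
definition holds :: "'a struc \<Rightarrow> fm \<Rightarrow> 'a list \<Rightarrow> bool" where
  "holds M p xs \<longleftrightarrow> sat M p (\<lambda>i. if i < length xs then xs ! i else zero M)"

text \<open>A parameter-free Delta_0 formula theta(x0,x1) defining in M a total function
  satisfying the recursion of x \<mapsto> 2^x.  In models of I\<Delta>_0 any such formula
  defines the same function (the usual one, given by the canonical Delta_0
  graph of exponentiation), so exp (totality of x \<mapsto> 2^x) holds iff such a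
  formula exists.\<close>
definition pow2_graph :: "'a struc \<Rightarrow> fm \<Rightarrow> bool" where
  "pow2_graph M \<theta> \<longleftrightarrow> delta0 \<theta> \<and> fv \<theta> \<subseteq> {0, 1}
   \<and> (\<forall>x\<in>carrier M. \<exists>y\<in>carrier M. holds M \<theta> [x, y])
   \<and> (\<forall>x\<in>carrier M. \<forall>y\<in>carrier M. \<forall>y'\<in>carrier M.
         holds M \<theta> [x, y] \<and> holds M \<theta> [x, y'] \<longrightarrow> y = y')
   \<and> holds M \<theta> [zero M, one M]
   \<and> (\<forall>x\<in>carrier M. \<forall>y\<in>carrier M.
         holds M \<theta> [x, y] \<longrightarrow> holds M \<theta> [plus M x (one M), plus M y y])"

definition exp_ax :: "'a struc \<Rightarrow> bool" where
  "exp_ax M \<longleftrightarrow> (\<exists>\<theta>. pow2_graph M \<theta>)"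

definition model_ISigma_exp :: "nat \<Rightarrow> 'a struc \<Rightarrow> bool" where
  "model_ISigma_exp n M \<longleftrightarrow> wf_struc M \<and> carrier M \<noteq> {} \<and> PAminus M \<and> ISigma n M \<and> exp_ax M"

definition power_graph :: "'a struc \<Rightarrow> fm \<Rightarrow> bool" where
  "power_graph M \<theta> \<longleftrightarrow> delta0 \<theta> \<and> fv \<theta> \<subseteq> {0, 1, 2}
   \<and> (\<forall>x\<in>carrier M. \<forall>y\<in>carrier M. \<exists>z\<in>carrier M. holds M \<theta> [x, y, z])
   \<and> (\<forall>x\<in>carrier M. \<forall>y\<in>carrier M. \<forall>z\<in>carrier M. \<forall>z'\<in>carrier M.
         holds M \<theta> [x, y, z] \<and> holds M \<theta> [x, y, z'] \<longrightarrow> z = z')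
   \<and> (\<forall>x\<in>carrier M. holds M \<theta> [x, zero M, one M])
   \<and> (\<forall>x\<in>carrier M. \<forall>y\<in>carrier M. \<forall>z\<in>carrier M.
         holds M \<theta> [x, y, z] \<longrightarrow> holds M \<theta> [x, plus M y (one M), times M z x])"

definition is_power :: "'a struc \<Rightarrow> 'a \<Rightarrow> 'a \<Rightarrow> 'a \<Rightarrow> bool" where
  "is_power M a e c \<longleftrightarrow> c \<in> carrier M \<and> (\<exists>\<theta>. power_graph M \<theta> \<and> holds M \<theta> [a, e, c])"

definition std_num :: "'a struc \<Rightarrow> nat \<Rightarrow> 'a" where
  "std_num M k = ((\<lambda>x. plus M x (one M)) ^^ k) (zero M)"

definition nonstandard :: "'a struc \<Rightarrow> 'a \<Rightarrow> bool" where
  "nonstandard M e \<longleftrightarrow> e \<in> carrier M \<and> e \<notin> range (std_num M)"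

definition inj_graph :: "'a struc \<Rightarrow> 'a \<Rightarrow> 'a \<Rightarrow> ('a \<Rightarrow> 'a \<Rightarrow> bool) \<Rightarrow> bool" where
  "inj_graph M x y R \<longleftrightarrow>
     (\<forall>u v. R u v \<longrightarrow> u \<in> carrier M \<and> v \<in> carrier M \<and> less M u x \<and> less M v y)
   \<and> (\<forall>u\<in>carrier M. less M u x \<longrightarrow> (\<exists>v. R u v))
   \<and> (\<forall>u v v'. R u v \<and> R u v' \<longrightarrow> v = v')
   \<and> (\<forall>u u' v. R u v \<and> R u' v \<longrightarrow> u = u')"

text \<open>M |= Sigma_k : x \<rightarrow> (2)^1_y : no injection from x into y whose graph is
  defined by a Sigma_k formula with parameters (variables 0,1 carry the
  arguments, all other variables are parameters).\<close>
definition no_def_inj :: "nat \<Rightarrow> 'a struc \<Rightarrow> 'a \<Rightarrow> 'a \<Rightarrow> bool" where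
  "no_def_inj k M x y \<longleftrightarrow>
     \<not> (\<exists>p s. sigma_fm k p \<and> assign M s \<and>
            inj_graph M x y (\<lambda>u v. sat M p (s(0 := u, 1 := v))))"

definition extends_via :: "('a \<Rightarrow> 'b) \<Rightarrow> 'a struc \<Rightarrow> 'b struc \<Rightarrow> bool" where
  "extends_via h M N \<longleftrightarrow> inj_on h (carrier M) \<and> h ` carrier M \<subseteq> carrier N
   \<and> h (zero M) = zero N \<and> h (one M) = one N
   \<and> (\<forall>x\<in>carrier M. \<forall>y\<in>carrier M.
        h (plus M x y) = plus N (h x) (h y) \<and> h (times M x y) = times N (h x) (h y)
        \<and> (less M x y \<longleftrightarrow> less N (h x) (h y)))"

definition cofinal_via :: "('a \<Rightarrow> 'b) \<Rightarrow> 'a struc \<Rightarrow> 'b struc \<Rightarrow> bool" where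
  "cofinal_via h M N \<longleftrightarrow> (\<forall>y\<in>carrier N. \<exists>x\<in>carrier M. leq N y (h x))"

definition sigma_elem_via :: "nat \<Rightarrow> ('a \<Rightarrow> 'b) \<Rightarrow> 'a struc \<Rightarrow> 'b struc \<Rightarrow> bool" where
  "sigma_elem_via k h M N \<longleftrightarrow>
     (\<forall>p s. sigma_fm k p \<longrightarrow> assign M s \<longrightarrow> (sat M p s \<longleftrightarrow> sat N p (h \<circ> s)))"

end

theory Submission
  imports Defs
begin

text \<open>Call a set of elements of a model coded if it is given by the binary digits of an element. Fix \<open>b > 0\<close> and
  \<open>c = a\<^sup>e\<close> with \<open>e\<close> nonstandard. Starting from \<open>[0, cb)\<close>, choose a decreasing sequence of
  coded sets \<open>S\<^sub>k\<close> such that no coded injection maps \<open>S\<^sub>k\<close> into \<open>a\<^sup>e\<^sup>-\<^sup>k b\<close> (up to reindexing). By the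
  pigeonhole principle a fibre of a coded function into \<open>a\<close>, and the complement of a coded set
  that injects into \<open>b\<close>, cost only one factor \<open>a\<close>; so every coded function into \<open>a\<close> can be made
  constant on some \<open>S\<^sub>k\<close> and every coded set injecting into \<open>b\<close> can be avoided. The ultrapower by
  coded functions along \<open>S\<^sub>k\<close> satisfies Los's theorem for \<open>\<Sigma>\<^sub>n\<close> formulas, hence is a cofinal
  \<open>\<Sigma>\<^sub>n\<^sub>+\<^sub>1\<close>-elementary extension satisfying \<open>I\<Sigma>\<^sub>n\<close> with no new elements below \<open>a\<close>, and the class of
  the identity lies outside the domain of every \<open>\<Sigma>\<^sub>n\<^sub>+\<^sub>1\<close> injection from \<open>cb\<close> into \<open>b\<close>. A countable
  chain of such extensions treats all pairs \<open>(c, b)\<close>.\<close>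

section \<open>Syntax\<close>

text \<open>The ground model may well have a Sigma_{n+1} injection from \<open>cb\<close> into
  \<open>b\<close>, although the pigeonhole principle excludes a coded one. So the definition is not
  refuted there; it is made to lose totality in the extension. If the new element had a value, that
  value would be the class of a coded function \<open>f\<close>, and the truth of the Sigma_{n+1}
  formula would provide coded witnesses that make it true in the ground model on a coded set of
  indices. On this set \<open>f\<close> is a coded injection into \<open>b\<close>, so the set is
  among those avoided. Los's theorem stops at level n because its witnesses must be coded: a choice
  function for a Sigma_m relation with m > 0 is obtained from Sigma_m induction. Bounded quantifiers
  take only Delta_0 induction and \<open>exp\<close>, which settles n = 0. A descending sequence can
  replace an ultrafilter because only coded sets have to be decided, and these are countably many.
  Along the chain the missing value cannot reappear: that a given element has a value is itself a
  Sigma_{n+1} statement, preserved in both directions.\<close>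

lemma eval_cong: "(\<And>i. i \<in> vars_trm t \<Longrightarrow> s i = s' i) \<Longrightarrow> eval M s t = eval M s' t"
  by (induction t) auto

lemma sat_cong: "(\<And>i. i \<in> fv p \<Longrightarrow> s i = s' i) \<Longrightarrow> sat M p s = sat M p s'"
proof (induction p arbitrary: s s')
  case (Eq t u)
  then have "eval M s t = eval M s' t" "eval M s u = eval M s' u"
    by (auto intro: eval_cong)
  then show ?case by simp
next
  case (Lt t u)
  then have "eval M s t = eval M s' t" "eval M s u = eval M s' u"
    by (auto intro: eval_cong)
  then show ?case by simp
next
  case (Neg p)
  then show ?case by (metis fv.simps(3) sat.simps(3))
next
  case (Conj p q)
  then show ?case by (metis UnCI fv.simps(4) sat.simps(4))
next
  case (Disj p q)
  then show ?case by (metis UnCI fv.simps(5) sat.simps(5))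
next
  case (Ex x p)
  have "sat M p (s(x := d)) = sat M p (s'(x := d))" for d
    using Ex.prems by (intro Ex.IH) auto
  then show ?case by simp
next
  case (All x p)
  have "sat M p (s(x := d)) = sat M p (s'(x := d))" for d
    using All.prems by (intro All.IH) auto
  then show ?case by simp
next
  case (BEx x t p)
  have "sat M p (s(x := d)) = sat M p (s'(x := d))" for d
    using BEx.prems by (intro BEx.IH) auto
  moreover have "eval M s t = eval M s' t"
    using BEx.prems by (intro eval_cong) auto
  ultimately show ?case by simp
next
  case (BAll x t p)
  have "sat M p (s(x := d)) = sat M p (s'(x := d))" for d
    using BAll.prems by (intro BAll.IH) auto
  moreover have "eval M s t = eval M s' t"
    using BAll.prems by (intro eval_cong) auto
  ultimately show ?case by simp
qed

lemma finite_vars_trm: "finite (vars_trm t)"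
  by (induction t) auto

lemma finite_fv: "finite (fv p)"
  by (induction p) (auto simp: finite_vars_trm)

section \<open>Renaming of free variables\<close>

primrec rename_trm :: "(nat \<Rightarrow> nat) \<Rightarrow> trm \<Rightarrow> trm" where
  "rename_trm r (Var i) = Var (r i)"
| "rename_trm r Zero = Zero"
| "rename_trm r One = One"
| "rename_trm r (Plus t u) = Plus (rename_trm r t) (rename_trm r u)"
| "rename_trm r (Times t u) = Times (rename_trm r t) (rename_trm r u)"

lemma eval_rename_trm: "eval M s (rename_trm r t) = eval M (\<lambda>i. s (r i)) t"
  by (induction t) auto

lemma vars_rename_trm: "vars_trm (rename_trm r t) = r ` vars_trm t"
  by (induction t) auto

lemma obtain_fresh:
  assumes "finite (A :: nat set)" obtains z where "z \<notin> A"
  using assms ex_new_if_finite infinite_UNIV_nat by blast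

lemma sat_rename_bind:
  assumes "\<And>s. sat M p' s = sat M p (\<lambda>i. s ((r(x := z)) i))" and "z \<notin> r ` fv p"
  shows "sat M p' (s(z := d)) = sat M p ((\<lambda>i. s (r i))(x := d))"
  unfolding assms(1) by (rule sat_cong) (use assms(2) in auto)

text \<open>Since \<open>r\<close> need not be injective, a quantifier could capture a renamed
  variable. The new bound variable \<open>z\<close> therefore avoids the renamed free variables and
  also the variables of the renamed bound, as \<open>delta0\<close> demands of bounded
  quantifiers.\<close>

lemma rename_delta0:
  "delta0 p \<Longrightarrow> \<exists>p'. delta0 p' \<and> (\<forall>s. sat M p' s = sat M p (\<lambda>i. s (r i)))"
proof (induction arbitrary: r rule: delta0.induct)
  case (1 t u)
  show ?case
    by (rule exI[of _ "Eq (rename_trm r t) (rename_trm r u)"]) (simp add: delta0.intros eval_rename_trm)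
next
  case (2 t u)
  show ?case
    by (rule exI[of _ "Lt (rename_trm r t) (rename_trm r u)"]) (simp add: delta0.intros eval_rename_trm)
next
  case (3 p)
  obtain p' where "delta0 p'" "\<forall>s. sat M p' s = sat M p (\<lambda>i. s (r i))" using 3 by blast
  then show ?case by (intro exI[of _ "Neg p'"]) (simp add: delta0.intros)
next
  case (4 p q)
  obtain p' where "delta0 p'" "\<forall>s. sat M p' s = sat M p (\<lambda>i. s (r i))" using 4 by blast
  moreover obtain q' where "delta0 q'" "\<forall>s. sat M q' s = sat M q (\<lambda>i. s (r i))" using 4 by blast
  ultimately show ?case by (intro exI[of _ "Conj p' q'"]) (simp add: delta0.intros)
next
  case (5 p q)
  obtain p' where "delta0 p'" "\<forall>s. sat M p' s = sat M p (\<lambda>i. s (r i))" using 5 by blast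
  moreover obtain q' where "delta0 q'" "\<forall>s. sat M q' s = sat M q (\<lambda>i. s (r i))" using 5 by blast
  ultimately show ?case by (intro exI[of _ "Disj p' q'"]) (simp add: delta0.intros)
next
  case (6 x t p)
  obtain z where z: "z \<notin> r ` fv p \<union> r ` vars_trm t"
    using obtain_fresh[of "r ` fv p \<union> r ` vars_trm t"] finite_fv finite_vars_trm by auto
  obtain p' where p': "delta0 p'" "\<And>s. sat M p' s = sat M p (\<lambda>i. s ((r(x := z)) i))"
    using "6.IH"[of "r(x := z)"] by blast
  have "sat M p' (s(z := d)) = sat M p ((\<lambda>i. s (r i))(x := d))" for s d
    by (rule sat_rename_bind[OF p'(2)]) (use z in auto)
  then show ?case using z p'(1)
    by (intro exI[of _ "BEx z (rename_trm r t) p'"])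
      (simp add: delta0.intros eval_rename_trm vars_rename_trm)
next
  case (7 x t p)
  obtain z where z: "z \<notin> r ` fv p \<union> r ` vars_trm t"
    using obtain_fresh[of "r ` fv p \<union> r ` vars_trm t"] finite_fv finite_vars_trm by auto
  obtain p' where p': "delta0 p'" "\<And>s. sat M p' s = sat M p (\<lambda>i. s ((r(x := z)) i))"
    using "7.IH"[of "r(x := z)"] by blast
  have "sat M p' (s(z := d)) = sat M p ((\<lambda>i. s (r i))(x := d))" for s d
    by (rule sat_rename_bind[OF p'(2)]) (use z in auto)
  then show ?case using z p'(1)
    by (intro exI[of _ "BAll z (rename_trm r t) p'"])
      (simp add: delta0.intros eval_rename_trm vars_rename_trm)
qed

lemma rename_sigma_pi:
  "sigma_fm n p \<Longrightarrow> \<forall>r. \<exists>p'. sigma_fm n p' \<and> (\<forall>s. sat M p' s = sat M p (\<lambda>i. s (r i)))"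
  "pi_fm n p \<Longrightarrow> \<forall>r. \<exists>p'. pi_fm n p' \<and> (\<forall>s. sat M p' s = sat M p (\<lambda>i. s (r i)))"
proof (induction rule: sigma_fm_pi_fm.inducts)
  case (1 p)
  then show ?case using rename_delta0 sigma_fm_pi_fm.intros(1) by blast
next
  case (2 p)
  then show ?case using rename_delta0 sigma_fm_pi_fm.intros(2) by blast
next
  case (3 n p)
  then show ?case using sigma_fm_pi_fm.intros(3) by blast
next
  case (4 n p x)
  show ?case
  proof
    fix r :: "nat \<Rightarrow> nat"
    obtain z where z: "z \<notin> r ` fv p" by (rule obtain_fresh[OF finite_imageI[OF finite_fv[of p], of r]])
    obtain p' where p': "sigma_fm (Suc n) p'" "\<And>s. sat M p' s = sat M p (\<lambda>i. s ((r(x := z)) i))"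
      using 4 by blast
    show "\<exists>p'. sigma_fm (Suc n) p' \<and> (\<forall>s. sat M p' s = sat M (Ex x p) (\<lambda>i. s (r i)))"
      using p'(1) sat_rename_bind[OF p'(2) z]
      by (intro exI[of _ "Ex z p'"]) (simp add: sigma_fm_pi_fm.intros)
  qed
next
  case (5 n p)
  then show ?case using sigma_fm_pi_fm.intros(5) by blast
next
  case (6 n p x)
  show ?case
  proof
    fix r :: "nat \<Rightarrow> nat"
    obtain z where z: "z \<notin> r ` fv p" by (rule obtain_fresh[OF finite_imageI[OF finite_fv[of p], of r]])
    obtain p' where p': "pi_fm (Suc n) p'" "\<And>s. sat M p' s = sat M p (\<lambda>i. s ((r(x := z)) i))"
      using 6 by blast
    show "\<exists>p'. pi_fm (Suc n) p' \<and> (\<forall>s. sat M p' s = sat M (All x p) (\<lambda>i. s (r i)))"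
      using p'(1) sat_rename_bind[OF p'(2) z]
      by (intro exI[of _ "All z p'"]) (simp add: sigma_fm_pi_fm.intros)
  qed
qed

text \<open>The dual formula is chosen before the structure, because \<open>elem_ext_sat\<close>
  evaluates one and the same dual in two structures.\<close>

lemma neg_sigma_pi:
  "sigma_fm n p \<Longrightarrow> \<exists>p'. pi_fm n p' \<and> (\<forall>M s. sat (M :: 'b struc) p' s \<longleftrightarrow> \<not> sat M p s)"
  "pi_fm n p \<Longrightarrow> \<exists>p'. sigma_fm n p' \<and> (\<forall>M s. sat (M :: 'b struc) p' s \<longleftrightarrow> \<not> sat M p s)"
proof (induction rule: sigma_fm_pi_fm.inducts)
  case (1 p)
  then show ?case
    by (intro exI[of _ "Neg p"]) (simp add: sigma_fm_pi_fm.intros delta0.intros)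
next
  case (2 p)
  then show ?case
    by (intro exI[of _ "Neg p"]) (simp add: sigma_fm_pi_fm.intros delta0.intros)
next
  case (3 n p)
  then show ?case using sigma_fm_pi_fm.intros(5) by blast
next
  case (4 n p x)
  then obtain p' where "pi_fm (Suc n) p'" "\<forall>M s. sat (M :: 'b struc) p' s \<longleftrightarrow> \<not> sat M p s" by blast
  then show ?case
    by (intro exI[of _ "All x p'"]) (simp add: sigma_fm_pi_fm.intros)
next
  case (5 n p)
  then show ?case using sigma_fm_pi_fm.intros(3) by blast
next
  case (6 n p x)
  then obtain p' where "sigma_fm (Suc n) p'" "\<forall>M s. sat (M :: 'b struc) p' s \<longleftrightarrow> \<not> sat M p s" by blast
  then show ?case
    by (intro exI[of _ "Ex x p'"]) (simp add: sigma_fm_pi_fm.intros)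
qed

text \<open>The rules contain no direct step from Sigma_n to Sigma_{n+1}, so the whole derivation is
  raised by one level. At the bottom a bounded formula reaches level 1 by way of the opposite
  class.\<close>

lemma sigma_pi_Suc:
  "sigma_fm n p \<Longrightarrow> sigma_fm (Suc n) p" "pi_fm n p \<Longrightarrow> pi_fm (Suc n) p"
proof (induction rule: sigma_fm_pi_fm.inducts)
  case (1 p)
  then show ?case by (rule sigma_fm_pi_fm.intros(3)[OF sigma_fm_pi_fm.intros(2)])
next
  case (2 p)
  then show ?case by (rule sigma_fm_pi_fm.intros(5)[OF sigma_fm_pi_fm.intros(1)])
next
  case (3 n p)
  then show ?case by (rule_tac sigma_fm_pi_fm.intros(3))
next
  case (4 n p x)
  then show ?case by (rule_tac sigma_fm_pi_fm.intros(4))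
next
  case (5 n p)
  then show ?case by (rule_tac sigma_fm_pi_fm.intros(5))
next
  case (6 n p x)
  then show ?case by (rule_tac sigma_fm_pi_fm.intros(6))
qed

lemma sigma_pi_mono:
  assumes "m \<le> n"
  shows "sigma_fm m p \<Longrightarrow> sigma_fm n p" "pi_fm m p \<Longrightarrow> pi_fm n p"
  using assms by (induction n rule: dec_induct) (simp_all add: sigma_pi_Suc)

lemma delta0_sigma: "delta0 p \<Longrightarrow> sigma_fm n p"
  using sigma_pi_mono(1)[of 0 n] sigma_fm_pi_fm.intros(1) by blast

lemma ISigma_0: "ISigma n M \<Longrightarrow> ISigma 0 M"
  unfolding ISigma_def by (meson sigma_pi_mono(1) zero_le)

section \<open>The axioms of PA^- as separate rules\<close>

lemma PAminusD:
  assumes "PAminus N"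
  shows
  "x \<in> carrier N \<Longrightarrow> y \<in> carrier N \<Longrightarrow> w \<in> carrier N \<Longrightarrow> plus N (plus N x y) w = plus N x (plus N y w)"
  "x \<in> carrier N \<Longrightarrow> y \<in> carrier N \<Longrightarrow> plus N x y = plus N y x"
  "x \<in> carrier N \<Longrightarrow> y \<in> carrier N \<Longrightarrow> w \<in> carrier N \<Longrightarrow> times N (times N x y) w = times N x (times N y w)"
  "x \<in> carrier N \<Longrightarrow> y \<in> carrier N \<Longrightarrow> times N x y = times N y x"
  "x \<in> carrier N \<Longrightarrow> y \<in> carrier N \<Longrightarrow> w \<in> carrier N \<Longrightarrow> times N x (plus N y w) = plus N (times N x y) (times N x w)"
  "x \<in> carrier N \<Longrightarrow> plus N x (zero N) = x"
  "x \<in> carrier N \<Longrightarrow> times N x (zero N) = zero N"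
  "x \<in> carrier N \<Longrightarrow> times N x (one N) = x"
  "x \<in> carrier N \<Longrightarrow> \<not> less N x x"
  "x \<in> carrier N \<Longrightarrow> y \<in> carrier N \<Longrightarrow> w \<in> carrier N \<Longrightarrow> less N x y \<Longrightarrow> less N y w \<Longrightarrow> less N x w"
  "x \<in> carrier N \<Longrightarrow> y \<in> carrier N \<Longrightarrow> less N x y \<or> x = y \<or> less N y x"
  "x \<in> carrier N \<Longrightarrow> y \<in> carrier N \<Longrightarrow> w \<in> carrier N \<Longrightarrow> less N x y \<Longrightarrow> less N (plus N x w) (plus N y w)"
  "x \<in> carrier N \<Longrightarrow> y \<in> carrier N \<Longrightarrow> w \<in> carrier N \<Longrightarrow> less N (zero N) w \<Longrightarrow> less N x y \<Longrightarrow> less N (times N x w) (times N y w)"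
  "x \<in> carrier N \<Longrightarrow> y \<in> carrier N \<Longrightarrow> less N x y \<Longrightarrow> \<exists>w\<in>carrier N. plus N x w = y"
  "less N (zero N) (one N)"
  "x \<in> carrier N \<Longrightarrow> less N (zero N) x \<Longrightarrow> one N = x \<or> less N (one N) x"
  "x \<in> carrier N \<Longrightarrow> x = zero N \<or> less N (zero N) x"
proof -
  note P = assms[unfolded PAminus_def Let_def]
  show "x \<in> carrier N \<Longrightarrow> y \<in> carrier N \<Longrightarrow> w \<in> carrier N \<Longrightarrow> plus N (plus N x y) w = plus N x (plus N y w)"
    using P[THEN conjunct1] by blast
  show "x \<in> carrier N \<Longrightarrow> y \<in> carrier N \<Longrightarrow> plus N x y = plus N y x"
    using P[THEN conjunct2, THEN conjunct1] by blast
  show "x \<in> carrier N \<Longrightarrow> y \<in> carrier N \<Longrightarrow> w \<in> carrier N \<Longrightarrow> times N (times N x y) w = times N x (times N y w)"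
    using P[THEN conjunct2, THEN conjunct2, THEN conjunct1] by blast
  show "x \<in> carrier N \<Longrightarrow> y \<in> carrier N \<Longrightarrow> times N x y = times N y x"
    using P[THEN conjunct2, THEN conjunct2, THEN conjunct2, THEN conjunct1] by blast
  show "x \<in> carrier N \<Longrightarrow> y \<in> carrier N \<Longrightarrow> w \<in> carrier N \<Longrightarrow> times N x (plus N y w) = plus N (times N x y) (times N x w)"
    using P[THEN conjunct2, THEN conjunct2, THEN conjunct2, THEN conjunct2, THEN conjunct1] by blast
  show "x \<in> carrier N \<Longrightarrow> plus N x (zero N) = x"
    using P[THEN conjunct2, THEN conjunct2, THEN conjunct2, THEN conjunct2, THEN conjunct2, THEN conjunct1] by blast
  show "x \<in> carrier N \<Longrightarrow> times N x (zero N) = zero N"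
    using P[THEN conjunct2, THEN conjunct2, THEN conjunct2, THEN conjunct2, THEN conjunct2, THEN conjunct1] by blast
  show "x \<in> carrier N \<Longrightarrow> times N x (one N) = x"
    using P[THEN conjunct2, THEN conjunct2, THEN conjunct2, THEN conjunct2, THEN conjunct2, THEN conjunct2, THEN conjunct1] by blast
  show "x \<in> carrier N \<Longrightarrow> \<not> less N x x"
    using P[THEN conjunct2, THEN conjunct2, THEN conjunct2, THEN conjunct2, THEN conjunct2, THEN conjunct2, THEN conjunct2, THEN conjunct1] by blast
  show "x \<in> carrier N \<Longrightarrow> y \<in> carrier N \<Longrightarrow> w \<in> carrier N \<Longrightarrow> less N x y \<Longrightarrow> less N y w \<Longrightarrow> less N x w"
    using P[THEN conjunct2, THEN conjunct2, THEN conjunct2, THEN conjunct2, THEN conjunct2, THEN conjunct2, THEN conjunct2, THEN conjunct2, THEN conjunct1] by blast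
  show "x \<in> carrier N \<Longrightarrow> y \<in> carrier N \<Longrightarrow> less N x y \<or> x = y \<or> less N y x"
    using P[THEN conjunct2, THEN conjunct2, THEN conjunct2, THEN conjunct2, THEN conjunct2, THEN conjunct2, THEN conjunct2, THEN conjunct2, THEN conjunct2, THEN conjunct1] by blast
  show "x \<in> carrier N \<Longrightarrow> y \<in> carrier N \<Longrightarrow> w \<in> carrier N \<Longrightarrow> less N x y \<Longrightarrow> less N (plus N x w) (plus N y w)"
    using P[THEN conjunct2, THEN conjunct2, THEN conjunct2, THEN conjunct2, THEN conjunct2, THEN conjunct2, THEN conjunct2, THEN conjunct2, THEN conjunct2, THEN conjunct2, THEN conjunct1] by blast
  show "x \<in> carrier N \<Longrightarrow> y \<in> carrier N \<Longrightarrow> w \<in> carrier N \<Longrightarrow> less N (zero N) w \<Longrightarrow> less N x y \<Longrightarrow> less N (times N x w) (times N y w)"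
    using P[THEN conjunct2, THEN conjunct2, THEN conjunct2, THEN conjunct2, THEN conjunct2, THEN conjunct2, THEN conjunct2, THEN conjunct2, THEN conjunct2, THEN conjunct2, THEN conjunct2, THEN conjunct1] by blast
  show "x \<in> carrier N \<Longrightarrow> y \<in> carrier N \<Longrightarrow> less N x y \<Longrightarrow> \<exists>w\<in>carrier N. plus N x w = y"
    using P[THEN conjunct2, THEN conjunct2, THEN conjunct2, THEN conjunct2, THEN conjunct2, THEN conjunct2, THEN conjunct2, THEN conjunct2, THEN conjunct2, THEN conjunct2, THEN conjunct2, THEN conjunct2, THEN conjunct1] by blast
  show "less N (zero N) (one N)"
    using P[THEN conjunct2, THEN conjunct2, THEN conjunct2, THEN conjunct2, THEN conjunct2, THEN conjunct2, THEN conjunct2, THEN conjunct2, THEN conjunct2, THEN conjunct2, THEN conjunct2, THEN conjunct2, THEN conjunct2, THEN conjunct1] by blast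
  show "x \<in> carrier N \<Longrightarrow> less N (zero N) x \<Longrightarrow> one N = x \<or> less N (one N) x"
    using P[THEN conjunct2, THEN conjunct2, THEN conjunct2, THEN conjunct2, THEN conjunct2, THEN conjunct2, THEN conjunct2, THEN conjunct2, THEN conjunct2, THEN conjunct2, THEN conjunct2, THEN conjunct2, THEN conjunct2, THEN conjunct2, THEN conjunct1] by blast
  show "x \<in> carrier N \<Longrightarrow> x = zero N \<or> less N (zero N) x"
    using P[THEN conjunct2, THEN conjunct2, THEN conjunct2, THEN conjunct2, THEN conjunct2, THEN conjunct2, THEN conjunct2, THEN conjunct2, THEN conjunct2, THEN conjunct2, THEN conjunct2, THEN conjunct2, THEN conjunct2, THEN conjunct2, THEN conjunct2] by blast
qed

section \<open>Boldface definability classes\<close>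

abbreviation push :: "'a \<Rightarrow> (nat \<Rightarrow> 'a) \<Rightarrow> nat \<Rightarrow> 'a" (infixr \<open>##\<close> 65) where
  "d ## s \<equiv> case_nat d s"

text \<open>With an abstract base class, the induction over one block of quantifiers is separated
  from the induction over the level of the hierarchy.\<close>

inductive ex_closure :: "(((nat \<Rightarrow> 'a) \<Rightarrow> bool) \<Rightarrow> bool) \<Rightarrow> ((nat \<Rightarrow> 'a) \<Rightarrow> bool) \<Rightarrow> bool"
  for B where
  base: "B P \<Longrightarrow> ex_closure B P"
| ex: "ex_closure B P \<Longrightarrow> ex_closure B (\<lambda>s. \<exists>d. P (d ## s))"

lemma ex_closure_subst:
  fixes T :: "((nat \<Rightarrow> 'a) \<Rightarrow> 'a) \<Rightarrow> bool"
  assumes "\<And>P f. B P \<Longrightarrow> (\<And>i. T (f i)) \<Longrightarrow> B (\<lambda>s. P (\<lambda>i. f i s))"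
    and "T (\<lambda>s. s 0)" and "\<And>f. T f \<Longrightarrow> T (\<lambda>s. f (\<lambda>i. s (Suc i)))"
  shows "ex_closure B P \<Longrightarrow> (\<And>i. T (f i)) \<Longrightarrow> ex_closure B (\<lambda>s. P (\<lambda>i. f i s))"
proof (induction arbitrary: f rule: ex_closure.induct)
  case (base P)
  show ?case by (rule ex_closure.base, rule assms(1)) (fact base)+
next
  case (ex P)
  \<comment> \<open>The substitution lifted under a binder: entry 0 is the bound variable itself,
    and all other entries are read past it.\<close>
  let ?g = "case_nat (\<lambda>s. s 0) (\<lambda>i s. f i (\<lambda>j. s (Suc j)))"
  have "T (?g i)" for i
    using assms(2) assms(3)[OF ex.prems] by (cases i) simp_all
  from ex_closure.ex[OF ex.IH[of ?g, OF this]]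
  have "ex_closure B (\<lambda>s. \<exists>d. P (\<lambda>i. ?g i (d ## s)))" .
  moreover have "(\<lambda>i. ?g i (d ## s)) = d ## (\<lambda>i. f i s)" for d s
    by (auto split: nat.split)
  ultimately show ?case by simp
qed

text \<open>With the whole type as carrier, the quantifiers of HOL are those of the structure and
  every environment is an assignment. Countable structures are brought into this form by
  \<open>pullback\<close> along a bijection with the natural numbers.\<close>

locale full_struc =
  fixes M :: "'a struc"
  assumes full: "carrier M = UNIV"
begin

inductive tmf :: "((nat \<Rightarrow> 'a) \<Rightarrow> 'a) \<Rightarrow> bool" where
  var: "tmf (\<lambda>s. s i)"
| const: "tmf (\<lambda>s. c)"
| plus: "tmf f \<Longrightarrow> tmf g \<Longrightarrow> tmf (\<lambda>s. plus M (f s) (g s))"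
| times: "tmf f \<Longrightarrow> tmf g \<Longrightarrow> tmf (\<lambda>s. times M (f s) (g s))"

inductive bD :: "((nat \<Rightarrow> 'a) \<Rightarrow> bool) \<Rightarrow> bool" where
  eq: "tmf f \<Longrightarrow> tmf g \<Longrightarrow> bD (\<lambda>s. f s = g s)"
| lt: "tmf f \<Longrightarrow> tmf g \<Longrightarrow> bD (\<lambda>s. less M (f s) (g s))"
| neg: "bD P \<Longrightarrow> bD (\<lambda>s. \<not> P s)"
| conj: "bD P \<Longrightarrow> bD Q \<Longrightarrow> bD (\<lambda>s. P s \<and> Q s)"
| bex: "tmf f \<Longrightarrow> bD P \<Longrightarrow> bD (\<lambda>s. \<exists>d. less M d (f s) \<and> P (d ## s))"

text \<open>The boldface classes: predicates of an environment that are definable with arbitrary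
  parameters by a bounded formula (\<open>bD\<close>), a \<open>\<Sigma>\<^sub>n\<close> formula (\<open>bS n\<close>) or a \<open>\<Pi>\<^sub>n\<close> formula (\<open>bP n\<close>).
  Quantifiers are in de Bruijn style, so that prenex operations need no renaming.\<close>

primrec bS :: "nat \<Rightarrow> ((nat \<Rightarrow> 'a) \<Rightarrow> bool) \<Rightarrow> bool" where
  "bS 0 = bD"
| "bS (Suc n) = ex_closure (\<lambda>P. bS n (\<lambda>s. \<not> P s))"

definition bP :: "nat \<Rightarrow> ((nat \<Rightarrow> 'a) \<Rightarrow> bool) \<Rightarrow> bool" where
  "bP n P = bS n (\<lambda>s. \<not> P s)"

lemma bS_Suc: "bS (Suc n) = ex_closure (bP n)"
  by (simp add: bP_def[abs_def])

lemma bP_neg: "bP n (\<lambda>s. \<not> P s) = bS n P"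
  by (simp add: bP_def)

lemma tmf_subst: "tmf g \<Longrightarrow> (\<And>i. tmf (f i)) \<Longrightarrow> tmf (\<lambda>s. g (\<lambda>i. f i s))"
  by (induction rule: tmf.induct) (simp_all add: tmf.const tmf.plus tmf.times)

lemma tmf_shift: "tmf f \<Longrightarrow> tmf (\<lambda>s. f (\<lambda>i. s (Suc i)))"
  by (rule tmf_subst[of f "\<lambda>i s. s (Suc i)"]) (simp_all add: tmf.var)

lemma bD_subst: "bD P \<Longrightarrow> (\<And>i. tmf (f i)) \<Longrightarrow> bD (\<lambda>s. P (\<lambda>i. f i s))"
proof (induction arbitrary: f rule: bD.induct)
  case (bex g P)
  let ?g = "case_nat (\<lambda>s. s 0) (\<lambda>i s. f i (\<lambda>j. s (Suc j)))"
  have "tmf (?g i)" for i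
    using tmf.var tmf_shift[OF bex.prems] by (cases i) simp_all
  from bD.bex[OF tmf_subst[OF bex.hyps(1), of f, OF bex.prems] bex.IH[of ?g, OF this]]
  have "bD (\<lambda>s. \<exists>d. less M d (g (\<lambda>i. f i s)) \<and> P (\<lambda>i. ?g i (d ## s)))" .
  moreover have "(\<lambda>i. ?g i (d ## s)) = d ## (\<lambda>i. f i s)" for d s
    by (auto split: nat.split)
  ultimately show ?case by simp
qed (simp_all add: bD.eq bD.lt bD.neg bD.conj tmf_subst)

lemma bS_subst: "bS n P \<Longrightarrow> (\<And>i. tmf (f i)) \<Longrightarrow> bS n (\<lambda>s. P (\<lambda>i. f i s))"
proof (induction n arbitrary: P f)
  case 0
  then show ?case by (simp add: bD_subst)
next
  case (Suc n)
  show ?case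
  proof -
    have "bP n (\<lambda>s. P (\<lambda>i. f i s))" if "bP n P" "\<And>i. tmf (f i)" for P f
      using Suc.IH[of "\<lambda>s. \<not> P s" f] that unfolding bP_def by blast
    then show ?thesis
      using Suc.prems unfolding bS_Suc
      by (rule_tac ex_closure_subst[where T = tmf]) (simp_all add: tmf.var tmf_shift)
  qed
qed

lemma bP_subst: "bP n P \<Longrightarrow> (\<And>i. tmf (f i)) \<Longrightarrow> bP n (\<lambda>s. P (\<lambda>i. f i s))"
  unfolding bP_def by (rule bS_subst)

lemma bD_disj: "bD P \<Longrightarrow> bD Q \<Longrightarrow> bD (\<lambda>s. P s \<or> Q s)"
  using bD.neg[OF bD.conj[OF bD.neg bD.neg], of P Q] by simp

lemma bD_imp: "bD P \<Longrightarrow> bD Q \<Longrightarrow> bD (\<lambda>s. P s \<longrightarrow> Q s)"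
  unfolding imp_conv_disj by (rule bD_disj[OF bD.neg])

lemma bD_iff: "bD P \<Longrightarrow> bD Q \<Longrightarrow> bD (\<lambda>s. P s \<longleftrightarrow> Q s)"
  unfolding iff_conv_conj_imp by (rule bD.conj[OF bD_imp bD_imp])

lemma bD_const: "bD (\<lambda>s. b)"
  by (cases b) (use bD.eq[OF tmf.const tmf.const, of "zero M" "zero M"] bD.neg in fastforce)+

lemma bD_bex:
  assumes "tmf f" "bD (\<lambda>s. Q (\<lambda>i. s (Suc i)) (s 0))"
  shows "bD (\<lambda>s. \<exists>d. less M d (f s) \<and> Q s d)"
  using bD.bex[OF assms] by simp

lemma bD_ball:
  assumes "tmf f" "bD (\<lambda>s. Q (\<lambda>i. s (Suc i)) (s 0))"
  shows "bD (\<lambda>s. \<forall>d. less M d (f s) \<longrightarrow> Q s d)"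
  using bD.neg[OF bD_bex[OF assms(1) bD.neg[OF assms(2)]]] by simp

text \<open>Quantifiers are pulled out one at a time, first those of \<open>P\<close>, then those of
  \<open>Q\<close>, while the other predicate is shifted past the new variable. For the disjunction
  this relies on types being inhabited.\<close>

lemma ex_closure_conj_disj:
  assumes "\<And>P Q. bP n P \<Longrightarrow> bP n Q \<Longrightarrow> bP n (\<lambda>s. P s \<and> Q s)"
    and "\<And>P Q. bP n P \<Longrightarrow> bP n Q \<Longrightarrow> bP n (\<lambda>s. P s \<or> Q s)"
  shows "bS (Suc n) P \<Longrightarrow> bS (Suc n) Q \<Longrightarrow>
    bS (Suc n) (\<lambda>s. P s \<and> Q s) \<and> bS (Suc n) (\<lambda>s. P s \<or> Q s)"
  unfolding bS_Suc
proof (induction arbitrary: Q rule: ex_closure.induct)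
  case (base P)
  from base(2,1) show ?case
  proof (induction arbitrary: P rule: ex_closure.induct)
    case (base Q)
    then show ?case using assms by (blast intro: ex_closure.base)
  next
    case (ex Q)
    have "bP n (\<lambda>s. P (\<lambda>i. s (Suc i)))"
      using ex.prems by (rule bP_subst) (rule tmf.var)
    from ex.IH[OF this] ex_closure.ex
    have "ex_closure (bP n) (\<lambda>s. \<exists>d. P s \<and> Q (d ## s))"
      "ex_closure (bP n) (\<lambda>s. \<exists>d. P s \<or> Q (d ## s))"
      by fastforce+
    then show ?case by simp
  qed
next
  case (ex P)
  have "ex_closure (bP n) (\<lambda>s. Q (\<lambda>i. s (Suc i)))"
    using ex.prems bS_subst[of "Suc n" Q "\<lambda>i s. s (Suc i)"] tmf.var unfolding bS_Suc by blast
  from ex.IH[OF this] ex_closure.ex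
  have "ex_closure (bP n) (\<lambda>s. \<exists>d. P (d ## s) \<and> Q s)"
    "ex_closure (bP n) (\<lambda>s. \<exists>d. P (d ## s) \<or> Q s)"
    by fastforce+
  then show ?case by simp
qed

lemma bS_conj_disj:
  "bS n P \<Longrightarrow> bS n Q \<Longrightarrow> bS n (\<lambda>s. P s \<and> Q s) \<and> bS n (\<lambda>s. P s \<or> Q s)"
proof (induction n arbitrary: P Q)
  case 0
  then show ?case by (simp add: bD.conj bD_disj)
next
  case (Suc n)
  show ?case
  proof (rule ex_closure_conj_disj[OF _ _ Suc.prems])
    fix P Q assume *: "bP n P" "bP n Q"
    then show "bP n (\<lambda>s. P s \<and> Q s)" "bP n (\<lambda>s. P s \<or> Q s)"
      using Suc.IH[of "\<lambda>s. \<not> P s" "\<lambda>s. \<not> Q s"] unfolding bP_def de_Morgan_conj de_Morgan_disj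
      by blast+
  qed
qed

lemma bS_conj: "bS n P \<Longrightarrow> bS n Q \<Longrightarrow> bS n (\<lambda>s. P s \<and> Q s)"
  and bS_disj: "bS n P \<Longrightarrow> bS n Q \<Longrightarrow> bS n (\<lambda>s. P s \<or> Q s)"
  using bS_conj_disj by blast+

lemma bP_conj: "bP n P \<Longrightarrow> bP n Q \<Longrightarrow> bP n (\<lambda>s. P s \<and> Q s)"
  unfolding bP_def using bS_disj[of n "\<lambda>s. \<not> P s" "\<lambda>s. \<not> Q s"] by simp

lemma bP_imp: "bS n P \<Longrightarrow> bP n Q \<Longrightarrow> bP n (\<lambda>s. P s \<longrightarrow> Q s)"
  unfolding bP_def using bS_conj[of n P "\<lambda>s. \<not> Q s"] by simp

lemma bS_of_bD: "bD P \<Longrightarrow> bS n P"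
proof (induction n arbitrary: P)
  case (Suc n)
  have "bS n (\<lambda>s. \<not> P s)" by (rule Suc.IH, rule bD.neg) fact
  then show ?case unfolding bS.simps by (rule ex_closure.base[of "\<lambda>P. bS n (\<lambda>s. \<not> P s)"])
qed simp

lemma bP_of_bD: "bD P \<Longrightarrow> bP n P"
  unfolding bP_def by (intro bS_of_bD bD.neg)

lemma bS_of_bP: "bP n P \<Longrightarrow> bS (Suc n) P"
  unfolding bS_Suc by (rule ex_closure.base[of "bP n"])

lemma bS_ex: "bS (Suc n) (\<lambda>s. Q (\<lambda>i. s (Suc i)) (s 0)) \<Longrightarrow> bS (Suc n) (\<lambda>s. \<exists>d. Q s d)"
  unfolding bS_Suc using ex_closure.ex by fastforce

text \<open>Bounded quantifiers are absorbed only where they match the class: existential ones by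
  Sigma, universal ones by Pi. The other combination would call for collection, and the formulas
  below are arranged so that it does not occur.\<close>

lemma bS_bex:
  assumes "tmf f" "bS n (\<lambda>s. Q (\<lambda>i. s (Suc i)) (s 0))"
  shows "bS n (\<lambda>s. \<exists>d. less M d (f s) \<and> Q s d)"
proof (cases n)
  case 0
  then show ?thesis using assms bD_bex by simp
next
  case (Suc m)
  show ?thesis unfolding Suc
    by (rule bS_ex, rule bS_conj)
      (use assms Suc in \<open>auto intro!: bS_of_bD bD.lt tmf.var tmf_shift simp del: bS.simps\<close>)
qed

lemma bP_ball:
  assumes "tmf f" "bP n (\<lambda>s. Q (\<lambda>i. s (Suc i)) (s 0))"
  shows "bP n (\<lambda>s. \<forall>d. less M d (f s) \<longrightarrow> Q s d)"
  using bS_bex[OF assms(1), of n "\<lambda>s d. \<not> Q s d"] assms(2) unfolding bP_def by simp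

lemma bS_Suc_mono: "bS n P \<Longrightarrow> bS (Suc n) P"
proof (induction n arbitrary: P)
  case 0
  then show ?case using bS_of_bD[of P "Suc 0"] by (simp del: bS.simps(2))
next
  case (Suc n)
  have *: "ex_closure (bP n) P \<Longrightarrow> ex_closure (bP (Suc n)) P" for P
  proof (induction rule: ex_closure.induct)
    case (base P)
    then have "bP (Suc n) P" unfolding bP_def by (rule Suc.IH)
    then show ?case by (rule ex_closure.base[of "bP (Suc n)" P])
  next
    case (ex P)
    show ?case using ex.IH by (rule ex_closure.ex)
  qed
  then show ?case using Suc.prems unfolding bS_Suc by blast
qed

lemma bS_mono: "m \<le> n \<Longrightarrow> bS m P \<Longrightarrow> bS n P"
  by (induction n rule: dec_induct) (use bS_Suc_mono in \<open>auto simp del: bS.simps\<close>)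

section \<open>From formulas to boldface classes\<close>

lemma tmf_eval: "tmf (\<lambda>s. eval M s t)"
  by (induction t) (simp_all add: tmf.intros)

lemma bD_upd:
  assumes "bD P"
  shows "bD (\<lambda>s. P ((\<lambda>i. s (Suc i))(x := s 0)))"
proof -
  have "bD (\<lambda>s. P (\<lambda>i. (if i = x then (\<lambda>s. s 0) else (\<lambda>s. s (Suc i))) s))"
    by (rule bD_subst[OF assms]) (auto intro: tmf.var)
  moreover have "(\<lambda>i. (if i = x then (\<lambda>s. s 0) else (\<lambda>s. s (Suc i))) s)
      = (\<lambda>i. s (Suc i))(x := s 0)" for s :: "nat \<Rightarrow> 'a"
    by auto
  ultimately show ?thesis by simp
qed

lemma bS_upd:
  assumes "bS n P"
  shows "bS n (\<lambda>s. P ((\<lambda>i. s (Suc i))(x := s 0)))"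
proof -
  have "bS n (\<lambda>s. P (\<lambda>i. (if i = x then (\<lambda>s. s 0) else (\<lambda>s. s (Suc i))) s))"
    by (rule bS_subst[OF assms]) (auto intro: tmf.var)
  moreover have "(\<lambda>i. (if i = x then (\<lambda>s. s 0) else (\<lambda>s. s (Suc i))) s)
      = (\<lambda>i. s (Suc i))(x := s 0)" for s :: "nat \<Rightarrow> 'a"
    by auto
  ultimately show ?thesis by simp
qed

lemma sat_fun:
  "sat M (Eq t u) = (\<lambda>s. eval M s t = eval M s u)"
  "sat M (Lt t u) = (\<lambda>s. less M (eval M s t) (eval M s u))"
  "sat M (Neg p) = (\<lambda>s. \<not> sat M p s)"
  "sat M (Conj p q) = (\<lambda>s. sat M p s \<and> sat M q s)"
  "sat M (Disj p q) = (\<lambda>s. sat M p s \<or> sat M q s)"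
  "sat M (Ex x p) = (\<lambda>s. \<exists>d. sat M p (s(x := d)))"
  "sat M (All x p) = (\<lambda>s. \<forall>d. sat M p (s(x := d)))"
  "sat M (BEx x t p) = (\<lambda>s. \<exists>d. less M d (eval M s t) \<and> sat M p (s(x := d)))"
  "sat M (BAll x t p) = (\<lambda>s. \<forall>d. less M d (eval M s t) \<longrightarrow> sat M p (s(x := d)))"
  by (auto simp: full fun_eq_iff)

lemma bD_sat: "delta0 p \<Longrightarrow> bD (sat M p)"
proof (induction rule: delta0.induct)
  case (1 t u)
  show ?case unfolding sat_fun by (rule bD.eq) (rule tmf_eval)+
next
  case (2 t u)
  show ?case unfolding sat_fun by (rule bD.lt) (rule tmf_eval)+
next
  case (3 p)
  show ?case unfolding sat_fun by (rule bD.neg) (fact 3)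
next
  case (4 p q)
  show ?case unfolding sat_fun by (rule bD.conj) (fact 4)+
next
  case (5 p q)
  show ?case unfolding sat_fun by (rule bD_disj) (fact 5)+
next
  case (6 x t p)
  show ?case unfolding sat_fun by (rule bD_bex[OF tmf_eval bD_upd]) (fact 6)
next
  case (7 x t p)
  show ?case unfolding sat_fun by (rule bD_ball[OF tmf_eval bD_upd]) (fact 7)
qed

lemma bS_sat:
  "sigma_fm n p \<Longrightarrow> bS n (sat M p)" "pi_fm n p \<Longrightarrow> bP n (sat M p)"
proof (induction rule: sigma_fm_pi_fm.inducts)
  case (1 p)
  then show ?case by (simp add: bD_sat)
next
  case (2 p)
  then show ?case by (intro bP_of_bD bD_sat)
next
  case (3 n p)
  show ?case by (rule bS_of_bP) fact
next
  case (4 n p x)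
  show ?case unfolding sat_fun by (rule bS_ex, rule bS_upd) fact
next
  case (5 n p)
  show ?case unfolding bP_def by (rule bS_of_bP) (use 5 in \<open>simp add: bP_neg\<close>)
next
  case (6 n p x)
  show ?case unfolding bP_def sat_fun not_all
    by (rule bS_ex, rule bS_upd) (use 6 in \<open>simp only: bP_def\<close>)
qed

text \<open>For the way back from boldface classes to formulas: formulas contain no parameters, so a
  predicate is represented by a formula together with a table \<open>r\<close> telling for each of
  its variables whether it reads the environment (\<open>Inl\<close>) or denotes a fixed parameter
  (\<open>Inr\<close>).\<close>

definition lookup :: "(nat \<Rightarrow> nat + 'a) \<Rightarrow> (nat \<Rightarrow> 'a) \<Rightarrow> nat \<Rightarrow> 'a" where
  "lookup r s i = (case r i of Inl j \<Rightarrow> s j | Inr c \<Rightarrow> c)"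

text \<open>Keeps the tables of two subformulas apart: one uses the even variables, the other the
  odd ones.\<close>

definition join :: "(nat \<Rightarrow> 'x) \<Rightarrow> (nat \<Rightarrow> 'x) \<Rightarrow> nat \<Rightarrow> 'x" where
  "join r q i = (if even i then r (i div 2) else q (i div 2))"

lemma lookup_join:
  "lookup (join r q) s (2 * i) = lookup r s i"
  "lookup (join r q) s (Suc (2 * i)) = lookup q s i"
  by (simp_all add: lookup_def join_def)

text \<open>The table seen from outside a quantifier. The entry for \<open>Inl 0\<close> is a dummy,
  as \<open>lookup_push\<close> treats the bound variable separately.\<close>

definition lower :: "(nat \<Rightarrow> nat + 'a) \<Rightarrow> nat \<Rightarrow> nat + 'a" where
  "lower r i = (case r i of Inl 0 \<Rightarrow> Inr (zero M) | Inl (Suc j) \<Rightarrow> Inl j | Inr c \<Rightarrow> Inr c)"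

lemma lookup_push:
  "lookup r (d ## s) i = (if r i = Inl 0 then d else lookup (lower r) s i)"
  by (auto simp: lookup_def lower_def split: sum.split nat.split)

lemma tmf_repr: "tmf f \<Longrightarrow> \<exists>t r. \<forall>s. f s = eval M (lookup r s) t"
proof (induction rule: tmf.induct)
  case (var i)
  show ?case by (rule exI[of _ "Var 0"], rule exI[of _ "\<lambda>_. Inl i"]) (simp add: lookup_def)
next
  case (const c)
  show ?case by (rule exI[of _ "Var 0"], rule exI[of _ "\<lambda>_. Inr c"]) (simp add: lookup_def)
next
  case (plus f g)
  then obtain t r u q where "\<And>s. f s = eval M (lookup r s) t" "\<And>s. g s = eval M (lookup q s) u"
    by metis
  then show ?case
    by (intro exI[of _ "Plus (rename_trm ((*) 2) t) (rename_trm (\<lambda>i. Suc (2 * i)) u)"] exI[of _ "join r q"])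
      (simp add: eval_rename_trm lookup_join)
next
  case (times f g)
  then obtain t r u q where "\<And>s. f s = eval M (lookup r s) t" "\<And>s. g s = eval M (lookup q s) u"
    by metis
  then show ?case
    by (intro exI[of _ "Times (rename_trm ((*) 2) t) (rename_trm (\<lambda>i. Suc (2 * i)) u)"] exI[of _ "join r q"])
      (simp add: eval_rename_trm lookup_join)
qed

lemma tmf_repr2:
  assumes "tmf f" "tmf g"
  shows "\<exists>t u r. (\<forall>s. f s = eval M (lookup r s) t) \<and> (\<forall>s. g s = eval M (lookup r s) u)"
proof -
  obtain t r u q where "\<And>s. f s = eval M (lookup r s) t" "\<And>s. g s = eval M (lookup q s) u"
    using tmf_repr assms by metis
  then show ?thesis
    by (intro exI[of _ "rename_trm ((*) 2) t"] exI[of _ "rename_trm (\<lambda>i. Suc (2 * i)) u"] exI[of _ "join r q"])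
      (simp add: eval_rename_trm lookup_join)
qed

lemma bD_repr: "bD P \<Longrightarrow> \<exists>p r. delta0 p \<and> (\<forall>s. P s = sat M p (lookup r s))"
proof (induction rule: bD.induct)
  case (eq f g)
  then obtain t u r where "\<forall>s. f s = eval M (lookup r s) t" "\<forall>s. g s = eval M (lookup r s) u"
    using tmf_repr2 by blast
  then show ?case by (intro exI[of _ "Eq t u"] exI[of _ r]) (simp add: delta0.intros)
next
  case (lt f g)
  then obtain t u r where "\<forall>s. f s = eval M (lookup r s) t" "\<forall>s. g s = eval M (lookup r s) u"
    using tmf_repr2 by blast
  then show ?case by (intro exI[of _ "Lt t u"] exI[of _ r]) (simp add: delta0.intros)
next
  case (neg P)
  then obtain p r where "delta0 p" "\<forall>s. P s = sat M p (lookup r s)" by blast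
  then show ?case by (intro exI[of _ "Neg p"] exI[of _ r]) (simp add: delta0.intros)
next
  case (conj P Q)
  then obtain p r q r' where
    "delta0 p" "\<forall>s. P s = sat M p (lookup r s)" "delta0 q" "\<forall>s. Q s = sat M q (lookup r' s)"
    by blast
  moreover obtain p' where "delta0 p'" "\<forall>s. sat M p' s = sat M p (\<lambda>i. s (2 * i))"
    using rename_delta0[OF \<open>delta0 p\<close>, of M "(*) 2"] by blast
  moreover obtain q' where "delta0 q'" "\<forall>s. sat M q' s = sat M q (\<lambda>i. s (Suc (2 * i)))"
    using rename_delta0[OF \<open>delta0 q\<close>, of M "\<lambda>i. Suc (2 * i)"] by blast
  ultimately show ?case
    by (intro exI[of _ "Conj p' q'"] exI[of _ "join r r'"]) (simp add: delta0.intros lookup_join)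
next
  case (bex f P)
  then obtain p r where p: "delta0 p" "\<And>s. P s = sat M p (lookup r s)" by blast
  obtain t q where t: "\<And>s. f s = eval M (lookup q s) t" using tmf_repr[OF bex.hyps(1)] by blast
  \<comment> \<open>Layout of the variables: 0 is the bound variable, the even ones from 2 on belong
    to the bound \<open>t'\<close>, the odd ones to the rest of \<open>p\<close>. Several variables
    of \<open>p\<close> may read the bound one, so \<open>h\<close> need not be injective.\<close>
  define h where "h i = (if r i = Inl 0 then 0 else Suc (2 * i))" for i
  obtain p' where p': "delta0 p'" "\<And>s. sat M p' s = sat M p (\<lambda>i. s (h i))"
    using rename_delta0[OF p(1), of M h] by blast
  define t' where "t' = rename_trm (\<lambda>i. 2 * (i + 1)) t"
  define r' where "r' = join (case_nat (Inr (zero M)) q) (lower r)"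
  have 1: "eval M (lookup r' s) t' = f s" for s
  proof -
    have "lookup r' s (2 * (i + 1)) = lookup q s i" for i
      unfolding r'_def by (subst lookup_join) (simp add: lookup_def)
    then show ?thesis by (simp add: t'_def t eval_rename_trm)
  qed
  have 2: "sat M p' ((lookup r' s)(0 := d)) = P (d ## s)" for s d
  proof -
    have "(\<lambda>i. ((lookup r' s)(0 := d)) (h i)) = lookup r (d ## s)"
      by (auto simp: h_def lookup_push r'_def lookup_join)
    then show ?thesis by (simp add: p p')
  qed
  have "0 \<notin> vars_trm t'" by (auto simp: t'_def vars_rename_trm)
  then show ?case
    using p'(1) 1 2 by (intro exI[of _ "BEx 0 t' p'"] exI[of _ r']) (simp add: delta0.intros full)
qed

lemma bS_repr:
  "bS n P \<Longrightarrow> \<exists>p r. sigma_fm n p \<and> (\<forall>s. P s = sat M p (lookup r s))"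
proof (induction n arbitrary: P)
  case 0
  then show ?case using bD_repr sigma_fm_pi_fm.intros(1) by simp blast
next
  case (Suc n)
  from Suc.prems show ?case unfolding bS_Suc
  proof (induction rule: ex_closure.induct)
    case (base P)
    then obtain p r where p: "sigma_fm n p" "\<And>s. (\<not> P s) = sat M p (lookup r s)"
      using Suc.IH[of "\<lambda>s. \<not> P s"] unfolding bP_def by blast
    obtain p' where "pi_fm n p'" "\<And>s. sat M p' s \<longleftrightarrow> \<not> sat M p s"
      using neg_sigma_pi(1)[OF p(1)] by blast
    then show ?case using p(2) by (metis sigma_fm_pi_fm.intros(3))
  next
    case (ex P)
    then obtain p r where p: "sigma_fm (Suc n) p" "\<And>s. P s = sat M p (lookup r s)" by blast
    define h where "h i = (if r i = Inl 0 then 0 else Suc i)" for i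
    obtain p' where p': "sigma_fm (Suc n) p'" "\<And>s. sat M p' s = sat M p (\<lambda>i. s (h i))"
      using rename_sigma_pi(1)[OF p(1), of M] by blast
    define r' where "r' = case_nat (Inr (zero M)) (lower r)"
    have 2: "sat M p' ((lookup r' s)(0 := d)) = P (d ## s)" for s d
    proof -
      have "(\<lambda>i. ((lookup r' s)(0 := d)) (h i)) = lookup r (d ## s)"
        unfolding lookup_push by (auto simp: h_def r'_def lookup_def)
      then show ?thesis by (simp add: p p')
    qed
    then show ?case
      using p'(1) by (intro exI[of _ "Ex 0 p'"] exI[of _ r']) (simp add: sigma_fm_pi_fm.intros full)
  qed
qed

lemma bS_induct:
  assumes "ISigma n M" and "bS n (\<lambda>s. P (s 0))"
    and "P (zero M)" and "\<And>x. P x \<Longrightarrow> P (plus M x (one M))"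
  shows "P x"
proof -
  obtain p r where p: "sigma_fm n p" "\<And>s. P (s 0) = sat M p (lookup r s)"
    using bS_repr[OF assms(2)] by blast
  define h where "h i = (if r i = Inl 0 then 0 else Suc i)" for i
  obtain p' where p': "sigma_fm n p'" "\<And>s. sat M p' s = sat M p (\<lambda>i. s (h i))"
    using rename_sigma_pi(1)[OF p(1), of M] by blast
  define s where "s = lookup (case_nat (Inr (zero M)) (lower r)) (\<lambda>_. zero M)"
  have *: "sat M p' (s(0 := d)) = P d" for d
  proof -
    have "(\<lambda>i. (s(0 := d)) (h i)) = lookup r (d ## (\<lambda>_. zero M))"
      unfolding lookup_push by (auto simp: h_def s_def lookup_def)
    then show ?thesis using p(2)[of "d ## (\<lambda>_. zero M)"] by (simp add: p')
  qed
  have "assign M s" by (simp add: assign_def full)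
  with assms(1) p'(1) show ?thesis
    unfolding ISigma_def using * assms(3,4) full by (metis UNIV_I)
qed

text \<open>Induction as it is used to find extremal objects: the greatest length of a coded choice
  list in \<open>uniformize_Pi\<close> and the jump of an induction formula in
  \<open>ISigma_N\<close>.\<close>

lemma bS_last:
  assumes "ISigma n M" and "bS n (\<lambda>s. P (s 0))" and "P (zero M)" and "\<not> P x"
  shows "\<exists>y. P y \<and> \<not> P (plus M y (one M))"
  using bS_induct[of n P x] assms by blast

end

section \<open>Arithmetic and binary coding of sets\<close>

locale full_PAminus = full_struc +
  assumes PAminus: "PAminus M"
begin

abbreviation add (infixl \<open>\<oplus>\<close> 65) where "x \<oplus> y \<equiv> plus M x y"
abbreviation mul (infixl \<open>\<otimes>\<close> 70) where "x \<otimes> y \<equiv> times M x y"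
abbreviation lt (infix \<open>\<prec>\<close> 50) where "x \<prec> y \<equiv> less M x y"
abbreviation le (infix \<open>\<preceq>\<close> 50) where "x \<preceq> y \<equiv> leq M x y"
abbreviation zer (\<open>\<zero>\<close>) where "\<zero> \<equiv> zero M"
abbreviation on (\<open>\<one>\<close>) where "\<one> \<equiv> one M"

text \<open>Truncated subtraction. It completes the ordered semiring to an instance of
  \<open>linordered_semidom\<close>, which makes arithmetic and order reasoning available for
  \<open>\<oplus>\<close>, \<open>\<otimes>\<close> and \<open>\<prec>\<close>.\<close>

definition diff :: "'a \<Rightarrow> 'a \<Rightarrow> 'a" where
  "diff x y = (if y \<preceq> x then THE w. y \<oplus> w = x else \<zero>)"

lemma PA:
  "(x \<oplus> y) \<oplus> w = x \<oplus> (y \<oplus> w)"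
  "x \<oplus> y = y \<oplus> x"
  "(x \<otimes> y) \<otimes> w = x \<otimes> (y \<otimes> w)"
  "x \<otimes> y = y \<otimes> x"
  "x \<otimes> (y \<oplus> w) = x \<otimes> y \<oplus> x \<otimes> w"
  "x \<oplus> \<zero> = x"
  "x \<otimes> \<zero> = \<zero>"
  "x \<otimes> \<one> = x"
  "\<not> x \<prec> x"
  "x \<prec> y \<Longrightarrow> y \<prec> w \<Longrightarrow> x \<prec> w"
  "x \<prec> y \<or> x = y \<or> y \<prec> x"
  "x \<prec> y \<Longrightarrow> x \<oplus> w \<prec> y \<oplus> w"
  "\<zero> \<prec> w \<Longrightarrow> x \<prec> y \<Longrightarrow> x \<otimes> w \<prec> y \<otimes> w"
  "x \<prec> y \<Longrightarrow> \<exists>w. x \<oplus> w = y"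
  "\<zero> \<prec> \<one>"
  "\<zero> \<prec> x \<Longrightarrow> \<one> = x \<or> \<one> \<prec> x"
  "x = \<zero> \<or> \<zero> \<prec> x"
proof -
  note P = PAminusD[OF PAminus, unfolded full]
  show "(x \<oplus> y) \<oplus> w = x \<oplus> (y \<oplus> w)" using P(1) by blast
  show "x \<oplus> y = y \<oplus> x" using P(2) by blast
  show "(x \<otimes> y) \<otimes> w = x \<otimes> (y \<otimes> w)" using P(3) by blast
  show "x \<otimes> y = y \<otimes> x" using P(4) by blast
  show "x \<otimes> (y \<oplus> w) = x \<otimes> y \<oplus> x \<otimes> w" using P(5) by blast
  show "x \<oplus> \<zero> = x" using P(6) by blast
  show "x \<otimes> \<zero> = \<zero>" using P(7) by blast
  show "x \<otimes> \<one> = x" using P(8) by blast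
  show "\<not> x \<prec> x" using P(9) by blast
  show "x \<prec> y \<Longrightarrow> y \<prec> w \<Longrightarrow> x \<prec> w" using P(10) by blast
  show "x \<prec> y \<or> x = y \<or> y \<prec> x" using P(11) by blast
  show "x \<prec> y \<Longrightarrow> x \<oplus> w \<prec> y \<oplus> w" using P(12) by blast
  show "\<zero> \<prec> w \<Longrightarrow> x \<prec> y \<Longrightarrow> x \<otimes> w \<prec> y \<otimes> w" using P(13) by blast
  show "x \<prec> y \<Longrightarrow> \<exists>w. x \<oplus> w = y" using P(14) by blast
  show "\<zero> \<prec> \<one>" using P(15) by blast
  show "\<zero> \<prec> x \<Longrightarrow> \<one> = x \<or> \<one> \<prec> x" using P(16) by blast
  show "x = \<zero> \<or> \<zero> \<prec> x" using P(17) by blast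
qed

lemma add_cancel: "x \<oplus> y = x \<oplus> w \<longleftrightarrow> y = w"
  by (metis PA(2,9,11,12))

lemma le_iff: "x \<preceq> y \<longleftrightarrow> (\<exists>w. x \<oplus> w = y)"
proof
  assume "x \<preceq> y"
  then show "\<exists>w. x \<oplus> w = y" unfolding leq_def using PA(6,14) by blast
next
  assume "\<exists>w. x \<oplus> w = y"
  then obtain w where "x \<oplus> w = y" by blast
  then show "x \<preceq> y" unfolding leq_def using PA(12)[of \<zero> w x] PA(17)[of w] PA(2,6) by metis
qed

lemma diff_add: "diff (y \<oplus> w) y = w"
proof -
  have "y \<preceq> y \<oplus> w" using le_iff by blast
  then show ?thesis unfolding diff_def by (simp add: add_cancel)
qed

lemma diff_lt: "x \<prec> y \<Longrightarrow> diff x y = \<zero>"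
  unfolding diff_def leq_def using PA(9,10) by metis

sublocale ar: linordered_semidom
  where plus = "plus M" and zero = "zero M" and times = "times M" and one = "one M"
    and minus = diff and less_eq = "leq M" and less = "less M"
proof
  fix a b c :: 'a
  show "a \<oplus> b \<oplus> c = a \<oplus> (b \<oplus> c)" by (rule PA(1))
  show "a \<oplus> b = b \<oplus> a" by (rule PA(2))
  show "\<zero> \<oplus> a = a" using PA(2,6) by metis
  show "a \<otimes> b \<otimes> c = a \<otimes> (b \<otimes> c)" by (rule PA(3))
  show "a \<otimes> b = b \<otimes> a" by (rule PA(4))
  show "\<one> \<otimes> a = a" using PA(4,8) by metis
  show "(a \<oplus> b) \<otimes> c = a \<otimes> c \<oplus> b \<otimes> c" using PA(4,5) by metis
  show "a \<otimes> (b \<oplus> c) = a \<otimes> b \<oplus> a \<otimes> c" by (rule PA(5))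
  show "\<zero> \<otimes> a = \<zero>" "a \<otimes> \<zero> = \<zero>" using PA(4,7) by metis+
  show "\<zero> \<noteq> \<one>" using PA(9,15) by metis
  show "diff (a \<oplus> b) a = b" by (rule diff_add)
  show "(a \<prec> b) = (a \<preceq> b \<and> \<not> b \<preceq> a)" unfolding leq_def using PA(9,10) by metis
  show "a \<preceq> a" unfolding leq_def by simp
  show "a \<preceq> b \<Longrightarrow> b \<preceq> c \<Longrightarrow> a \<preceq> c" unfolding leq_def using PA(10) by metis
  show "a \<preceq> b \<Longrightarrow> b \<preceq> a \<Longrightarrow> a = b" unfolding leq_def using PA(9,10) by metis
  show "a \<preceq> b \<or> b \<preceq> a" unfolding leq_def using PA(11) by metis
  show "a \<preceq> b \<Longrightarrow> c \<oplus> a \<preceq> c \<oplus> b" unfolding le_iff using PA(1) by metis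
  show "a \<prec> b \<Longrightarrow> \<zero> \<prec> c \<Longrightarrow> c \<otimes> a \<prec> c \<otimes> b" using PA(4,13) by metis
  show "\<zero> \<prec> \<one>" by (rule PA(15))
  show "a \<noteq> \<zero> \<Longrightarrow> b \<noteq> \<zero> \<Longrightarrow> a \<otimes> b \<noteq> \<zero>"
    using PA(13)[of b \<zero> a] PA(17)[of a] PA(17)[of b] PA(4,7,9) by metis
  show "b \<preceq> a \<Longrightarrow> diff a b \<oplus> b = a" unfolding le_iff using diff_add PA(2) by metis
  have cases: "a \<prec> b \<or> (\<exists>w. a = b \<oplus> w)" for a b
    using PA(11)[of a b] PA(6)[of b] PA(14)[of b a] by metis
  have le_add: "a \<prec> b \<Longrightarrow> a \<prec> b \<oplus> c" for a b c
    using le_iff[of b "b \<oplus> c"] PA(10)[of a b "b \<oplus> c"] unfolding leq_def by metis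
  have zdiff: "diff \<zero> a = \<zero>" for a
    using PA(17)[of a] diff_lt[of \<zero> a] diff_add[of \<zero> \<zero>] PA(6)[of \<zero>] by metis
  show "diff (diff a b) c = diff a (b \<oplus> c)"
  proof (cases "a \<prec> b")
    case True
    then show ?thesis using le_add diff_lt zdiff by metis
  next
    case False
    then obtain w where w: "a = b \<oplus> w" using cases by blast
    show ?thesis
    proof (cases "w \<prec> c")
      case True
      then have "a \<prec> b \<oplus> c" unfolding w using PA(2,12) by metis
      then show ?thesis using True diff_lt diff_add w by metis
    next
      case False
      then obtain v where "w = c \<oplus> v" using cases by blast
      then have "a = (b \<oplus> c) \<oplus> v" using w PA(1) by metis
      then show ?thesis using \<open>w = c \<oplus> v\<close> diff_add w by metis
    qed
  qed
  show "c \<otimes> diff a b = diff (c \<otimes> a) (c \<otimes> b)"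
  proof (cases "a \<prec> b")
    case True
    show ?thesis
    proof (cases "c = \<zero>")
      case True
      then show ?thesis using zdiff PA(4,7) by metis
    next
      case False
      then have "c \<otimes> a \<prec> c \<otimes> b" using True PA(4,13,17) by metis
      then show ?thesis using True diff_lt PA(7) by metis
    qed
  next
    case False
    then obtain w where w: "a = b \<oplus> w" using cases by blast
    then show ?thesis using diff_add PA(5) by metis
  qed
qed

lemmas alg = ar.distrib_left ar.distrib_right ar.add.assoc ar.add.commute ar.add.left_commute
  ar.mult.assoc ar.mult.commute ar.mult.left_commute

lemma zero_le [simp]: "\<zero> \<preceq> x"
  unfolding leq_def using PA(17) by metis

lemma lt_zero [simp]: "\<not> x \<prec> \<zero>"
  using zero_le ar.not_less by blast

lemma Suc_le_iff: "x \<oplus> \<one> \<preceq> y \<longleftrightarrow> x \<prec> y"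
proof
  assume "x \<prec> y"
  then obtain w where w: "x \<oplus> w = y" using PA(14) by blast
  then have "w \<noteq> \<zero>" using \<open>x \<prec> y\<close> by auto
  then have "\<one> \<preceq> w" using PA(16,17) unfolding leq_def by metis
  then show "x \<oplus> \<one> \<preceq> y" unfolding w[symmetric] by simp
next
  assume "x \<oplus> \<one> \<preceq> y"
  then show "x \<prec> y" using ar.less_add_one ar.less_le_trans by blast
qed

lemma lt_Suc_iff: "x \<prec> y \<oplus> \<one> \<longleftrightarrow> x \<preceq> y"
  using Suc_le_iff[of y x] ar.not_less by blast

lemma le_add [simp]: "x \<preceq> x \<oplus> y" "x \<preceq> y \<oplus> x"
  using ar.add_left_mono[OF zero_le[of y], of x] by (simp_all add: alg)

lemma le_mult: "y \<noteq> \<zero> \<Longrightarrow> x \<preceq> x \<otimes> y"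
  using ar.mult_left_mono[of \<one> y x] PA(16,17) unfolding leq_def by (metis PA(8) leq_def zero_le)

lemma obtain_pred: assumes "x \<noteq> \<zero>" obtains y where "x = y \<oplus> \<one>"
proof -
  have "\<one> \<preceq> x" using assms PA(16,17) unfolding leq_def by metis
  then show ?thesis using that le_iff alg(4) by metis
qed

text \<open>A polynomial pairing without division by two, so that pairs are term functions. It is
  injective but not onto; a formula about components must state separately that its argument is a
  pair.\<close>

definition pr :: "'a \<Rightarrow> 'a \<Rightarrow> 'a" where
  "pr x y = (x \<oplus> y) \<otimes> (x \<oplus> y) \<oplus> x"

text \<open>With \<open>s = x \<oplus> y\<close> the value lies between s^2 and s^2 + s, hence below
  (s+1)^2. Pairs are thus ordered first by their sum.\<close>

lemma pr_less:
  assumes "x \<oplus> y \<prec> u \<oplus> v" shows "pr x y \<prec> pr u v"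
proof -
  let ?s = "x \<oplus> y"
  have "x \<prec> ?s \<oplus> \<one>" by (simp add: lt_Suc_iff)
  then have "pr x y \<prec> ?s \<otimes> ?s \<oplus> (?s \<oplus> \<one>)" unfolding pr_def by simp
  also have "\<dots> \<preceq> (?s \<oplus> \<one>) \<otimes> (?s \<oplus> \<one>)"
  proof -
    have "(t \<oplus> \<one>) \<otimes> (t \<oplus> \<one>) = t \<otimes> t \<oplus> (t \<oplus> \<one>) \<oplus> t" for t
      by (simp add: alg)
    then show ?thesis by (metis le_add(1))
  qed
  also have "\<dots> \<preceq> (u \<oplus> v) \<otimes> (u \<oplus> v)"
    using assms by (intro ar.mult_mono) (simp_all add: Suc_le_iff)
  also have "\<dots> \<preceq> pr u v" unfolding pr_def by simp
  finally show ?thesis .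
qed

lemma pr_inj [simp]: "pr x y = pr u v \<longleftrightarrow> x = u \<and> y = v"
proof
  assume *: "pr x y = pr u v"
  then have "x \<oplus> y = u \<oplus> v"
    using pr_less[of x y u v] pr_less[of u v x y] ar.less_irrefl ar.neqE by metis
  then show "x = u \<and> y = v" using * unfolding pr_def by simp
qed simp

lemma pr_mono: "x \<prec> u \<Longrightarrow> y \<prec> v \<Longrightarrow> pr x y \<prec> pr u v"
  by (intro pr_less ar.add_strict_mono)

lemma le_square: "x \<preceq> x \<otimes> x"
  using le_mult[of x x] by (cases "x = \<zero>") auto

lemma le_pr: "x \<preceq> pr x y" "y \<preceq> pr x y"
proof -
  show "x \<preceq> pr x y" unfolding pr_def by simp
  have "y \<preceq> x \<oplus> y" by simp
  also have "\<dots> \<preceq> (x \<oplus> y) \<otimes> (x \<oplus> y)" by (rule le_square)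
  also have "\<dots> \<preceq> pr x y" unfolding pr_def by simp
  finally show "y \<preceq> pr x y" .
qed

lemma tmf_pr: "tmf f \<Longrightarrow> tmf g \<Longrightarrow> tmf (\<lambda>s. pr (f s) (g s))"
  unfolding pr_def by (intro tmf.plus tmf.times)

lemma bD_le: "tmf f \<Longrightarrow> tmf g \<Longrightarrow> bD (\<lambda>s. f s \<preceq> g s)"
  unfolding leq_def by (intro bD_disj bD.lt bD.eq)

lemma bD_comp1: "bD (\<lambda>s. P (s 0)) \<Longrightarrow> tmf f \<Longrightarrow> bD (\<lambda>s. P (f s))"
  using bD_subst[of "\<lambda>s. P (s 0)" "\<lambda>_. f"] by simp

lemma bD_comp2:
  assumes "bD (\<lambda>s. P (s 0) (s (Suc 0)))" "tmf f" "tmf g" shows "bD (\<lambda>s. P (f s) (g s))"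
proof -
  have "bD (\<lambda>s. P ((if (0::nat) = 0 then f else g) s) ((if (Suc 0) = 0 then f else g) s))"
    by (rule bD_subst[OF assms(1), of "\<lambda>i. if i = 0 then f else g"]) (use assms in auto)
  then show ?thesis by simp
qed

lemmas tm_intros = tmf.var tmf.const tmf.plus tmf.times tmf_pr
lemmas bD_intros = bD_bex bD_ball bD.conj bD_disj bD_imp bD.eq bD_iff bD.lt bD_le bD.neg tm_intros bD_const

end

text \<open>Only Delta_0 induction and one fixed graph of the exponential are assumed here. Lemmas
  that use more induction take it as a hypothesis.\<close>

locale coded_model = full_PAminus +
  fixes \<theta>
  assumes ISigma0: "ISigma 0 M" and pow2: "pow2_graph M \<theta>"
begin

lemma bD_induct:
  assumes "bD (\<lambda>s. P (s 0))" and "P \<zero>" and "\<And>x. P x \<Longrightarrow> P (x \<oplus> \<one>)"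
  shows "P x"
  using bS_induct[OF ISigma0, of P] assms by simp

section \<open>Powers of two\<close>

definition pw :: "'a \<Rightarrow> 'a" where "pw x = (THE y. holds M \<theta> [x, y])"

lemma pw_eq: "pw x = y \<longleftrightarrow> holds M \<theta> [x, y]"
proof -
  have "\<exists>!y. holds M \<theta> [x, y]" using pow2 unfolding pow2_graph_def full by blast
  then show ?thesis unfolding pw_def by (metis theI')
qed

lemma pw_0 [simp]: "pw \<zero> = \<one>"
  using pow2 unfolding pw_eq pow2_graph_def by blast

lemma pw_Suc: "pw (x \<oplus> \<one>) = pw x \<oplus> pw x"
  using pow2 pw_eq unfolding pow2_graph_def full by blast

lemma bD_pw:
  assumes "tmf f" "tmf g" shows "bD (\<lambda>s. pw (f s) = g s)"
proof -
  have "bD (\<lambda>s. sat M \<theta> (\<lambda>i. (if i = 0 then f else if i = Suc 0 then g else (\<lambda>_. \<zero>)) s))"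
    by (rule bD_subst[OF bD_sat]) (use pow2 assms tmf.const in \<open>auto simp: pow2_graph_def\<close>)
  moreover have "(\<lambda>i. (if i = 0 then f else if i = Suc 0 then g else (\<lambda>_. \<zero>)) s)
    = (\<lambda>i. if i < length [f s, g s] then [f s, g s] ! i else \<zero>)" for s :: "nat \<Rightarrow> 'a"
    by (auto simp: less_Suc_eq fun_eq_iff)
  ultimately show ?thesis unfolding pw_eq holds_def by simp
qed

lemma pw_nonzero [simp]: "pw x \<noteq> \<zero>"
proof (rule bD_induct[of "\<lambda>x. pw x \<noteq> \<zero>"])
  show "bD (\<lambda>s. pw (s 0) \<noteq> \<zero>)" by (intro bD.neg bD_pw tm_intros)
  fix x assume "pw x \<noteq> \<zero>"
  then have "\<zero> \<prec> pw x \<oplus> pw x"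
    using PA(17) ar.add_pos_pos by blast
  then show "pw (x \<oplus> \<one>) \<noteq> \<zero>" unfolding pw_Suc by auto
qed simp

lemma pw_pos [simp]: "\<zero> \<prec> pw x"
  using PA(17) pw_nonzero by blast

lemma lt_pw: "x \<prec> pw x"
proof -
  \<comment> \<open>\<open>pw\<close> is not a term and enters Delta_0 formulas through its graph;
    negating the existence of a small value avoids having to bound \<open>pw x\<close> from
    above.\<close>
  have "\<not> (\<exists>p. p \<prec> x \<oplus> \<one> \<and> pw x = p)"
  proof (rule bD_induct[of "\<lambda>x. \<not> (\<exists>p. p \<prec> x \<oplus> \<one> \<and> pw x = p)"])
    show "bD (\<lambda>s. \<not> (\<exists>p. p \<prec> s 0 \<oplus> \<one> \<and> pw (s 0) = p))" by (intro bD_pw bD_intros)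
    fix x assume "\<not> (\<exists>p. p \<prec> x \<oplus> \<one> \<and> pw x = p)"
    then have "x \<prec> pw x" using ar.not_less lt_Suc_iff by blast
    then have "x \<oplus> \<one> \<preceq> pw x" using Suc_le_iff by blast
    also have "\<dots> \<prec> pw x \<oplus> pw x" by simp
    finally show "\<not> (\<exists>p. p \<prec> x \<oplus> \<one> \<oplus> \<one> \<and> pw (x \<oplus> \<one>) = p)"
      using lt_Suc_iff ar.not_less pw_Suc by force
  qed (simp add: lt_Suc_iff)
  then show ?thesis using ar.not_less lt_Suc_iff by blast
qed

text \<open>Induction on \<open>i = X - x\<close>, downwards from \<open>X\<close>. The fixed number
  \<open>pw X\<close> then bounds all quantifiers, and the equation itself shows that
  \<open>k\<close> and \<open>pw x\<close> stay below it. An upward argument would presuppose the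
  monotonicity that is derived from this lemma.\<close>

lemma pw_dvd:
  assumes "x \<preceq> X" shows "\<exists>k. pw X = k \<otimes> pw x"
proof -
  let ?B = "pw X \<oplus> \<one>"
  let ?P = "\<lambda>i. i \<preceq> X \<longrightarrow> (\<exists>x. x \<prec> X \<oplus> \<one> \<and> (\<exists>p. p \<prec> ?B \<and> (\<exists>k. k \<prec> ?B \<and>
    x \<oplus> i = X \<and> pw x = p \<and> pw X = k \<otimes> p)))"
  obtain i where i: "x \<oplus> i = X" using assms le_iff by blast
  have "?P i"
  proof (rule bD_induct[of ?P])
    show "bD (\<lambda>s. ?P (s 0))" by (intro bD_pw bD_intros)
    have "X \<preceq> X" "\<one> \<preceq> pw X" "pw X \<preceq> pw X" "X \<oplus> \<zero> = X" "pw X = \<one> \<otimes> pw X"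
      using Suc_le_iff[of \<zero> "pw X"] by simp_all
    then show "?P \<zero>" unfolding lt_Suc_iff by blast
    fix i assume IH: "?P i"
    show "?P (i \<oplus> \<one>)"
    proof
      assume i: "i \<oplus> \<one> \<preceq> X"
      then have "i \<prec> X" using Suc_le_iff by blast
      then obtain x k where xk: "x \<oplus> i = X" "pw X = k \<otimes> pw x"
        using IH unfolding leq_def by blast
      have "x \<noteq> \<zero>" using xk(1) \<open>i \<prec> X\<close> by auto
      then obtain y where y: "x = y \<oplus> \<one>" by (rule obtain_pred)
      have eq: "pw X = (k \<oplus> k) \<otimes> pw y" using xk(2) unfolding y pw_Suc by (simp add: alg)
      have "k \<oplus> k \<preceq> pw X" unfolding eq by (intro le_mult) simp
      moreover have "pw y \<preceq> pw X"
      proof -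
        have "k \<oplus> k \<noteq> \<zero>" using eq pw_nonzero[of X] by auto
        then show ?thesis unfolding eq using le_mult[of "k \<oplus> k" "pw y"] by (simp add: alg(7))
      qed
      moreover have "y \<oplus> (i \<oplus> \<one>) = X" using xk(1) y by (simp add: alg)
      moreover have "y \<preceq> X" using calculation(3) by auto
      ultimately show "\<exists>x. x \<prec> X \<oplus> \<one> \<and> (\<exists>p. p \<prec> ?B \<and> (\<exists>k. k \<prec> ?B \<and>
          x \<oplus> (i \<oplus> \<one>) = X \<and> pw x = p \<and> pw X = k \<otimes> p))"
        using eq unfolding lt_Suc_iff by blast
    qed
  qed
  moreover have "i \<preceq> X" using i by auto
  ultimately obtain y k where "y \<oplus> i = X" "pw X = k \<otimes> pw y" by blast
  moreover have "y = x" using calculation(1) i by (metis ar.add_right_cancel)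
  ultimately show ?thesis by blast
qed

lemma pw_mono: assumes "x \<preceq> y" shows "pw x \<preceq> pw y"
proof -
  obtain k where k: "pw y = k \<otimes> pw x" using pw_dvd assms by blast
  then have "k \<noteq> \<zero>" using pw_nonzero[of y] by auto
  then show ?thesis unfolding k using le_mult[of k "pw x"] by (simp add: alg(7))
qed

text \<open>Ackermann membership: the binary digit of \<open>c\<close> at place \<open>z\<close> is
  one, that is, c = (2q+1) 2^z + r with r < 2^z. Bounding \<open>p\<close> and \<open>q\<close> by
  \<open>c\<close> makes this Delta_0; \<open>E_iff\<close> removes the bounds.\<close>

definition E :: "'a \<Rightarrow> 'a \<Rightarrow> bool" where
  "E z c \<longleftrightarrow> (\<exists>p. p \<prec> c \<oplus> \<one> \<and> pw z = p \<and>
     (\<exists>q. q \<prec> c \<oplus> \<one> \<and> (\<exists>r. r \<prec> p \<and> c = (q \<oplus> q) \<otimes> p \<oplus> p \<oplus> r)))"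

lemma bD_E: "tmf f \<Longrightarrow> tmf g \<Longrightarrow> bD (\<lambda>s. E (f s) (g s))"
  by (rule bD_comp2) (unfold E_def, intro bD_pw bD_intros)

lemma E_iff: "E z c \<longleftrightarrow> (\<exists>q r. r \<prec> pw z \<and> c = (q \<oplus> q) \<otimes> pw z \<oplus> pw z \<oplus> r)"
proof
  assume "\<exists>q r. r \<prec> pw z \<and> c = (q \<oplus> q) \<otimes> pw z \<oplus> pw z \<oplus> r"
  then obtain q r where qr: "r \<prec> pw z" "c = (q \<oplus> q) \<otimes> pw z \<oplus> pw z \<oplus> r" by blast
  have "pw z \<preceq> c" unfolding qr(2) by (simp add: alg(3))
       (metis alg(3) alg(4) le_add(1))
  moreover have "q \<preceq> c"
  proof -
    have "q \<preceq> q \<otimes> pw z" by (simp add: le_mult)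
    also have "\<dots> \<preceq> c" unfolding qr(2) by (simp add: alg(2) alg(3))
    finally show ?thesis .
  qed
  ultimately show "E z c" unfolding E_def lt_Suc_iff using qr by blast
qed (auto simp: E_def)

lemma E_pw_le: "E z c \<Longrightarrow> pw z \<preceq> c"
  unfolding E_def lt_Suc_iff by blast

lemma E_less: "E z c \<Longrightarrow> z \<prec> c"
  using E_pw_le lt_pw ar.less_le_trans by blast

text \<open>For z < x the number 2^(z+1) divides 2^x, so adding \<open>pw x\<close> changes only the
  quotient \<open>q\<close> and leaves digit \<open>z\<close> alone.\<close>

lemma E_add_pw:
  assumes "z \<prec> x" shows "E z (c \<oplus> pw x) \<longleftrightarrow> E z c"
proof -
  have "z \<oplus> \<one> \<preceq> x" using assms Suc_le_iff by blast
  then obtain k where k: "pw x = k \<otimes> (pw z \<oplus> pw z)" using pw_dvd pw_Suc by metis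
  show ?thesis
  proof
    assume "E z c"
    then obtain q r where qr: "r \<prec> pw z" "c = (q \<oplus> q) \<otimes> pw z \<oplus> pw z \<oplus> r"
      unfolding E_iff by blast
    have "c \<oplus> pw x = ((q \<oplus> k) \<oplus> (q \<oplus> k)) \<otimes> pw z \<oplus> pw z \<oplus> r"
      unfolding k qr(2) by (simp add: alg)
    then show "E z (c \<oplus> pw x)" using qr(1) unfolding E_iff by blast
  next
    assume "E z (c \<oplus> pw x)"
    then obtain q r where qr: "r \<prec> pw z" "c \<oplus> pw x = (q \<oplus> q) \<otimes> pw z \<oplus> pw z \<oplus> r"
      unfolding E_iff by blast
    show "E z c"
    proof (cases "q \<prec> k")
      \<comment> \<open>This case is impossible: it would give
        \<open>c \<oplus> pw x \<prec> pw x\<close>.\<close>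
      case True
      then obtain w where w: "(q \<oplus> \<one>) \<oplus> w = k" using Suc_le_iff le_iff by metis
      have "c \<oplus> pw x \<prec> (q \<oplus> q) \<otimes> pw z \<oplus> pw z \<oplus> pw z" unfolding qr(2) using qr(1) by simp
      also have "\<dots> = (q \<oplus> \<one>) \<otimes> (pw z \<oplus> pw z)" by (simp add: alg)
      also have "\<dots> \<preceq> pw x" unfolding k w[symmetric] by (simp add: alg(2))
      finally show ?thesis using ar.not_less le_add(2) by blast
    next
      case False
      then obtain w where w: "q = k \<oplus> w" using le_iff ar.not_less by metis
      note qr(2)
      also have "(q \<oplus> q) \<otimes> pw z \<oplus> pw z \<oplus> r = ((w \<oplus> w) \<otimes> pw z \<oplus> pw z \<oplus> r) \<oplus> pw x"
        unfolding k w by (simp add: alg)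
      finally have "c \<oplus> pw x = ((w \<oplus> w) \<otimes> pw z \<oplus> pw z \<oplus> r) \<oplus> pw x" .
      then show ?thesis using qr(1) unfolding E_iff by (metis ar.add_right_cancel)
    qed
  qed
qed

text \<open>The code is built digit by digit. Totality of the exponential enters here: the partial
  codes stay below \<open>pw X\<close>, so the existence of a correct partial code is a Delta_0
  property of its length.\<close>

lemma comprehension:
  assumes "bD (\<lambda>s. P (s 0))"
  shows "\<exists>c. c \<prec> pw X \<and> (\<forall>z. E z c \<longleftrightarrow> z \<prec> X \<and> P z)"
proof -
  let ?Q = "\<lambda>x. x \<preceq> X \<longrightarrow> (\<exists>p. p \<prec> pw X \<oplus> \<one> \<and> pw x = p \<and>
    (\<exists>c. c \<prec> p \<and> (\<forall>z. z \<prec> x \<longrightarrow> E z c \<longleftrightarrow> P z)))"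
  have "?Q X"
  proof (rule bD_induct[of ?Q])
    show "bD (\<lambda>s. ?Q (s 0))" by (intro bD_pw bD_E bD_comp1[OF assms] bD_intros)
    show "?Q \<zero>" using pw_mono[OF zero_le[of X]] by (auto simp: lt_Suc_iff intro: exI[of _ \<zero>])
    fix x assume IH: "?Q x"
    show "?Q (x \<oplus> \<one>)"
    proof
      assume le: "x \<oplus> \<one> \<preceq> X"
      then have "x \<preceq> X" using Suc_le_iff leq_def by metis
      then obtain c where c: "c \<prec> pw x" "\<And>z. z \<prec> x \<Longrightarrow> E z c \<longleftrightarrow> P z" using IH by blast
      have "\<exists>c'. c' \<prec> pw (x \<oplus> \<one>) \<and> (\<forall>z. z \<prec> x \<oplus> \<one> \<longrightarrow> E z c' \<longleftrightarrow> P z)"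
      proof (cases "P x")
        case True
        have "E x (c \<oplus> pw x)" unfolding E_iff
          by (intro exI[of _ \<zero>] exI[of _ c]) (simp add: c(1) alg(4))
        then have "\<forall>z. z \<prec> x \<oplus> \<one> \<longrightarrow> E z (c \<oplus> pw x) \<longleftrightarrow> P z"
          using c(2) E_add_pw[of _ x c] True unfolding lt_Suc_iff leq_def by blast
        moreover have "c \<oplus> pw x \<prec> pw (x \<oplus> \<one>)" using c(1) by (simp add: pw_Suc)
        ultimately show ?thesis by blast
      next
        case False
        have "\<not> E x c" using E_pw_le[of x c] c(1) ar.not_less by blast
        then have "\<forall>z. z \<prec> x \<oplus> \<one> \<longrightarrow> E z c \<longleftrightarrow> P z"
          using c(2) False unfolding lt_Suc_iff leq_def by blast
        moreover have "c \<prec> pw (x \<oplus> \<one>)" using c(1) unfolding pw_Suc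
          by (rule ar.less_le_trans) simp
        ultimately show ?thesis by blast
      qed
      then show "\<exists>p. p \<prec> pw X \<oplus> \<one> \<and> pw (x \<oplus> \<one>) = p \<and>
          (\<exists>c. c \<prec> p \<and> (\<forall>z. z \<prec> x \<oplus> \<one> \<longrightarrow> E z c \<longleftrightarrow> P z))"
        using pw_mono[OF le] lt_Suc_iff by blast
    qed
  qed
  then obtain c where c: "c \<prec> pw X" "\<And>z. z \<prec> X \<Longrightarrow> E z c \<longleftrightarrow> P z" by auto
  moreover have "z \<prec> X" if "E z c" for z
  proof (rule ccontr)
    assume "\<not> z \<prec> X"
    then have "pw X \<preceq> pw z" by (intro pw_mono) (simp add: ar.not_less)
    also have "\<dots> \<preceq> c" using that by (rule E_pw_le)
    also note c(1)
    finally show False by simp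
  qed
  ultimately show ?thesis by blast
qed

end

section \<open>Coded smallness and uniformization\<close>

context full_PAminus
begin

lemma pr_mono_le:
  assumes "x \<preceq> u" "y \<preceq> v" shows "pr x y \<preceq> pr u v"
proof -
  have "x \<oplus> y \<preceq> u \<oplus> v" using assms by (rule ar.add_mono)
  then have "(x \<oplus> y) \<otimes> (x \<oplus> y) \<preceq> (u \<oplus> v) \<otimes> (u \<oplus> v)" by (intro ar.mult_mono) auto
  then show ?thesis unfolding pr_def using assms(1) by (rule ar.add_mono)
qed

lemma bS_comp2:
  assumes "bS n (\<lambda>s. P (s 0) (s (Suc 0)))" "tmf f" "tmf g" shows "bS n (\<lambda>s. P (f s) (g s))"
proof -
  have "bS n (\<lambda>s. P ((if (0::nat) = 0 then f else g) s) ((if (Suc 0) = 0 then f else g) s))"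
    by (rule bS_subst[OF assms(1), of "\<lambda>i. if i = 0 then f else g"]) (use assms in auto)
  then show ?thesis by simp
qed

lemma bP_comp2:
  assumes "bP n (\<lambda>s. P (s 0) (s (Suc 0)))" "tmf f" "tmf g" shows "bP n (\<lambda>s. P (f s) (g s))"
  using bS_comp2[of n "\<lambda>x y. \<not> P x y"] assms unfolding bP_def by blast

text \<open>A block of existential quantifiers is contracted by the pairing function; the matrix
  universally quantifies the components of the pair, so that it stays \<open>\<Pi>\<^sub>k\<close>.\<close>
lemma contract:
  assumes "bS (Suc k) P"
  shows "\<exists>Q. bP k Q \<and> (\<forall>s. P s \<longleftrightarrow> (\<exists>d. Q (d ## s)))"
  using assms unfolding bS_Suc
proof (induction rule: ex_closure.induct)
  case (base P)
  have "bP k (\<lambda>s. P (\<lambda>i. s (Suc i)))"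
    by (rule bP_subst[OF base, of "\<lambda>i s. s (Suc i)"]) (rule tmf.var)
  then show ?case by (intro exI[of _ "\<lambda>s. P (\<lambda>i. s (Suc i))"]) simp
next
  case (ex P)
  then obtain Q where Q: "bP k Q" "\<And>s. P s \<longleftrightarrow> (\<exists>d. Q (d ## s))" by blast
  let ?T = "\<lambda>s x. (\<exists>d. d \<prec> x \<oplus> \<one> \<and> (\<exists>e. e \<prec> x \<oplus> \<one> \<and> x = pr d e)) \<and>
     (\<forall>d. d \<prec> x \<oplus> \<one> \<longrightarrow> (\<forall>e. e \<prec> x \<oplus> \<one> \<longrightarrow> x = pr d e \<longrightarrow> Q (d ## e ## s)))"
  have "bP k (\<lambda>s. Q (s (Suc 0) ## s 0 ## (\<lambda>i. s (Suc (Suc (Suc i))))))"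
  proof -
    let ?f = "case_nat (\<lambda>s. s (Suc 0)) (case_nat (\<lambda>s. s 0) (\<lambda>i s. s (Suc (Suc (Suc i)))))"
    have "bP k (\<lambda>s. Q (\<lambda>i. ?f i s))"
      by (rule bP_subst[OF Q(1)]) (auto split: nat.split intro: tmf.var)
    moreover have "(\<lambda>i. ?f i s) = s (Suc 0) ## s 0 ## (\<lambda>i. s (Suc (Suc (Suc i))))" for s :: "nat \<Rightarrow> 'a"
      by (auto split: nat.split)
    ultimately show ?thesis by simp
  qed
  then have "bP k (\<lambda>s. ?T (\<lambda>i. s (Suc i)) (s 0))"
    by (rule_tac bP_conj, intro bP_of_bD bD_intros)
      (rule bP_ball, intro tm_intros, rule bP_ball, intro tm_intros, rule bP_imp, intro bS_of_bD bD_intros)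
  moreover have "(\<exists>e. P (e ## s)) \<longleftrightarrow> (\<exists>x. ?T s x)" for s
  proof
    assume "\<exists>e. P (e ## s)"
    then obtain d e where "Q (d ## e ## s)" using Q(2) by blast
    then have "?T s (pr d e)" using le_pr by (auto simp: lt_Suc_iff)
    then show "\<exists>x. ?T s x" by blast
  qed (use Q(2) in blast)
  ultimately show ?case
    by (intro exI[of _ "\<lambda>s. ?T (\<lambda>i. s (Suc i)) (s 0)"]) simp
qed

end

context coded_model
begin

section \<open>Coded sets and coded relations\<close>

definition coded :: "'a set \<Rightarrow> bool" where
  "coded A \<longleftrightarrow> (\<exists>c. \<forall>z. z \<in> A \<longleftrightarrow> E z c)"

lemma bD_mem: "coded A \<Longrightarrow> tmf f \<Longrightarrow> bD (\<lambda>s. f s \<in> A)"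
  unfolding coded_def using bD_E[OF _ tmf.const, of f] by auto

lemma codedI: "bD (\<lambda>s. P (s 0)) \<Longrightarrow> coded {z. z \<prec> X \<and> P z}"
  unfolding coded_def using comprehension[of P X] by auto

lemma coded_bounded: "coded A \<Longrightarrow> \<exists>X. \<forall>x\<in>A. x \<prec> X"
  unfolding coded_def using E_less by blast

lemma coded_sub: "coded A \<Longrightarrow> bD (\<lambda>s. P (s 0)) \<Longrightarrow> coded {z \<in> A. P z}"
proof -
  assume A: "coded A" "bD (\<lambda>s. P (s 0))"
  obtain X where X: "\<forall>x\<in>A. x \<prec> X" using coded_bounded A(1) by blast
  have "coded {z. z \<prec> X \<and> z \<in> A \<and> P z}"
    by (intro codedI bD.conj bD_mem A tmf.var)
  moreover have "{z. z \<prec> X \<and> z \<in> A \<and> P z} = {z \<in> A. P z}" using X by blast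
  ultimately show ?thesis by simp
qed

text \<open>The explicit bound on \<open>g\<close> matters: it turns quantification over coded
  relations inside a rectangle into a bounded quantifier.\<close>

lemma rel_comprehension:
  assumes "bD (\<lambda>s. R (s 0) (s (Suc 0)))"
  shows "\<exists>g. g \<prec> pw (pr X Y) \<and> (\<forall>x y. E (pr x y) g \<longleftrightarrow> x \<prec> X \<and> y \<prec> Y \<and> R x y)"
proof -
  have "bD (\<lambda>s. \<exists>x. x \<prec> X \<and> (\<exists>y. y \<prec> Y \<and> s 0 = pr x y \<and> R x y))"
    by (intro bD_comp2[OF assms] bD_intros)
  from comprehension[OF this, of "pr X Y"] show ?thesis using pr_mono by auto
qed

text \<open>A coded injection of \<open>A\<close> into \<open>m\<close> in relational form. The
  relation \<open>g\<close> may be multivalued; disjointness of the value sets is what passes to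
  unions and survives the rerouting of values in the pigeonhole proof.\<close>

definition small :: "'a set \<Rightarrow> 'a \<Rightarrow> bool" where
  "small A m \<longleftrightarrow> (\<exists>g. (\<forall>x\<in>A. \<exists>y. y \<prec> m \<and> E (pr x y) g) \<and>
     (\<forall>x\<in>A. \<forall>x'\<in>A. \<forall>y. y \<prec> m \<longrightarrow> E (pr x y) g \<longrightarrow> E (pr x' y) g \<longrightarrow> x = x'))"

lemma smallI:
  assumes "bD (\<lambda>s. R (s 0) (s (Suc 0)))" "\<forall>x\<in>A. x \<prec> X"
    and "\<And>x. x \<in> A \<Longrightarrow> \<exists>y. y \<prec> m \<and> R x y"
    and "\<And>x x' y. x \<in> A \<Longrightarrow> x' \<in> A \<Longrightarrow> y \<prec> m \<Longrightarrow> R x y \<Longrightarrow> R x' y \<Longrightarrow> x = x'"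
  shows "small A m"
proof -
  obtain g where g: "\<And>x y. E (pr x y) g \<longleftrightarrow> x \<prec> X \<and> y \<prec> m \<and> R x y"
    using rel_comprehension[OF assms(1)] by blast
  show ?thesis unfolding small_def
    by (rule exI[of _ g]) (use g assms in blast)
qed

text \<open>Restricting \<open>g\<close> to the relevant pairs bounds its code, which makes
  smallness of a bounded set a Delta_0 property and so accessible to induction.\<close>

lemma small_code:
  assumes "small A m" "\<forall>x\<in>A. x \<prec> X"
  shows "\<exists>g. g \<prec> pw (pr X m) \<and> (\<forall>x\<in>A. \<exists>y. y \<prec> m \<and> E (pr x y) g) \<and>
     (\<forall>x\<in>A. \<forall>x'\<in>A. \<forall>y. y \<prec> m \<longrightarrow> E (pr x y) g \<longrightarrow> E (pr x' y) g \<longrightarrow> x = x')"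
proof -
  obtain g where g: "\<forall>x\<in>A. \<exists>y. y \<prec> m \<and> E (pr x y) g"
    "\<forall>x\<in>A. \<forall>x'\<in>A. \<forall>y. y \<prec> m \<longrightarrow> E (pr x y) g \<longrightarrow> E (pr x' y) g \<longrightarrow> x = x'"
    using assms(1) unfolding small_def by blast
  have "bD (\<lambda>s. E (pr (s 0) (s (Suc 0))) g)" by (intro bD_E tm_intros)
  from rel_comprehension[OF this, of X m] obtain g' where
    "g' \<prec> pw (pr X m)" "\<forall>x y. E (pr x y) g' \<longleftrightarrow> x \<prec> X \<and> y \<prec> m \<and> E (pr x y) g" by blast
  then show ?thesis by (intro exI[of _ g']) (use g assms(2) in blast)
qed

lemma small_subset: "small A m \<Longrightarrow> B \<subseteq> A \<Longrightarrow> small B m"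
  unfolding small_def by blast

lemma small_mono:
  assumes "small A m" "m \<preceq> m'" "coded A" shows "small A m'"
proof -
  obtain g where g: "\<forall>x\<in>A. \<exists>y. y \<prec> m \<and> E (pr x y) g"
    "\<forall>x\<in>A. \<forall>x'\<in>A. \<forall>y. y \<prec> m \<longrightarrow> E (pr x y) g \<longrightarrow> E (pr x' y) g \<longrightarrow> x = x'"
    using assms(1) unfolding small_def by blast
  obtain X where X: "\<forall>x\<in>A. x \<prec> X" using coded_bounded assms(3) by blast
  show ?thesis
  proof (rule smallI[of "\<lambda>x y. y \<prec> m \<and> E (pr x y) g", OF _ X])
    show "bD (\<lambda>s. s (Suc 0) \<prec> m \<and> E (pr (s 0) (s (Suc 0))) g)" by (intro bD_E bD_intros)
  qed (use g assms(2) ar.less_le_trans in blast)+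
qed

text \<open>Induction on \<open>m\<close>: an injection of m+2 points into m+1 is turned into one of
  m+1 points into m by rerouting the value \<open>m\<close>. The number \<open>Z\<close> provides
  one bound on the codes for all stages, so the claim is Delta_0 in \<open>m\<close>.\<close>

lemma pigeonhole_code:
  assumes "m \<preceq> Z" "g \<prec> pw (pr (Z \<oplus> \<one>) Z)"
    and "\<And>x. x \<prec> m \<oplus> \<one> \<Longrightarrow> \<exists>y. y \<prec> m \<and> E (pr x y) g"
    and "\<And>x x' y. x \<prec> m \<oplus> \<one> \<Longrightarrow> x' \<prec> m \<oplus> \<one> \<Longrightarrow> y \<prec> m \<Longrightarrow> E (pr x y) g \<Longrightarrow> E (pr x' y) g \<Longrightarrow> x = x'"
  shows False
proof -
  let ?B = "pw (pr (Z \<oplus> \<one>) Z)"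
  let ?P = "\<lambda>m. m \<preceq> Z \<longrightarrow> (\<forall>g. g \<prec> ?B \<longrightarrow> \<not> ((\<forall>x. x \<prec> m \<oplus> \<one> \<longrightarrow> (\<exists>y. y \<prec> m \<and> E (pr x y) g)) \<and>
    (\<forall>x. x \<prec> m \<oplus> \<one> \<longrightarrow> (\<forall>x'. x' \<prec> m \<oplus> \<one> \<longrightarrow> (\<forall>y. y \<prec> m \<longrightarrow>
       E (pr x y) g \<longrightarrow> E (pr x' y) g \<longrightarrow> x = x')))))"
  have "?P m"
  proof (rule bD_induct[of ?P])
    show "bD (\<lambda>s. ?P (s 0))" by (intro bD_E bD_intros)
    show "?P \<zero>" by (auto intro: exI[of _ \<zero>])
    fix m assume IH: "?P m"
    show "?P (m \<oplus> \<one>)"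
    proof (intro impI allI notI, elim conjE)
      fix g
      assume m: "m \<oplus> \<one> \<preceq> Z"
        and tot: "\<forall>x. x \<prec> m \<oplus> \<one> \<oplus> \<one> \<longrightarrow> (\<exists>y. y \<prec> m \<oplus> \<one> \<and> E (pr x y) g)"
        and inj: "\<forall>x. x \<prec> m \<oplus> \<one> \<oplus> \<one> \<longrightarrow> (\<forall>x'. x' \<prec> m \<oplus> \<one> \<oplus> \<one> \<longrightarrow> (\<forall>y. y \<prec> m \<oplus> \<one> \<longrightarrow>
           E (pr x y) g \<longrightarrow> E (pr x' y) g \<longrightarrow> x = x'))"
      have mZ: "m \<preceq> Z" using m Suc_le_iff leq_def by metis
      \<comment> \<open>A point with value \<open>m\<close> inherits the values of the top point
        \<open>m \<oplus> \<one>\<close>, which is dropped from the domain.\<close>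
      let ?R = "\<lambda>x y. x \<prec> m \<oplus> \<one> \<and> y \<prec> m \<and>
        (E (pr x y) g \<or> E (pr x m) g \<and> E (pr (m \<oplus> \<one>) y) g)"
      have "bD (\<lambda>s. ?R (s 0) (s (Suc 0)))" by (intro bD_E bD_intros)
      from rel_comprehension[OF this, of "Z \<oplus> \<one>" Z] obtain g' where
        g': "g' \<prec> ?B" "\<And>x y. E (pr x y) g' \<longleftrightarrow> x \<prec> Z \<oplus> \<one> \<and> y \<prec> Z \<and> ?R x y" by blast
      have bnd: "x \<prec> Z \<oplus> \<one>" if "x \<prec> m \<oplus> \<one>" for x
        using that mZ unfolding lt_Suc_iff by order
      have bnd2: "y \<prec> Z" if "y \<prec> m" for y using that mZ by order
      have lt2: "x \<prec> m \<oplus> \<one> \<oplus> \<one>" if "x \<prec> m \<oplus> \<one>" for x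
        using that ar.less_add_one[of "m \<oplus> \<one>"] by order
      have top: "m \<oplus> \<one> \<prec> m \<oplus> \<one> \<oplus> \<one>" "m \<prec> m \<oplus> \<one>" by simp_all
      have "\<exists>y. y \<prec> m \<and> E (pr x y) g'" if x: "x \<prec> m \<oplus> \<one>" for x
      proof -
        obtain y where y: "y \<prec> m \<oplus> \<one>" "E (pr x y) g" using tot lt2[OF x] by blast
        show ?thesis
        proof (cases "y \<prec> m")
          case True
          then show ?thesis using g'(2) x y bnd bnd2 by blast
        next
          case False
          then have ym: "y = m" using y(1) unfolding lt_Suc_iff leq_def by blast
          obtain y' where y': "y' \<prec> m \<oplus> \<one>" "E (pr (m \<oplus> \<one>) y') g" using tot top by blast
          have "y' \<noteq> m" using inj lt2[OF x] top y y' x unfolding ym by (metis ar.less_irrefl)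
          then have "y' \<prec> m" using y'(1) unfolding lt_Suc_iff leq_def by blast
          then show ?thesis using g'(2) x y y' ym bnd bnd2 by blast
        qed
      qed
      moreover have "x = x'" if "x \<prec> m \<oplus> \<one>" "x' \<prec> m \<oplus> \<one>" "y \<prec> m" "E (pr x y) g'" "E (pr x' y) g'" for x x' y
      proof -
        have ym: "y \<prec> m \<oplus> \<one>" using that(3) unfolding lt_Suc_iff leq_def by blast
        have neq: "x \<noteq> m \<oplus> \<one>" "x' \<noteq> m \<oplus> \<one>" using that(1,2) by auto
        have I: "u = u'" if "u \<prec> m \<oplus> \<one> \<oplus> \<one>" "u' \<prec> m \<oplus> \<one> \<oplus> \<one>" "v \<prec> m \<oplus> \<one>"
            "E (pr u v) g" "E (pr u' v) g" for u u' v using inj that by blast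
        from that(4,5) have "E (pr x y) g \<or> E (pr x m) g \<and> E (pr (m \<oplus> \<one>) y) g"
          "E (pr x' y) g \<or> E (pr x' m) g \<and> E (pr (m \<oplus> \<one>) y) g"
          unfolding g'(2) by blast+
        then show ?thesis
          using I[OF lt2[OF that(1)] lt2[OF that(2)] ym] I[OF lt2[OF that(1)] lt2[OF that(2)] top(2)]
            I[OF lt2[OF that(1)] top(1) ym] I[OF lt2[OF that(2)] top(1) ym] neq
          by blast
      qed
      ultimately show False using IH mZ g'(1) by blast
    qed
  qed
  then show False using assms by blast
qed

lemma pigeonhole:
  assumes "m \<prec> k" shows "\<not> small {x. x \<prec> k} m"
proof
  assume "small {x. x \<prec> k} m"
  then have "small {x. x \<prec> m \<oplus> \<one>} m"
    by (rule small_subset) (use assms ar.le_less_trans in \<open>auto simp: lt_Suc_iff\<close>)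
  from small_code[OF this, of "m \<oplus> \<one>"] obtain g where "g \<prec> pw (pr (m \<oplus> \<one>) m)"
    "\<forall>x\<in>{x. x \<prec> m \<oplus> \<one>}. \<exists>y. y \<prec> m \<and> E (pr x y) g"
    "\<forall>x\<in>{x. x \<prec> m \<oplus> \<one>}. \<forall>x'\<in>{x. x \<prec> m \<oplus> \<one>}. \<forall>y. y \<prec> m \<longrightarrow>
      E (pr x y) g \<longrightarrow> E (pr x' y) g \<longrightarrow> x = x'" by blast
  then show False using pigeonhole_code[of m m g] by simp
qed

text \<open>Elements of \<open>A\<close> keep their values, the others are shifted by
  \<open>m\<close>. Since \<open>A\<close> is coded, this case distinction is Delta_0.\<close>

lemma small_union:
  assumes "coded A" "coded A'" "small A m" "small A' m'"
  shows "small (A \<union> A') (m \<oplus> m')"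
proof -
  obtain g where g: "\<And>x. x \<in> A \<Longrightarrow> \<exists>y. y \<prec> m \<and> E (pr x y) g"
    "\<And>x x' y. x \<in> A \<Longrightarrow> x' \<in> A \<Longrightarrow> y \<prec> m \<Longrightarrow> E (pr x y) g \<Longrightarrow> E (pr x' y) g \<Longrightarrow> x = x'"
    using assms(3) unfolding small_def by metis
  obtain g' where g': "\<And>x. x \<in> A' \<Longrightarrow> \<exists>y. y \<prec> m' \<and> E (pr x y) g'"
    "\<And>x x' y. x \<in> A' \<Longrightarrow> x' \<in> A' \<Longrightarrow> y \<prec> m' \<Longrightarrow> E (pr x y) g' \<Longrightarrow> E (pr x' y) g' \<Longrightarrow> x = x'"
    using assms(4) unfolding small_def by metis
  obtain X where X: "\<forall>x\<in>A. x \<prec> X" using coded_bounded assms(1) by blast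
  obtain X' where X': "\<forall>x\<in>A'. x \<prec> X'" using coded_bounded assms(2) by blast
  let ?R = "\<lambda>x y. (x \<in> A \<and> y \<prec> m \<and> E (pr x y) g) \<or>
    (x \<notin> A \<and> (\<exists>z. z \<prec> m' \<and> y = m \<oplus> z \<and> E (pr x z) g'))"
  show ?thesis
  proof (rule smallI[of ?R])
    show "bD (\<lambda>s. ?R (s 0) (s (Suc 0)))" by (intro bD_E bD_mem assms bD_intros)
    show "\<forall>x\<in>A \<union> A'. x \<prec> X \<oplus> X'"
      using X X' le_add(1)[of X X'] le_add(2)[of X' X] ar.less_le_trans by blast
    fix x assume x: "x \<in> A \<union> A'"
    show "\<exists>y. y \<prec> m \<oplus> m' \<and> ?R x y"
    proof (cases "x \<in> A")
      case True
      then show ?thesis using g(1) le_add(1)[of m m'] ar.less_le_trans by blast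
    next
      case False
      then obtain z where "z \<prec> m'" "E (pr x z) g'" using x g'(1) by blast
      then show ?thesis using False by (intro exI[of _ "m \<oplus> z"]) auto
    qed
  next
    fix x x' y assume *: "x \<in> A \<union> A'" "x' \<in> A \<union> A'" "?R x y" "?R x' y"
    have **: "\<not> m \<oplus> z \<prec> m" for z by (simp add: ar.not_less)
    show "x = x'" using * g(2) g'(2) ** by (metis UnE add_cancel)
  qed
qed

text \<open>The injections of the single fibres are not given uniformly in \<open>i\<close>. Delta_0
  induction on the number of fibres joins them one by one; it applies because the joined injection
  always has a code below \<open>?B\<close>, so that smallness can be replaced by the bounded
  statement \<open>?Q\<close>.\<close>

lemma small_fibres:
  assumes "coded A" and "\<And>i. i \<prec> a \<Longrightarrow> small {x \<in> A. E (pr x i) t} m"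
  shows "small {x \<in> A. \<exists>i. i \<prec> a \<and> E (pr x i) t} (a \<otimes> m)"
proof -
  obtain X where X: "\<forall>x\<in>A. x \<prec> X" using coded_bounded assms(1) by blast
  let ?B = "pw (pr X (a \<otimes> m))"
  let ?A = "\<lambda>i x. x \<in> A \<and> (\<exists>j. j \<prec> i \<and> E (pr x j) t)"
  have sm_iff: "small {x. ?A i x} (i \<otimes> m) \<longleftrightarrow> (\<exists>g. g \<prec> ?B \<and>
      (\<forall>x. x \<prec> X \<longrightarrow> ?A i x \<longrightarrow> (\<exists>y. y \<prec> i \<otimes> m \<and> E (pr x y) g)) \<and>
      (\<forall>x. x \<prec> X \<longrightarrow> (\<forall>x'. x' \<prec> X \<longrightarrow> (\<forall>y. y \<prec> i \<otimes> m \<longrightarrow> ?A i x \<longrightarrow> ?A i x' \<longrightarrow>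
        E (pr x y) g \<longrightarrow> E (pr x' y) g \<longrightarrow> x = x'))))" (is "_ \<longleftrightarrow> ?Q i") if "i \<preceq> a" for i
  proof
    assume "small {x. ?A i x} (i \<otimes> m)"
    moreover have "\<forall>x\<in>{x. ?A i x}. x \<prec> X" using X by blast
    ultimately obtain g where "g \<prec> pw (pr X (i \<otimes> m))"
      and *: "\<forall>x\<in>{x. ?A i x}. \<exists>y. y \<prec> i \<otimes> m \<and> E (pr x y) g"
      "\<forall>x\<in>{x. ?A i x}. \<forall>x'\<in>{x. ?A i x}. \<forall>y. y \<prec> i \<otimes> m \<longrightarrow> E (pr x y) g \<longrightarrow> E (pr x' y) g \<longrightarrow> x = x'"
      using small_code by blast
    moreover have "pw (pr X (i \<otimes> m)) \<preceq> ?B"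
      using that by (intro pw_mono pr_mono_le ar.mult_right_mono) auto
    ultimately have "g \<prec> ?B" by order
    then show "?Q i" using * by blast
  next
    assume "?Q i"
    then show "small {x. ?A i x} (i \<otimes> m)" unfolding small_def using X by blast
  qed
  have coded: "coded {x. ?A i x}" for i
    using coded_sub[OF assms(1), of "\<lambda>x. \<exists>j. j \<prec> i \<and> E (pr x j) t"]
    by (simp add: bD_E bD_intros Collect_conj_eq2)
  have "a \<preceq> a \<longrightarrow> ?Q a"
  proof (rule bD_induct[of "\<lambda>i. i \<preceq> a \<longrightarrow> ?Q i"])
    show "bD (\<lambda>s. s 0 \<preceq> a \<longrightarrow> ?Q (s 0))" by (intro bD_E bD_mem assms bD_intros)
    show "\<zero> \<preceq> a \<longrightarrow> ?Q \<zero>" by (auto intro: exI[of _ \<zero>])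
    fix i assume IH: "i \<preceq> a \<longrightarrow> ?Q i"
    show "i \<oplus> \<one> \<preceq> a \<longrightarrow> ?Q (i \<oplus> \<one>)"
    proof
      assume i: "i \<oplus> \<one> \<preceq> a"
      then have "i \<prec> a" using Suc_le_iff by blast
      then have "small {x. ?A i x} (i \<otimes> m)" using IH sm_iff[of i] unfolding leq_def by blast
      moreover have "coded {x \<in> A. E (pr x i) t}"
        by (intro coded_sub assms bD_E tm_intros)
      ultimately have "small ({x. ?A i x} \<union> {x \<in> A. E (pr x i) t}) (i \<otimes> m \<oplus> m)"
        using small_union coded assms(2)[OF \<open>i \<prec> a\<close>] by blast
      moreover have "{x. ?A i x} \<union> {x \<in> A. E (pr x i) t} = {x. ?A (i \<oplus> \<one>) x}"
        unfolding lt_Suc_iff leq_def by blast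
      moreover have "i \<otimes> m \<oplus> m = (i \<oplus> \<one>) \<otimes> m" by (simp add: alg)
      ultimately show "?Q (i \<oplus> \<one>)" using sm_iff[OF i] by simp
    qed
  qed
  then have "small {x. ?A a x} (a \<otimes> m)" using sm_iff[of a] by simp
  then show ?thesis by simp
qed

text \<open>That \<open>K\<close> distinct arguments below \<open>X\<close> have coded correct
  values is a Sigma_{k+1} statement about \<open>K\<close>: the quantifiers in front of
  \<open>R\<close> are bounded and universal, so only the code \<open>g\<close> is quantified
  unboundedly. By the pigeonhole principle \<open>K\<close> is at most \<open>X\<close>, so
  induction gives a list that cannot be prolonged. It meets every argument with a value, since a
  missing one could be appended.\<close>

lemma uniformize_Pi:
  assumes I: "ISigma (Suc k) M" and R: "bP k (\<lambda>s. R (s 0) (s (Suc 0)))"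
  shows "\<exists>t. (\<forall>x y. E (pr x y) t \<longrightarrow> x \<prec> X \<and> R x y) \<and>
    (\<forall>x y. x \<prec> X \<longrightarrow> R x y \<longrightarrow> (\<exists>y. E (pr x y) t))"
proof -
  let ?tot = "\<lambda>K g. \<forall>i. i \<prec> K \<longrightarrow> (\<exists>x. x \<prec> X \<and> (\<exists>y. y \<prec> g \<and> E (pr i (pr x y)) g))"
  let ?cor = "\<lambda>K g. \<forall>i. i \<prec> K \<longrightarrow> (\<forall>x. x \<prec> X \<longrightarrow> (\<forall>y. y \<prec> g \<longrightarrow> E (pr i (pr x y)) g \<longrightarrow> R x y))"
  let ?inj = "\<lambda>K g. \<forall>i. i \<prec> K \<longrightarrow> (\<forall>i'. i' \<prec> K \<longrightarrow> (\<forall>x. x \<prec> X \<longrightarrow> (\<forall>y. y \<prec> g \<longrightarrow> (\<forall>y'. y' \<prec> g \<longrightarrow>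
      E (pr i (pr x y)) g \<longrightarrow> E (pr i' (pr x y')) g \<longrightarrow> i = i'))))"
  \<comment> \<open>a coded partial choice function whose domain is enumerated injectively by \<open>K\<close>\<close>
  let ?P = "\<lambda>K. \<exists>g. ?tot K g \<and> ?inj K g \<and> ?cor K g"
  have bnd: "y \<prec> g" if "E (pr i (pr x y)) g" for i x y g
    using E_less[OF that] le_pr(2)[of "pr x y" i] le_pr(2)[of y x] by order
  have "bP k (\<lambda>s. ?cor (s (Suc 0)) (s 0))"
    by (rule bP_ball, intro tm_intros, rule bP_ball, intro tm_intros, rule bP_ball, intro tm_intros,
        rule bP_imp, intro bS_of_bD bD_E tm_intros, rule bP_comp2[OF R]) (rule tmf.var)+
  then have "bS (Suc k) (\<lambda>s. ?P (s 0))"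
    by (rule_tac bS_ex, rule_tac bS_conj[OF _ bS_conj]) (rule bS_of_bP, assumption | intro bS_of_bD bD_E bD_intros)+
  note last = bS_last[OF I this]
  have "\<not> ?P (X \<oplus> \<one>)"
  proof
    assume "?P (X \<oplus> \<one>)"
    then obtain g where g: "?tot (X \<oplus> \<one>) g" "?inj (X \<oplus> \<one>) g" by blast
    have "small {x. x \<prec> X \<oplus> \<one>} X"
    proof (rule smallI[of "\<lambda>i x. \<exists>y. y \<prec> g \<and> E (pr i (pr x y)) g"])
      show "bD (\<lambda>s. \<exists>y. y \<prec> g \<and> E (pr (s 0) (pr (s (Suc 0)) y)) g)" by (intro bD_E bD_intros)
    qed (use g in blast)+
    then show False using pigeonhole[of X "X \<oplus> \<one>"] by simp
  qed
  then have "\<exists>K. ?P K \<and> \<not> ?P (K \<oplus> \<one>)" by (intro last) simp_all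
  then obtain K where K: "?P K" "\<not> ?P (K \<oplus> \<one>)" by blast
  then obtain g where g: "?tot K g" "?inj K g" "?cor K g" by blast
  have "bD (\<lambda>s. \<exists>i. i \<prec> K \<and> E (pr i (pr (s 0) (s (Suc 0)))) g)" by (intro bD_E bD_intros)
  from rel_comprehension[OF this, of X g] obtain t where
    t: "\<And>x y. E (pr x y) t \<longleftrightarrow> x \<prec> X \<and> y \<prec> g \<and> (\<exists>i. i \<prec> K \<and> E (pr i (pr x y)) g)" by blast
  have "\<exists>y. E (pr x y) t" if x: "x \<prec> X" and Rxy: "R x y" for x y
  proof (rule ccontr)
    assume "\<not> ?thesis"
    then have new: "\<not> E (pr i (pr x y)) g" if "i \<prec> K" for i y using t x bnd that by blast
    let ?S = "\<lambda>i u. (i \<prec> K \<and> E (pr i u) g) \<or> (i = K \<and> u = pr x y)"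
    have "bD (\<lambda>s. ?S (s 0) (s (Suc 0)))" by (intro bD_E bD_intros)
    \<comment> \<open>The second bound leaves room for the old values, which lie below
      \<open>g\<close>, and for the new value \<open>y\<close>.\<close>
    from rel_comprehension[OF this, of "K \<oplus> \<one>" "pr X (g \<oplus> y \<oplus> \<one>)"] obtain g' where
      g0: "\<And>i u. E (pr i u) g' \<longleftrightarrow> i \<prec> K \<oplus> \<one> \<and> u \<prec> pr X (g \<oplus> y \<oplus> \<one>) \<and> ?S i u" by blast
    have g': "E (pr i (pr u v)) g' \<longleftrightarrow> (i \<prec> K \<and> E (pr i (pr u v)) g) \<or> (i = K \<and> u = x \<and> v = y)"
      if "u \<prec> X" for i u v
    proof -
      have "pr u v \<prec> pr X (g \<oplus> y \<oplus> \<one>)" if "?S i (pr u v)"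
      proof (rule pr_mono[OF \<open>u \<prec> X\<close>])
        have "v \<prec> g \<or> v = y" using that bnd by auto
        then show "v \<prec> g \<oplus> y \<oplus> \<one>"
          unfolding lt_Suc_iff using le_add[of g y] le_add[of y g] leq_def ar.less_le_trans by metis
      qed
      moreover have "i \<prec> K \<oplus> \<one>" if "?S i (pr u v)" using that unfolding lt_Suc_iff leq_def by blast
      ultimately show ?thesis unfolding g0 by auto
    qed
    have "?tot (K \<oplus> \<one>) g'"
    proof (intro allI impI)
      fix i assume "i \<prec> K \<oplus> \<one>"
      then consider "i \<prec> K" | "i = K" unfolding lt_Suc_iff leq_def by blast
      then show "\<exists>x. x \<prec> X \<and> (\<exists>y. y \<prec> g' \<and> E (pr i (pr x y)) g')"
      proof cases
        case 1
        then obtain u v where "u \<prec> X" "E (pr i (pr u v)) g" using g(1) by blast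
        then show ?thesis using g' 1 bnd by blast
      next
        case 2
        then show ?thesis using g'[OF x, of K y] bnd x by blast
      qed
    qed
    moreover have "?inj (K \<oplus> \<one>) g'"
    proof (intro allI impI)
      fix i i' u v v' assume u: "u \<prec> X" and e: "E (pr i (pr u v)) g'" "E (pr i' (pr u v')) g'"
      from e consider "i \<prec> K" "E (pr i (pr u v)) g" "i' \<prec> K" "E (pr i' (pr u v')) g"
        | "i = K" "i' = K" | j w where "j \<prec> K" "E (pr j (pr x w)) g"
        unfolding g'[OF u] by blast
      then show "i = i'"
      proof cases
        case 1
        then show ?thesis using g(2) u bnd by blast
      next
        case 3
        then show ?thesis using new by blast
      qed simp
    qed
    moreover have "?cor (K \<oplus> \<one>) g'"
    proof (intro allI impI)
      fix i u v assume u: "u \<prec> X" and e: "E (pr i (pr u v)) g'"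
      from e show "R u v" unfolding g'[OF u] using g(3) Rxy u bnd by blast
    qed
    ultimately show False using K(2) by blast
  qed
  moreover have "x \<prec> X \<and> R x y" if "E (pr x y) t" for x y using that t g(3) by blast
  ultimately show ?thesis by blast
qed

text \<open>The outer existential block is contracted to one quantifier, whose witness
  \<open>d\<close> is chosen together with \<open>y\<close> as a pair; projecting the coded pairs to
  their first component gives \<open>t'\<close>.\<close>

lemma uniformize:
  assumes I: "ISigma (Suc k) M" and R: "bS (Suc k) (\<lambda>s. R (s 0) (s (Suc 0)))"
  shows "\<exists>t. (\<forall>x y. E (pr x y) t \<longrightarrow> x \<prec> X \<and> R x y) \<and>
    (\<forall>x y. x \<prec> X \<longrightarrow> R x y \<longrightarrow> (\<exists>y. E (pr x y) t))"
proof -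
  obtain Q0 where Q0: "bP k Q0" "\<And>s. R (s 0) (s (Suc 0)) \<longleftrightarrow> (\<exists>d. Q0 (d ## s))"
    using contract[OF R] by blast
  define Q where "Q x y d = Q0 (d ## x ## y ## (\<lambda>_. \<zero>))" for x y d
  have RQ: "R x y \<longleftrightarrow> (\<exists>d. Q x y d)" for x y
    using Q0(2)[of "x ## y ## (\<lambda>_. \<zero>)"] by (simp add: Q_def)
  have bQ: "bP k (\<lambda>s. Q (f s) (g s) (h s))" if "tmf f" "tmf g" "tmf h" for f g h
  proof -
    let ?f = "h ## f ## g ## (\<lambda>_ _. \<zero>)"
    have "bP k (\<lambda>s. Q0 (\<lambda>i. ?f i s))"
      by (rule bP_subst[OF Q0(1)]) (use that tmf.const in \<open>auto split: nat.split\<close>)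
    moreover have "(\<lambda>i. ?f i s) = h s ## f s ## g s ## (\<lambda>_. \<zero>)" for s
      by (auto split: nat.split)
    ultimately show ?thesis unfolding Q_def by simp
  qed
  define S where "S x z \<longleftrightarrow> (\<exists>y. y \<prec> z \<oplus> \<one> \<and> (\<exists>d. d \<prec> z \<oplus> \<one> \<and> z = pr y d)) \<and>
    (\<forall>y. y \<prec> z \<oplus> \<one> \<longrightarrow> (\<forall>d. d \<prec> z \<oplus> \<one> \<longrightarrow> z = pr y d \<longrightarrow> Q x y d))" for x z
  have S: "S x (pr y d) \<longleftrightarrow> Q x y d" "S x z \<Longrightarrow> \<exists>y d. z = pr y d" for x y d z
    using le_pr(1)[of y d] le_pr(2)[of d y] unfolding S_def by (auto simp: lt_Suc_iff)
  have "bP k (\<lambda>s. S (s 0) (s (Suc 0)))" unfolding S_def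
    by (rule bP_conj, intro bP_of_bD bD_intros)
      (rule bP_ball, intro tm_intros, rule bP_ball, intro tm_intros, rule bP_imp,
        intro bS_of_bD bD_intros, rule bQ; intro tm_intros)
  from uniformize_Pi[OF I this, of X] obtain t where
    t: "\<And>x z. E (pr x z) t \<Longrightarrow> x \<prec> X \<and> S x z" "\<And>x z. x \<prec> X \<Longrightarrow> S x z \<Longrightarrow> \<exists>z. E (pr x z) t"
    by metis
  have "bD (\<lambda>s. \<exists>d. d \<prec> t \<and> E (pr (s 0) (pr (s (Suc 0)) d)) t)" by (intro bD_E bD_intros)
  from rel_comprehension[OF this, of X t] obtain t' where
    t': "\<And>x y. E (pr x y) t' \<longleftrightarrow> x \<prec> X \<and> y \<prec> t \<and> (\<exists>d. d \<prec> t \<and> E (pr x (pr y d)) t)" by blast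
  have "x \<prec> X \<and> R x y" if "E (pr x y) t'" for x y
  proof -
    obtain d where d: "x \<prec> X" "E (pr x (pr y d)) t" using \<open>E (pr x y) t'\<close> t' by blast
    have "Q x y d" using t(1)[OF d(2)] S(1) by blast
    then show ?thesis using RQ d(1) by blast
  qed
  moreover have "\<exists>y. E (pr x y) t'" if x: "x \<prec> X" and Rxy: "R x y" for x y
  proof -
    obtain d where "Q x y d" using RQ Rxy by blast
    then have "S x (pr y d)" using S(1) by blast
    then obtain z where z: "E (pr x z) t" using t(2) x by blast
    then obtain u v where uv: "z = pr u v" using t(1) S(2) by blast
    have "u \<prec> t" "v \<prec> t" using E_less[OF z] le_pr(2)[of z x] le_pr(1)[of u v] le_pr(2)[of v u] unfolding uv by order+
    then show ?thesis using t' z x uv by blast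
  qed
  ultimately show ?thesis by blast
qed

text \<open>Above level 0 the set is the domain of a coded choice relation for
  \<open>\<lambda>x y. P x\<close>, and the domain of a coded relation is coded.\<close>

lemma coded_Sigma:
  assumes I: "ISigma n M" and P: "bS n (\<lambda>s. P (s 0))"
  shows "coded {z. z \<prec> X \<and> P z}"
proof (cases n)
  case 0
  then show ?thesis using codedI P by simp
next
  case (Suc k)
  from uniformize[of k "\<lambda>x y. P x" X] I P Suc obtain t where
    t: "\<And>x y. E (pr x y) t \<Longrightarrow> x \<prec> X \<and> P x" "\<And>x. x \<prec> X \<Longrightarrow> P x \<Longrightarrow> \<exists>y. E (pr x y) t"
    by (simp del: bS.simps) metis
  have "coded {x. x \<prec> X \<and> (\<exists>y. y \<prec> t \<and> E (pr x y) t)}"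
    by (intro codedI bD_E bD_intros)
  moreover have "{x. x \<prec> X \<and> (\<exists>y. y \<prec> t \<and> E (pr x y) t)} = {z. z \<prec> X \<and> P z}"
    using t E_less le_pr(2) ar.le_less_trans by blast
  ultimately show ?thesis by simp
qed

lemma rel_comprehension_Sigma:
  assumes I: "ISigma n M" and R: "bS n (\<lambda>s. R (s 0) (s (Suc 0)))"
  shows "\<exists>g. \<forall>x y. E (pr x y) g \<longleftrightarrow> x \<prec> X \<and> y \<prec> Y \<and> R x y"
proof -
  have "bS n (\<lambda>s. \<exists>x. x \<prec> X \<and> (\<exists>y. y \<prec> Y \<and> s 0 = pr x y \<and> R x y))"
    by (rule bS_bex, intro tm_intros, rule bS_bex, intro tm_intros, rule bS_conj,
        intro bS_of_bD bD_intros, rule bS_comp2[OF R]) (rule tmf.var)+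
  from coded_Sigma[OF I this, of "pr X Y"] obtain c where
    "\<And>z. (z \<prec> pr X Y \<and> (\<exists>x. x \<prec> X \<and> (\<exists>y. y \<prec> Y \<and> z = pr x y \<and> R x y))) \<longleftrightarrow> E z c"
    unfolding coded_def by blast
  then show ?thesis using pr_mono by (intro exI[of _ c]) (metis pr_inj)
qed

end

section \<open>Generic shrinking sequences and coded functions\<close>

lemma ISigma_mono: "ISigma n M \<Longrightarrow> m \<le> n \<Longrightarrow> ISigma m M"
  unfolding ISigma_def by (meson sigma_pi_mono(1))

context coded_model
begin

context
  fixes C :: "nat \<Rightarrow> 'a" and a b :: 'a
  assumes C: "\<And>k. C k = a \<otimes> C (Suc k)" and C0: "C 0 \<noteq> \<zero>" and a: "\<one> \<prec> a" and b: "\<zero> \<prec> b"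
begin

lemma C_nonzero: "C k \<noteq> \<zero>"
proof (induction k)
  case (Suc k)
  then show ?case using C[of k] by auto
qed (rule C0)

text \<open>The index \<open>k\<close> counts the factors \<open>a\<close> already spent. Only coded
  injections are considered, so that largeness can be argued for inside the model.\<close>

definition large :: "nat \<Rightarrow> 'a set \<Rightarrow> bool" where
  "large k A \<longleftrightarrow> coded A \<and> \<not> small A (C k \<otimes> b)"

lemma large_ne: "large k A \<Longrightarrow> A \<noteq> {}"
  unfolding large_def small_def by auto

text \<open>Putting \<open>B\<close> back adds \<open>b\<close> to the size of the target. Since
  \<open>C (Suc k)\<close> is at least 1 and \<open>a\<close> at least 2, this is covered by
  doubling, hence by one factor \<open>a\<close>.\<close>

lemma large_avoid:
  assumes "large k A" "coded B" "small B b"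
  shows "large (Suc k) (A - B)"
proof -
  have cod: "coded (A - B)"
    using coded_sub[of A "\<lambda>x. x \<notin> B"] assms(1,2) bD.neg[OF bD_mem[OF assms(2) tmf.var]]
    unfolding large_def by (simp add: set_diff_eq)
  moreover have "\<not> small (A - B) (C (Suc k) \<otimes> b)"
  proof
    assume "small (A - B) (C (Suc k) \<otimes> b)"
    from small_union[OF cod assms(2) this assms(3)]
    have "small A (C (Suc k) \<otimes> b \<oplus> b)" by (rule small_subset) blast
    moreover have "C (Suc k) \<otimes> b \<oplus> b \<preceq> C k \<otimes> b"
    proof -
      have "b \<preceq> C (Suc k) \<otimes> b" using le_mult[OF C_nonzero, of b "Suc k"] by (simp add: alg(7))
      then have "C (Suc k) \<otimes> b \<oplus> b \<preceq> C (Suc k) \<otimes> b \<oplus> C (Suc k) \<otimes> b" by simp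
      also have "\<dots> = (\<one> \<oplus> \<one>) \<otimes> (C (Suc k) \<otimes> b)"
        by (simp only: ar.distrib_right ar.mult_1_left)
      also have "\<dots> \<preceq> a \<otimes> (C (Suc k) \<otimes> b)"
        by (rule ar.mult_right_mono[OF iffD2[OF Suc_le_iff a]]) simp
      also have "\<dots> = C k \<otimes> b" unfolding C[of k] by (simp add: alg(6))
      finally show ?thesis .
    qed
    ultimately show False using assms(1) small_mono unfolding large_def by blast
  qed
  ultimately show ?thesis unfolding large_def by blast
qed

lemma large_fibre:
  assumes "large k A" "\<And>x. x \<in> A \<Longrightarrow> \<exists>i. i \<prec> a \<and> E (pr x i) t"
  shows "\<exists>i. i \<prec> a \<and> large (Suc k) {x \<in> A. E (pr x i) t}"
proof (rule ccontr)
  assume *: "\<not> ?thesis"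
  have "coded A" using assms(1) unfolding large_def by blast
  moreover have "small {x \<in> A. E (pr x i) t} (C (Suc k) \<otimes> b)" if "i \<prec> a" for i
  proof -
    have "coded {x \<in> A. E (pr x i) t}" by (intro coded_sub \<open>coded A\<close> bD_E tm_intros)
    then show ?thesis using * that unfolding large_def by blast
  qed
  ultimately have "small {x \<in> A. \<exists>i. i \<prec> a \<and> E (pr x i) t} (a \<otimes> (C (Suc k) \<otimes> b))"
    by (rule small_fibres)
  moreover have "{x \<in> A. \<exists>i. i \<prec> a \<and> E (pr x i) t} = A" using assms(2) by blast
  moreover have "a \<otimes> (C (Suc k) \<otimes> b) = C k \<otimes> b" unfolding C[of k] by (simp add: alg(6))
  ultimately show False using assms(1) unfolding large_def by simp
qed

text \<open>The index is 1 and not 0: the interval does inject into \<open>C 0 \<otimes> b\<close>,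
  and giving up one factor makes the pigeonhole principle applicable.\<close>

lemma large_start: "large (Suc 0) {x. x \<prec> C 0 \<otimes> b}"
proof -
  have "C (Suc 0) \<prec> C 0" unfolding C[of 0]
    using ar.mult_strict_right_mono[OF a, of "C (Suc 0)"] C_nonzero PA(17) by auto
  then have "C (Suc 0) \<otimes> b \<prec> C 0 \<otimes> b" using b by (rule ar.mult_strict_right_mono)
  moreover have "coded {x. x \<prec> C 0 \<otimes> b}"
    using codedI[of "\<lambda>_. True"] bD_const by simp
  ultimately show ?thesis unfolding large_def using pigeonhole by blast
qed

text \<open>All elements \<open>t\<close> are enumerated, and each is treated both as the code of a
  set to be avoided and as the code of a relation to be made constant.\<close>

lemma shrinking_sequence:
  assumes "countable (UNIV :: 'a set)"
  shows "\<exists>S :: nat \<Rightarrow> 'a set. (\<forall>k. S (Suc k) \<subseteq> S k) \<and> (\<forall>k. S k \<noteq> {}) \<and> (\<forall>k. S k \<subseteq> {x. x \<prec> C 0 \<otimes> b})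
    \<and> (\<forall>t. (\<forall>x. x \<prec> C 0 \<otimes> b \<longrightarrow> (\<exists>i. i \<prec> a \<and> E (pr x i) t)) \<longrightarrow>
         (\<exists>k i. i \<prec> a \<and> (\<forall>x\<in>S k. E (pr x i) t)))
    \<and> (\<forall>B. coded B \<longrightarrow> small B b \<longrightarrow> (\<exists>k. S k \<inter> B = {}))"
proof -
  let ?L = "C 0 \<otimes> b"
  \<comment> \<open>One factor \<open>a\<close> was spent at the start and each stage spends two,
    one for avoiding and one for passing to a fibre.\<close>
  define good where "good k A \<longleftrightarrow> large (Suc (2 * k)) A \<and> A \<subseteq> {x. x \<prec> ?L}" for k A
  define task where "task t A B \<longleftrightarrow> B \<subseteq> A \<and> (small {x. E x t} b \<longrightarrow> B \<inter> {x. E x t} = {}) \<and>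
    ((\<forall>x. x \<prec> ?L \<longrightarrow> (\<exists>i. i \<prec> a \<and> E (pr x i) t)) \<longrightarrow> (\<exists>i. i \<prec> a \<and> (\<forall>x\<in>B. E (pr x i) t)))" for t A B
  have step: "\<exists>B. good (Suc k) B \<and> task t A B" if A: "good k A" for k A t
  proof -
    define A1 where "A1 = (if small {x. E x t} b then A - {x. E x t} else A)"
    have A1: "large (Suc (Suc (2 * k))) A1"
    proof (cases "small {x. E x t} b")
      case True
      have "coded {x. E x t}" unfolding coded_def by blast
      then show ?thesis using True A large_avoid unfolding good_def A1_def by auto
    next
      case False
      \<comment> \<open>Removing the empty set spends the factor although there is nothing to avoid,
        which keeps the indices uniform.\<close>
      have "small {} b" unfolding small_def by simp
      moreover have "coded {}" using codedI[of "\<lambda>_. False"] bD_const by simp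
      ultimately show ?thesis
        using False A large_avoid[of "Suc (2 * k)" A "{}"] unfolding good_def A1_def by auto
    qed
    have sub: "A1 \<subseteq> A" "A \<subseteq> {x. x \<prec> ?L}" using A unfolding A1_def good_def by auto
    have dis: "small {x. E x t} b \<Longrightarrow> A1 \<inter> {x. E x t} = {}" unfolding A1_def by auto
    show ?thesis
    proof (cases "\<forall>x. x \<prec> ?L \<longrightarrow> (\<exists>i. i \<prec> a \<and> E (pr x i) t)")
      case True
      then have "\<exists>i. i \<prec> a \<and> E (pr x i) t" if "x \<in> A1" for x using sub that by blast
      from large_fibre[OF A1 this] obtain i where
        i: "i \<prec> a" "large (Suc (Suc (Suc (2 * k)))) {x \<in> A1. E (pr x i) t}" by blast
      show ?thesis
        by (rule exI[of _ "{x \<in> A1. E (pr x i) t}"]) (use i sub dis in \<open>auto simp: good_def task_def\<close>)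
    next
      case False
      have "small {} b" unfolding small_def by simp
      moreover have "coded {}" using codedI[of "\<lambda>_. False"] bD_const by simp
      ultimately have "large (Suc (Suc (Suc (2 * k)))) A1"
        using A1 large_avoid[of "Suc (Suc (2 * k))" A1 "{}"] by simp
      then show ?thesis
        by (intro exI[of _ A1]) (use False sub dis in \<open>auto simp: good_def task_def\<close>)
    qed
  qed
  have "\<exists>A. good 0 A" using large_start unfolding good_def by auto
  then obtain S where S: "\<And>k. good k (S k)" "\<And>k. task (from_nat_into UNIV k) (S k) (S (Suc k))"
    using dependent_nat_choice[of good "\<lambda>k. task (from_nat_into UNIV k)"] step by blast
  have "\<exists>k. t = from_nat_into UNIV k" for t :: 'a
    using from_nat_into_surj[OF assms, of t] by auto
  then have all: "\<exists>k. task t (S k) (S (Suc k))" for t using S(2) by metis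
  show ?thesis
  proof (rule exI[of _ S], intro conjI allI impI)
    fix k
    show "S (Suc k) \<subseteq> S k" using S(2)[of k] unfolding task_def by blast
    show "S k \<noteq> {}" using S(1)[of k] large_ne unfolding good_def by blast
    show "S k \<subseteq> {x. x \<prec> ?L}" using S(1)[of k] unfolding good_def by blast
  next
    fix t assume "\<forall>x. x \<prec> ?L \<longrightarrow> (\<exists>i. i \<prec> a \<and> E (pr x i) t)"
    then show "\<exists>k i. i \<prec> a \<and> (\<forall>x\<in>S k. E (pr x i) t)" using all[of t] unfolding task_def by blast
  next
    fix B assume "coded B" "small B b"
    then obtain t where t: "B = {x. E x t}" unfolding coded_def by blast
    then show "\<exists>k. S k \<inter> B = {}" using all[of t] \<open>small B b\<close> unfolding task_def by blast
  qed
qed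

end

end

section \<open>Coded functions along the shrinking sequence\<close>

locale generic = coded_model M \<theta> for M :: "'a struc" and \<theta> +
  fixes n :: nat and a b L :: 'a and S :: "nat \<Rightarrow> 'a set"
  assumes In: "ISigma n M" and a: "\<one> \<prec> a"
    and S_dec: "\<And>k. S (Suc k) \<subseteq> S k" and S_ne: "\<And>k. S k \<noteq> {}" and S_L: "\<And>k x. x \<in> S k \<Longrightarrow> x \<prec> L"
    and S_const: "\<And>t. (\<And>x. x \<prec> L \<Longrightarrow> \<exists>i. i \<prec> a \<and> E (pr x i) t) \<Longrightarrow>
         \<exists>k i. i \<prec> a \<and> (\<forall>x\<in>S k. E (pr x i) t)"
    and S_avoid: "\<And>B. coded B \<Longrightarrow> small B b \<Longrightarrow> \<exists>k. S k \<inter> B = {}"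
begin

text \<open>Membership in the filter generated by the sets \<open>S k\<close>. This filter need not
  be ultra; \<open>Ev_decide\<close> shows that it decides the coded sets.\<close>

definition Ev :: "('a \<Rightarrow> bool) \<Rightarrow> bool" where "Ev P \<longleftrightarrow> (\<exists>k. \<forall>x\<in>S k. P x)"

text \<open>Only the part of \<open>f\<close> below \<open>L\<close> is coded. Other values are
  arbitrary and invisible to \<open>Ev\<close>, because every \<open>S k\<close> lies below
  \<open>L\<close>.\<close>

definition FN :: "('a \<Rightarrow> 'a) \<Rightarrow> bool" where
  "FN f \<longleftrightarrow> (\<exists>t. \<forall>x y. E (pr x y) t \<longleftrightarrow> x \<prec> L \<and> f x = y)"

lemma S_anti: "k \<le> l \<Longrightarrow> S l \<subseteq> S k"
  using S_dec by (rule lift_Suc_antimono_le)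

lemma Ev_conj: "Ev (\<lambda>x. P x \<and> Q x) \<longleftrightarrow> Ev P \<and> Ev Q"
proof
  assume "Ev P \<and> Ev Q"
  then obtain k l where "\<forall>x\<in>S k. P x" "\<forall>x\<in>S l. Q x" unfolding Ev_def by blast
  then have "\<forall>x\<in>S (max k l). P x \<and> Q x" using S_anti[of k "max k l"] S_anti[of l "max k l"] by auto
  then show "Ev (\<lambda>x. P x \<and> Q x)" unfolding Ev_def by blast
qed (auto simp: Ev_def)

lemma Ev_mono: "Ev P \<Longrightarrow> (\<And>x. x \<prec> L \<Longrightarrow> P x \<Longrightarrow> Q x) \<Longrightarrow> Ev Q"
  unfolding Ev_def using S_L by blast

lemma Ev_mono2: "Ev P \<Longrightarrow> Ev Q \<Longrightarrow> (\<And>x. x \<prec> L \<Longrightarrow> P x \<Longrightarrow> Q x \<Longrightarrow> R x) \<Longrightarrow> Ev R"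
  using Ev_conj[of P Q] Ev_mono[of "\<lambda>x. P x \<and> Q x" R] by blast

lemma Ev_all: "(\<And>x. x \<prec> L \<Longrightarrow> P x) \<Longrightarrow> Ev P"
  unfolding Ev_def using S_L by blast

lemma Ev_ex: "Ev P \<Longrightarrow> \<exists>x. x \<prec> L \<and> P x"
  unfolding Ev_def using S_L S_ne by blast

lemma Ev_const [simp]: "Ev (\<lambda>_. P) \<longleftrightarrow> P"
  unfolding Ev_def using S_ne by blast

lemma Ev_not: "Ev P \<Longrightarrow> Ev (\<lambda>x. \<not> P x) \<Longrightarrow> False"
  using Ev_conj[of P "\<lambda>x. \<not> P x"] by simp

text \<open>Apply \<open>S_const\<close> to the characteristic function; its two values lie below
  \<open>a\<close> because \<open>a\<close> exceeds 1.\<close>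

lemma Ev_decide:
  assumes "coded {x. x \<prec> L \<and> P x}" shows "Ev P \<or> Ev (\<lambda>x. \<not> P x)"
proof -
  let ?A = "{x. x \<prec> L \<and> P x}"
  have "bD (\<lambda>s. s 0 \<in> ?A \<and> s (Suc 0) = \<zero> \<or> s 0 \<notin> ?A \<and> s (Suc 0) = \<one>)"
    by (intro bD_mem assms bD_intros)
  from rel_comprehension[OF this, of L a] obtain t where
    t: "\<And>x y. E (pr x y) t \<longleftrightarrow> x \<prec> L \<and> y \<prec> a \<and> (x \<in> ?A \<and> y = \<zero> \<or> x \<notin> ?A \<and> y = \<one>)" by blast
  have "\<zero> \<prec> a" using a ar.zero_less_one by order
  then have "\<exists>i. i \<prec> a \<and> E (pr x i) t" if "x \<prec> L" for x using t a that by blast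
  from S_const[OF this] obtain k i where "\<forall>x\<in>S k. E (pr x i) t" by blast
  then have "\<forall>x\<in>S k. P x \<and> i = \<zero> \<or> \<not> P x \<and> i = \<one>" unfolding t by blast
  then show ?thesis unfolding Ev_def using ar.zero_neq_one by metis
qed

lemma least:
  assumes "bD (\<lambda>s. P (s 0))" "P y"
  shows "\<exists>y. P y \<and> (\<forall>z. z \<prec> y \<longrightarrow> \<not> P z)"
proof (rule ccontr)
  assume *: "\<not> ?thesis"
  have "\<forall>z. z \<prec> y \<oplus> \<one> \<longrightarrow> \<not> P z"
  proof (rule bD_induct[of "\<lambda>y. \<forall>z. z \<prec> y \<oplus> \<one> \<longrightarrow> \<not> P z"])
    show "bD (\<lambda>s. \<forall>z. z \<prec> s 0 \<oplus> \<one> \<longrightarrow> \<not> P z)" by (intro bD_comp1[OF assms(1)] bD_intros)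
    show "\<forall>z. z \<prec> \<zero> \<oplus> \<one> \<longrightarrow> \<not> P z" using * lt_Suc_iff leq_def lt_zero by metis
    fix x assume "\<forall>z. z \<prec> x \<oplus> \<one> \<longrightarrow> \<not> P z"
    then show "\<forall>z. z \<prec> x \<oplus> \<one> \<oplus> \<one> \<longrightarrow> \<not> P z" using * lt_Suc_iff leq_def by metis
  qed
  then show False using assms(2) by simp
qed

text \<open>The least value makes the relation functional, and minimality is again Delta_0.\<close>

lemma FN_choose:
  assumes R: "bD (\<lambda>s. R (s 0) (s (Suc 0)))" and ex: "\<And>x. x \<prec> L \<Longrightarrow> \<exists>y. y \<prec> B \<and> R x y"
  shows "\<exists>f. FN f \<and> (\<forall>x. x \<prec> L \<longrightarrow> R x (f x) \<and> f x \<prec> B)"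
proof -
  let ?Q = "\<lambda>x y. R x y \<and> (\<forall>z. z \<prec> y \<longrightarrow> \<not> R x z)"
  have uni: "\<exists>y. y \<prec> B \<and> ?Q x y" if x: "x \<prec> L" for x
  proof -
    obtain y0 where y0: "y0 \<prec> B" "R x y0" using ex[OF x] by blast
    have "bD (\<lambda>s. R x (s 0))" by (intro bD_comp2[OF R] tm_intros)
    from least[OF this y0(2)] obtain y where y: "?Q x y" by blast
    then have "y \<preceq> y0" using y0 ar.not_less by blast
    then have "y \<prec> B" using y0(1) by order
    then show ?thesis using y by blast
  qed
  have uniq: "y = y'" if "?Q x y" "?Q x y'" for x y y' using that PA(11) by metis
  define f where "f x = (SOME y. y \<prec> B \<and> ?Q x y)" for x
  have f: "f x \<prec> B \<and> ?Q x (f x)" if "x \<prec> L" for x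
    unfolding f_def by (rule someI_ex) (rule uni[OF that])
  have "bD (\<lambda>s. ?Q (s 0) (s (Suc 0)))" by (intro bD_comp2[OF R] bD_intros)
  from rel_comprehension[OF this, of L B] obtain t where
    "\<And>x y. E (pr x y) t \<longleftrightarrow> x \<prec> L \<and> y \<prec> B \<and> ?Q x y" by blast
  then have "\<forall>x y. E (pr x y) t \<longleftrightarrow> x \<prec> L \<and> f x = y" using f uniq by metis
  then show ?thesis using f unfolding FN_def by blast
qed

lemma FN_choose_code:
  "\<exists>f. FN f \<and> (\<forall>x. x \<prec> L \<longrightarrow> (\<exists>y. E (pr x y) t) \<longrightarrow> E (pr x (f x)) t)"
proof -
  \<comment> \<open>The default value zero makes the relation total.\<close>
  let ?R = "\<lambda>x y. E (pr x y) t \<or> \<not> (\<exists>z. z \<prec> t \<and> E (pr x z) t) \<and> y = \<zero>"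
  have bnd: "y \<prec> t" if "E (pr x y) t" for x y using E_less[OF that] le_pr(2)[of y x] by order
  have "bD (\<lambda>s. ?R (s 0) (s (Suc 0)))" by (intro bD_E bD_intros)
  moreover have "\<exists>y. y \<prec> t \<oplus> \<one> \<and> ?R x y" for x
  proof (cases "\<exists>z. z \<prec> t \<and> E (pr x z) t")
    case True
    then show ?thesis unfolding lt_Suc_iff leq_def by blast
  next
    case False
    then show ?thesis unfolding lt_Suc_iff by (intro exI[of _ \<zero>]) simp
  qed
  ultimately have "\<exists>f. FN f \<and> (\<forall>x. x \<prec> L \<longrightarrow> ?R x (f x) \<and> f x \<prec> t \<oplus> \<one>)" by (rule FN_choose)
  then obtain f where "FN f" "\<forall>x. x \<prec> L \<longrightarrow> ?R x (f x)" by blast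
  then show ?thesis using bnd by blast
qed

lemma FN_I:
  assumes "bD (\<lambda>s. R (s 0) (s (Suc 0)))" and "\<And>x y. x \<prec> L \<Longrightarrow> R x y \<longleftrightarrow> f x = y"
    and "\<And>x. x \<prec> L \<Longrightarrow> f x \<prec> B"
  shows "FN f"
proof -
  obtain t where "\<And>x y. E (pr x y) t \<longleftrightarrow> x \<prec> L \<and> y \<prec> B \<and> R x y"
    using rel_comprehension[OF assms(1), of L B] by blast
  then have "\<forall>x y. E (pr x y) t \<longleftrightarrow> x \<prec> L \<and> f x = y" using assms(2,3) by metis
  then show ?thesis unfolding FN_def by blast
qed

lemma FN_code:
  assumes "FN f" obtains t where "\<And>x y. E (pr x y) t \<longleftrightarrow> x \<prec> L \<and> f x = y" "\<And>x. x \<prec> L \<Longrightarrow> f x \<prec> t"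
proof -
  obtain t where t: "\<And>x y. E (pr x y) t \<longleftrightarrow> x \<prec> L \<and> f x = y" using assms unfolding FN_def by blast
  moreover have "f x \<prec> t" if "x \<prec> L" for x
    using E_less[of "pr x (f x)" t] le_pr(2)[of "f x" x] t that ar.le_less_trans by blast
  ultimately show ?thesis using that by blast
qed

lemma FN_const [simp]: "FN (\<lambda>_. d)"
  by (rule FN_I[of "\<lambda>x y. y = d" _ "d \<oplus> \<one>"]) (auto intro: bD_intros)

lemma FN_id: "FN (\<lambda>x. x)"
  by (rule FN_I[of "\<lambda>x y. x = y" _ L]) (auto intro: bD_intros)

lemma FN_plus: assumes "FN f" "FN g" shows "FN (\<lambda>x. f x \<oplus> g x)"
proof -
  obtain t where t: "\<And>x y. E (pr x y) t \<longleftrightarrow> x \<prec> L \<and> f x = y" "\<And>x. x \<prec> L \<Longrightarrow> f x \<prec> t"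
    using FN_code[OF assms(1)] by blast
  obtain u where u: "\<And>x y. E (pr x y) u \<longleftrightarrow> x \<prec> L \<and> g x = y" "\<And>x. x \<prec> L \<Longrightarrow> g x \<prec> u"
    using FN_code[OF assms(2)] by blast
  show ?thesis
  proof (rule FN_I[where B = "t \<oplus> u"])
    show "bD (\<lambda>s. \<exists>v. v \<prec> t \<and> (\<exists>w. w \<prec> u \<and> E (pr (s 0) v) t \<and> E (pr (s 0) w) u \<and> s (Suc 0) = v \<oplus> w))"
      by (intro bD_E bD_intros)
  qed (use t u in \<open>auto intro: ar.add_strict_mono\<close>)
qed

lemma FN_times: assumes "FN f" "FN g" shows "FN (\<lambda>x. f x \<otimes> g x)"
proof -
  obtain t where t: "\<And>x y. E (pr x y) t \<longleftrightarrow> x \<prec> L \<and> f x = y" "\<And>x. x \<prec> L \<Longrightarrow> f x \<prec> t"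
    using FN_code[OF assms(1)] by blast
  obtain u where u: "\<And>x y. E (pr x y) u \<longleftrightarrow> x \<prec> L \<and> g x = y" "\<And>x. x \<prec> L \<Longrightarrow> g x \<prec> u"
    using FN_code[OF assms(2)] by blast
  show ?thesis
  proof (rule FN_I[where B = "t \<otimes> u \<oplus> \<one>"])
    show "bD (\<lambda>s. \<exists>v. v \<prec> t \<and> (\<exists>w. w \<prec> u \<and> E (pr (s 0) v) t \<and> E (pr (s 0) w) u \<and> s (Suc 0) = v \<otimes> w))"
      by (intro bD_E bD_intros)
    show "f x \<otimes> g x \<prec> t \<otimes> u \<oplus> \<one>" if "x \<prec> L" for x
      unfolding lt_Suc_iff using t(2)[OF that] u(2)[OF that] by (intro ar.mult_mono) auto
  qed (use t u in auto)
qed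

lemma FN_eval: "(\<And>i. FN (F i)) \<Longrightarrow> FN (\<lambda>x. eval M (\<lambda>i. F i x) t)"
  by (induction t) (auto intro: FN_plus FN_times)

text \<open>A coded function is not a term function, so its value is introduced by a bounded
  existential quantifier over its graph, which preserves the class. One variable is replaced at a
  time, hence the restriction to finite \<open>J\<close>; the free variables of a formula are
  enough.\<close>

lemma bS_FN_subst:
  assumes "bS m P" "\<And>i. FN (F i)" "finite J"
  shows "\<exists>Q. bS m Q \<and> (\<forall>x s. x \<prec> L \<longrightarrow> Q (x ## s) = P (\<lambda>i. if i \<in> J then F i x else s i))"
  using assms(3)
proof (induction J rule: finite_induct)
  case empty
  have "bS m (\<lambda>s. P (\<lambda>i. s (Suc i)))" by (rule bS_subst[OF assms(1)]) (rule tmf.var)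
  then show ?case by (intro exI[of _ "\<lambda>s. P (\<lambda>i. s (Suc i))"]) simp
next
  case (insert l J)
  then obtain Q where Q: "bS m Q" "\<And>x s. x \<prec> L \<Longrightarrow> Q (x ## s) = P (\<lambda>i. if i \<in> J then F i x else s i)"
    by blast
  obtain t where t: "\<And>x y. E (pr x y) t \<longleftrightarrow> x \<prec> L \<and> F l x = y" "\<And>x. x \<prec> L \<Longrightarrow> F l x \<prec> t"
    using FN_code[OF assms(2)] by blast
  let ?Q = "\<lambda>s. \<exists>y. y \<prec> t \<and> E (pr (s 0) y) t \<and> Q (s 0 ## (\<lambda>i. s (Suc i))(l := y))"
  have "bS m (\<lambda>s. Q (s (Suc 0) ## (\<lambda>i. s (Suc (Suc i)))(l := s 0)))"
  proof -
    let ?f = "case_nat (\<lambda>s. s (Suc 0)) (\<lambda>i. if i = l then (\<lambda>s. s 0) else (\<lambda>s. s (Suc (Suc i))))"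
    have "bS m (\<lambda>s. Q (\<lambda>i. ?f i s))"
      by (rule bS_subst[OF Q(1)]) (auto split: nat.split intro: tmf.var)
    moreover have "(\<lambda>i. ?f i s) = s (Suc 0) ## (\<lambda>i. s (Suc (Suc i)))(l := s 0)" for s :: "nat \<Rightarrow> 'a"
      by (auto split: nat.split)
    ultimately show ?thesis by simp
  qed
  then have "bS m ?Q"
    by (rule_tac bS_bex, intro tm_intros, rule_tac bS_conj, intro bS_of_bD bD_E tm_intros)
  moreover have "?Q (x ## s) = P (\<lambda>i. if i \<in> insert l J then F i x else s i)" if x: "x \<prec> L" for x s
  proof -
    have "?Q (x ## s) = Q (x ## s(l := F l x))" using t x by auto
    also have "\<dots> = P (\<lambda>i. if i \<in> J then F i x else (s(l := F l x)) i)" by (rule Q(2)[OF x])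
    also have "(\<lambda>i. if i \<in> J then F i x else (s(l := F l x)) i) = (\<lambda>i. if i \<in> insert l J then F i x else s i)"
      using insert.hyps by auto
    finally show ?thesis .
  qed
  ultimately show ?case by blast
qed

lemma sat_rel:
  assumes "sigma_fm m p" "\<And>i. FN (F i)"
  shows "\<exists>R. bS m (\<lambda>s. R (s 0) (s (Suc 0))) \<and>
    (\<forall>x y. x \<prec> L \<longrightarrow> R x y = sat M p ((\<lambda>i. F i x)(v := y)))"
proof -
  obtain Q where Q: "bS m Q"
    "\<And>x s. x \<prec> L \<Longrightarrow> Q (x ## s) = sat M p (\<lambda>i. if i \<in> fv p - {v} then F i x else s i)"
    using bS_FN_subst[OF bS_sat(1)[OF assms(1)], of F "fv p - {v}"] assms(2) finite_fv by blast
  have "bS m (\<lambda>s. Q (s 0 ## (\<lambda>_. s (Suc 0))))"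
  proof -
    let ?f = "case_nat (\<lambda>s. s 0) (\<lambda>i s. s (Suc 0))"
    have "bS m (\<lambda>s. Q (\<lambda>i. ?f i s))"
      by (rule bS_subst[OF Q(1)]) (auto split: nat.split intro: tmf.var)
    moreover have "(\<lambda>i. ?f i s) = s 0 ## (\<lambda>_. s (Suc 0))" for s :: "nat \<Rightarrow> 'a"
      by (auto split: nat.split)
    ultimately show ?thesis by simp
  qed
  \<comment> \<open>Giving every remaining variable the value \<open>y\<close> is harmless, since
    \<open>v\<close> is the only free variable of \<open>p\<close> that was not replaced.\<close>
  moreover have "Q (x ## (\<lambda>_. y)) = sat M p ((\<lambda>i. F i x)(v := y))" if "x \<prec> L" for x y
    unfolding Q(2)[OF that] by (rule sat_cong) auto
  ultimately show ?thesis by (intro exI[of _ "\<lambda>x y. Q (x ## (\<lambda>_. y))"]) blast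
qed

lemma coded_sat:
  assumes "sigma_fm m p" "m \<le> n" "\<And>i. FN (F i)"
  shows "coded {x. x \<prec> L \<and> sat M p (\<lambda>i. F i x)}"
proof -
  obtain v where v: "v \<notin> fv p" using obtain_fresh[OF finite_fv[of p]] by blast
  obtain R where R: "bS m (\<lambda>s. R (s 0) (s (Suc 0)))"
    "\<And>x y. x \<prec> L \<Longrightarrow> R x y = sat M p ((\<lambda>i. F i x)(v := y))"
    using sat_rel[of m p F v] assms by blast
  have "bS n (\<lambda>s. R (s 0) \<zero>)" by (rule bS_mono[OF assms(2)], rule bS_comp2[OF R(1)]) (intro tm_intros)+
  then have "coded {x. x \<prec> L \<and> R x \<zero>}" by (rule coded_Sigma[OF In])
  moreover have "R x \<zero> = sat M p (\<lambda>i. F i x)" if "x \<prec> L" for x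
    unfolding R(2)[OF that] by (rule sat_cong) (use v in auto)
  ultimately show ?thesis by (simp cong: conj_cong)
qed

lemma Ev_sat_decide:
  assumes "sigma_fm m p \<or> pi_fm m p" "m \<le> n" "\<And>i. FN (F i)"
  shows "Ev (\<lambda>x. sat M p (\<lambda>i. F i x)) \<or> Ev (\<lambda>x. \<not> sat M p (\<lambda>i. F i x))"
  using assms(1)
proof
  assume "sigma_fm m p"
  then have "coded {x. x \<prec> L \<and> sat M p (\<lambda>i. F i x)}" by (rule coded_sat[OF _ assms(2)]) (rule assms(3))
  then show ?thesis by (rule Ev_decide)
next
  assume "pi_fm m p"
  then obtain p' where p': "sigma_fm m p'" "\<And>s. sat M p' s \<longleftrightarrow> \<not> sat M p s"
    using neg_sigma_pi(2) by blast
  have "coded {x. x \<prec> L \<and> sat M p' (\<lambda>i. F i x)}" by (rule coded_sat[OF p'(1) assms(2)]) (rule assms(3))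
  then have "Ev (\<lambda>x. sat M p' (\<lambda>i. F i x)) \<or> Ev (\<lambda>x. \<not> sat M p' (\<lambda>i. F i x))"
    by (rule Ev_decide)
  then show ?thesis unfolding p'(2) by auto
qed

text \<open>Skolem functions for the existential case of Los's theorem. The appeal to
  \<open>uniformize\<close> requires induction at level \<open>Suc m\<close>, which is the source of
  the restriction to level n.\<close>

lemma witness_Sigma:
  assumes "sigma_fm (Suc m) p" "Suc m \<le> n" "\<And>i. FN (F i)"
  shows "\<exists>g. FN g \<and> (\<forall>x y. x \<prec> L \<longrightarrow> sat M p ((\<lambda>i. F i x)(v := y)) \<longrightarrow>
    sat M p ((\<lambda>i. F i x)(v := g x)))"
proof -
  obtain R where R: "bS (Suc m) (\<lambda>s. R (s 0) (s (Suc 0)))"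
    "\<And>x y. x \<prec> L \<Longrightarrow> R x y = sat M p ((\<lambda>i. F i x)(v := y))"
    using sat_rel[of "Suc m" p F v] assms by blast
  obtain t where t: "\<And>x y. E (pr x y) t \<Longrightarrow> R x y" "\<And>x y. x \<prec> L \<Longrightarrow> R x y \<Longrightarrow> \<exists>y. E (pr x y) t"
    using uniformize[OF ISigma_mono[OF In assms(2)] R(1), of L] by blast
  obtain g where "FN g" "\<And>x. x \<prec> L \<Longrightarrow> \<exists>y. E (pr x y) t \<Longrightarrow> E (pr x (g x)) t"
    using FN_choose_code[of t] by blast
  then show ?thesis using R(2) t by blast
qed

text \<open>For a bounded quantifier the values of \<open>h\<close> have a common bound
  \<open>u\<close>, so witnesses can be chosen by Delta_0 means; in this way bounded formulas are
  handled also for n = 0.\<close>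

lemma witness_bounded:
  assumes "delta0 p" "\<And>i. FN (F i)" "FN h"
  shows "\<exists>g. FN g \<and> (\<forall>x y. x \<prec> L \<longrightarrow> y \<prec> h x \<longrightarrow> sat M p ((\<lambda>i. F i x)(v := y)) \<longrightarrow>
    g x \<prec> h x \<and> sat M p ((\<lambda>i. F i x)(v := g x)))"
proof -
  obtain R where R: "bD (\<lambda>s. R (s 0) (s (Suc 0)))"
    "\<And>x y. x \<prec> L \<Longrightarrow> R x y = sat M p ((\<lambda>i. F i x)(v := y))"
    using sat_rel[of 0 p F v] assms sigma_fm_pi_fm.intros(1) by (metis bS.simps(1))
  obtain u where u: "\<And>x y. E (pr x y) u \<longleftrightarrow> x \<prec> L \<and> h x = y" "\<And>x. x \<prec> L \<Longrightarrow> h x \<prec> u"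
    using FN_code[OF assms(3)] by blast
  have "bD (\<lambda>s. R (s 0) (s (Suc 0)) \<and> (\<exists>z. z \<prec> u \<and> E (pr (s 0) z) u \<and> s (Suc 0) \<prec> z))"
    by (intro bD_comp2[OF R(1)] bD_E bD_intros)
  from rel_comprehension[OF this, of L u] obtain t where
    t: "\<And>x y. E (pr x y) t \<longleftrightarrow> x \<prec> L \<and> y \<prec> u \<and> R x y \<and> (\<exists>z. z \<prec> u \<and> E (pr x z) u \<and> y \<prec> z)"
    by blast
  have t': "E (pr x y) t \<longleftrightarrow> R x y \<and> y \<prec> h x" if "x \<prec> L" for x y
    unfolding t u(1) using that u(2)[OF that] PA(10) by blast
  obtain g where "FN g" "\<And>x. x \<prec> L \<Longrightarrow> \<exists>y. E (pr x y) t \<Longrightarrow> E (pr x (g x)) t"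
    using FN_choose_code[of t] by blast
  then show ?thesis using R(2) t' by blast
qed

end

section \<open>The coded ultrapower\<close>

text \<open>The universal axioms of PA^- as one bounded formula; the difference in the subtraction
  axiom is bounded by \<open>y\<close>, hence below y+1. Every construction that preserves Delta_0
  truth therefore preserves PA^-: the ultrapower, the transport along a bijection and the union of a
  chain.\<close>

definition PAminus_matrix :: fm where
  "PAminus_matrix = (let x = Var 0; y = Var 1; w = Var 2;
     imp = (\<lambda>p q. Disj (Neg p) q) in
     foldr Conj
      [Eq (Plus (Plus x y) w) (Plus x (Plus y w)),
       Eq (Plus x y) (Plus y x),
       Eq (Times (Times x y) w) (Times x (Times y w)),
       Eq (Times x y) (Times y x),
       Eq (Times x (Plus y w)) (Plus (Times x y) (Times x w)),
       Eq (Plus x Zero) x,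
       Eq (Times x Zero) Zero,
       Eq (Times x One) x,
       Neg (Lt x x),
       imp (Conj (Lt x y) (Lt y w)) (Lt x w),
       Disj (Lt x y) (Disj (Eq x y) (Lt y x)),
       imp (Lt x y) (Lt (Plus x w) (Plus y w)),
       imp (Conj (Lt Zero w) (Lt x y)) (Lt (Times x w) (Times y w)),
       imp (Lt x y) (BEx 3 (Plus y One) (Eq (Plus x (Var 3)) y)),
       Lt Zero One,
       imp (Lt Zero x) (Disj (Eq One x) (Lt One x))]
      (Disj (Eq x Zero) (Lt Zero x)))"

lemma delta0_PAminus_matrix: "delta0 PAminus_matrix"
  unfolding PAminus_matrix_def Let_def foldr.simps o_def id_def by (intro delta0.intros) auto

lemma PAminus_of_matrix:
  assumes "\<And>s. assign N s \<Longrightarrow> sat N PAminus_matrix s"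
    and ne: "zero N \<in> carrier N"
  shows "PAminus N"
proof -
  have *: "sat N PAminus_matrix (x ## y ## w ## (\<lambda>_. w))"
    if "x \<in> carrier N" "y \<in> carrier N" "w \<in> carrier N" for x y w
    by (rule assms) (use that in \<open>auto simp: assign_def split: nat.split\<close>)
  note ** = *[unfolded PAminus_matrix_def Let_def foldr.simps o_def id_def, simplified]
  show ?thesis
  proof (unfold PAminus_def Let_def, intro conjI ballI impI)
    fix x y w assume C: "x \<in> carrier N" "y \<in> carrier N" "w \<in> carrier N"
    note X = **[OF C(1) C(2) C(3)]
    show "plus N (plus N x y) w = plus N x (plus N y w)" using X by blast
    show "times N (times N x y) w = times N x (times N y w)" using X by blast
    show "times N x (plus N y w) = plus N (times N x y) (times N x w)" using X by blast
    show "less N x w" if "less N x y \<and> less N y w" using X that by blast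
    show "less N (plus N x w) (plus N y w)" if "less N x y" using X that by blast
    show "less N (times N x w) (times N y w)" if "less N (zero N) w \<and> less N x y" using X that by blast
  next
    fix x y assume C: "x \<in> carrier N" "y \<in> carrier N"
    note X = **[OF C(1) C(2) C(1)]
    show "plus N x y = plus N y x" using X by blast
    show "times N x y = times N y x" using X by blast
    show "less N x y \<or> x = y \<or> less N y x" using X by blast
    show "\<exists>w\<in>carrier N. plus N x w = y" if "less N x y" using X that by blast
  next
    fix x assume C: "x \<in> carrier N"
    note X = **[OF C(1) C(1) C(1)]
    show "plus N x (zero N) = x" using X by blast
    show "times N x (zero N) = zero N" using X by blast
    show "times N x (one N) = x" using X by blast
    show "\<not> less N x x" using X by blast
    show "one N = x \<or> less N (one N) x" if "less N (zero N) x" using X that by blast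
    show "x = zero N \<or> less N (zero N) x" using X by blast
  next
    show "less N (zero N) (one N)" using **[OF ne ne ne] by blast
  qed
qed

lemma sat_PAminus_matrix:
  assumes "PAminus N" "wf_struc N" "assign N s"
  shows "sat N PAminus_matrix s"
proof -
  note P = PAminusD[OF assms(1)]
  have c: "s i \<in> carrier N" "zero N \<in> carrier N" "one N \<in> carrier N" for i
    using assms(2,3) unfolding assign_def wf_struc_def by auto
  have cl: "plus N x y \<in> carrier N" if "x \<in> carrier N" "y \<in> carrier N" for x y
    using assms(2) that unfolding wf_struc_def by auto
  \<comment> \<open>The difference of \<open>y\<close> and \<open>x\<close> is at most
    \<open>y\<close>, so it satisfies the bound in the matrix.\<close>
  have *: "\<exists>d\<in>carrier N. less N d (plus N y (one N)) \<and> plus N x d = y"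
    if x: "x \<in> carrier N" "y \<in> carrier N" "less N x y" for x y
  proof -
    obtain w where w: "w \<in> carrier N" "plus N x w = y" using P(14) x by blast
    have "plus N (zero N) w = w" using P(2,6) w(1) c(2) by metis
    then have "w = y \<or> less N w y" using P(12)[of "zero N" x w] P(17)[of x] w x c(2) by metis
    moreover have "less N y (plus N y (one N))"
      using P(12)[OF c(2,3) x(2) P(15)] P(2)[of _ y] P(6)[OF x(2)] c(2,3) x(2) by metis
    ultimately have "less N w (plus N y (one N))"
      using P(10)[OF w(1) x(2) cl[OF x(2) c(3)]] by blast
    then show ?thesis using w by blast
  qed
  have imps: "\<not> (less N (s 0) (s 1) \<and> less N (s 1) (s 2)) \<or> less N (s 0) (s 2)"
    "\<not> less N (s 0) (s 1) \<or> less N (plus N (s 0) (s 2)) (plus N (s 1) (s 2))"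
    "\<not> (less N (zero N) (s 2) \<and> less N (s 0) (s 1)) \<or> less N (times N (s 0) (s 2)) (times N (s 1) (s 2))"
    "\<not> less N (zero N) (s 0) \<or> one N = s 0 \<or> less N (one N) (s 0)"
    "\<not> less N (s 0) (s 1) \<or> (\<exists>d\<in>carrier N. less N d (plus N (s 1) (one N)) \<and>
       plus N ((s(3 := d)) 0) ((s(3 := d)) 3) = (s(3 := d)) 1)"
    using P(10)[OF c(1) c(1) c(1), of 0 1 2] P(12)[OF c(1) c(1) c(1), of 0 1 2]
      P(13)[OF c(1)[of 0] c(1)[of 1] c(1)[of 2]] P(16)[OF c(1), of 0] *[OF c(1) c(1), of 0 1] by auto
  show ?thesis
    unfolding PAminus_matrix_def Let_def foldr.simps o_def id_def sat.simps eval.simps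
    by (intro conjI) ((rule P(1) P(2) P(3) P(4) P(5) P(6) P(7) P(8) P(9) P(11) P(15) P(17); rule c)
        | rule imps)+
qed

lemma (in full_struc) wf_full: "wf_struc M"
  by (simp add: wf_struc_def full)

text \<open>The naming of the classes is left open. \<open>exists_classes\<close> later lets the
  class of a constant be the old element itself, so that the extension contains the given model
  literally.\<close>

locale generic_quotient = generic M \<theta> n a b L S for M :: "'a struc" and \<theta> n a b L S +
  fixes cl :: "('a \<Rightarrow> 'a) \<Rightarrow> 'b"
  assumes cl_eq: "\<And>f g. FN f \<Longrightarrow> FN g \<Longrightarrow> cl f = cl g \<longleftrightarrow> Ev (\<lambda>x. f x = g x)"
begin

definition rep :: "'b \<Rightarrow> 'a \<Rightarrow> 'a" where "rep y = (SOME f. FN f \<and> cl f = y)"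

definition N :: "'b struc" where
  "N = \<lparr>carrier = cl ` Collect FN, zero = cl (\<lambda>_. \<zero>), one = cl (\<lambda>_. \<one>),
    plus = (\<lambda>y z. cl (\<lambda>x. rep y x \<oplus> rep z x)), times = (\<lambda>y z. cl (\<lambda>x. rep y x \<otimes> rep z x)),
    less = (\<lambda>y z. Ev (\<lambda>x. rep y x \<prec> rep z x))\<rparr>"

lemma N_simps:
  "carrier N = cl ` Collect FN" "zero N = cl (\<lambda>_. \<zero>)" "one N = cl (\<lambda>_. \<one>)"
  by (simp_all add: N_def)

lemma rep: assumes "FN f" shows "FN (rep (cl f))" "Ev (\<lambda>x. rep (cl f) x = f x)"
proof -
  have *: "FN (rep (cl f)) \<and> cl (rep (cl f)) = cl f"
    unfolding rep_def using someI_ex[of "\<lambda>g. FN g \<and> cl g = cl f"] assms by blast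
  then show "FN (rep (cl f))" by blast
  show "Ev (\<lambda>x. rep (cl f) x = f x)" using * cl_eq assms by blast
qed

lemma N_plus: assumes "FN f" "FN g" shows "plus N (cl f) (cl g) = cl (\<lambda>x. f x \<oplus> g x)"
proof -
  have "Ev (\<lambda>x. rep (cl f) x \<oplus> rep (cl g) x = f x \<oplus> g x)"
    by (rule Ev_mono2[OF rep(2)[OF assms(1)] rep(2)[OF assms(2)]]) simp
  then show ?thesis unfolding N_def by (simp add: cl_eq FN_plus assms rep(1))
qed

lemma N_times: assumes "FN f" "FN g" shows "times N (cl f) (cl g) = cl (\<lambda>x. f x \<otimes> g x)"
proof -
  have "Ev (\<lambda>x. rep (cl f) x \<otimes> rep (cl g) x = f x \<otimes> g x)"
    by (rule Ev_mono2[OF rep(2)[OF assms(1)] rep(2)[OF assms(2)]]) simp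
  then show ?thesis unfolding N_def by (simp add: cl_eq FN_times assms rep(1))
qed

lemma N_less: assumes "FN f" "FN g" shows "less N (cl f) (cl g) \<longleftrightarrow> Ev (\<lambda>x. f x \<prec> g x)"
proof -
  have r: "Ev (\<lambda>x. rep (cl f) x = f x \<and> rep (cl g) x = g x)"
    unfolding Ev_conj using rep(2) assms by blast
  have "Ev (\<lambda>x. rep (cl f) x \<prec> rep (cl g) x) \<longleftrightarrow> Ev (\<lambda>x. f x \<prec> g x)"
  proof
    assume "Ev (\<lambda>x. rep (cl f) x \<prec> rep (cl g) x)"
    from Ev_mono2[OF this r] show "Ev (\<lambda>x. f x \<prec> g x)" by auto
  next
    assume "Ev (\<lambda>x. f x \<prec> g x)"
    from Ev_mono2[OF this r] show "Ev (\<lambda>x. rep (cl f) x \<prec> rep (cl g) x)" by auto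
  qed
  then show ?thesis by (simp add: N_def)
qed

lemma wf_N: "wf_struc N"
  unfolding wf_struc_def N_simps by (auto simp: N_plus N_times FN_plus FN_times)

lemma assign_N: assumes "assign N s" obtains F where "\<And>i. FN (F i)" "s = (\<lambda>i. cl (F i))"
proof -
  have "\<forall>i. \<exists>f. FN f \<and> s i = cl f" using assms unfolding assign_def N_simps by blast
  then obtain F where "\<forall>i. FN (F i) \<and> s i = cl (F i)" by metis
  then show ?thesis using that by blast
qed

lemma eval_N: "(\<And>i. FN (F i)) \<Longrightarrow> eval N (\<lambda>i. cl (F i)) t = cl (\<lambda>x. eval M (\<lambda>i. F i x) t)"
  by (induction t) (simp_all add: N_simps N_plus N_times FN_eval)

lemma cl_upd: "(\<lambda>i. cl (F i))(v := cl g) = (\<lambda>i. cl ((F(v := g)) i))"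
  and F_upd: "(\<lambda>i. (F(v := g)) i x) = (\<lambda>i. F i x)(v := g x)"
  by auto

definition los :: "fm \<Rightarrow> bool" where
  "los p \<longleftrightarrow> (\<forall>F. (\<forall>i. FN (F i)) \<longrightarrow>
     (sat N p (\<lambda>i. cl (F i)) \<longleftrightarrow> Ev (\<lambda>x. sat M p (\<lambda>i. F i x))))"

lemma losD: "los p \<Longrightarrow> (\<And>i. FN (F i)) \<Longrightarrow> sat N p (\<lambda>i. cl (F i)) \<longleftrightarrow> Ev (\<lambda>x. sat M p (\<lambda>i. F i x))"
  unfolding los_def by blast

lemma los_upd:
  assumes "los p" "\<And>i. FN (F i)" "FN g"
  shows "sat N p ((\<lambda>i. cl (F i))(v := cl g)) \<longleftrightarrow> Ev (\<lambda>x. sat M p ((\<lambda>i. F i x)(v := g x)))"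
  unfolding cl_upd F_upd[symmetric] by (rule losD[OF assms(1)]) (use assms in auto)

text \<open>A filter alone does not commute with negation; the extra hypothesis is supplied by the
  decision of coded truth sets.\<close>

lemma los_neg:
  assumes "los p" "\<And>F. (\<And>i. FN (F i)) \<Longrightarrow>
    Ev (\<lambda>x. sat M p (\<lambda>i. F i x)) \<or> Ev (\<lambda>x. \<not> sat M p (\<lambda>i. F i x))"
  shows "los (Neg p)"
  unfolding los_def
proof (intro allI impI)
  fix F :: "nat \<Rightarrow> 'a \<Rightarrow> 'a" assume F: "\<forall>i. FN (F i)"
  show "sat N (Neg p) (\<lambda>i. cl (F i)) \<longleftrightarrow> Ev (\<lambda>x. sat M (Neg p) (\<lambda>i. F i x))"
    using assms(2)[of F] losD[OF assms(1), of F] Ev_not[of "\<lambda>x. sat M p (\<lambda>i. F i x)"] F by auto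
qed

lemma los_delta0: "delta0 p \<Longrightarrow> los p"
proof (induction rule: delta0.induct)
  case (1 t u)
  show ?case unfolding los_def by (simp add: eval_N cl_eq FN_eval)
next
  case (2 t u)
  show ?case unfolding los_def by (simp add: eval_N N_less FN_eval)
next
  case (3 p)
  show ?case
    by (rule los_neg[OF 3(2)], rule Ev_sat_decide[of 0]) (use 3(1) sigma_fm_pi_fm.intros in auto)
next
  case (4 p q)
  then show ?case unfolding los_def by (simp add: Ev_conj)
next
  case (5 p q)
  show ?case unfolding los_def
  proof (intro allI impI)
    fix F :: "nat \<Rightarrow> 'a \<Rightarrow> 'a" assume F: "\<forall>i. FN (F i)"
    let ?P = "\<lambda>x. sat M p (\<lambda>i. F i x)" and ?Q = "\<lambda>x. sat M q (\<lambda>i. F i x)"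
    have dec: "Ev ?P \<or> Ev (\<lambda>x. \<not> ?P x)"
      by (rule Ev_sat_decide[of 0]) (use 5(1) F sigma_fm_pi_fm.intros in auto)
    have "Ev ?P \<or> Ev ?Q \<longleftrightarrow> Ev (\<lambda>x. ?P x \<or> ?Q x)"
    proof
      assume "Ev ?P \<or> Ev ?Q"
      then show "Ev (\<lambda>x. ?P x \<or> ?Q x)" using Ev_mono[of _ "\<lambda>x. ?P x \<or> ?Q x"] by blast
    next
      assume *: "Ev (\<lambda>x. ?P x \<or> ?Q x)"
      have "Ev ?Q" if "Ev (\<lambda>x. \<not> ?P x)" by (rule Ev_mono2[OF * that]) blast
      then show "Ev ?P \<or> Ev ?Q" using dec by blast
    qed
    then show "sat N (Disj p q) (\<lambda>i. cl (F i)) = Ev (\<lambda>x. sat M (Disj p q) (\<lambda>i. F i x))"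
      using losD[OF 5(3)] losD[OF 5(4)] F by simp
  qed
next
  case (6 v t p)
  show ?case unfolding los_def
  proof (intro allI impI)
    fix F :: "nat \<Rightarrow> 'a \<Rightarrow> 'a" assume F: "\<forall>i. FN (F i)"
    let ?h = "\<lambda>x. eval M (\<lambda>i. F i x) t"
    have h: "FN ?h" "eval N (\<lambda>i. cl (F i)) t = cl ?h" using F by (simp_all add: FN_eval eval_N)
    show "sat N (BEx v t p) (\<lambda>i. cl (F i)) = Ev (\<lambda>x. sat M (BEx v t p) (\<lambda>i. F i x))" (is "?l = ?r")
    proof
      assume ?l
      then obtain g where g: "FN g" "less N (cl g) (cl ?h)" "sat N p ((\<lambda>i. cl (F i))(v := cl g))"
        by (auto simp: h N_simps)
      have "Ev (\<lambda>x. g x \<prec> ?h x)" using g N_less h by blast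
      moreover have "Ev (\<lambda>x. sat M p ((\<lambda>i. F i x)(v := g x)))" using g(1,3) los_upd[OF 6(3)] F by blast
      ultimately show ?r by (rule Ev_mono2) (auto simp: full)
    next
      assume ?r
      obtain g where g: "FN g" "\<And>x y. x \<prec> L \<Longrightarrow> y \<prec> ?h x \<Longrightarrow> sat M p ((\<lambda>i. F i x)(v := y)) \<Longrightarrow>
          g x \<prec> ?h x \<and> sat M p ((\<lambda>i. F i x)(v := g x))"
        using witness_bounded[OF 6(2) _ h(1), of F v] F by blast
      from \<open>?r\<close> have "Ev (\<lambda>x. g x \<prec> ?h x \<and> sat M p ((\<lambda>i. F i x)(v := g x)))"
        by (rule Ev_mono) (use g(2) in auto)
      then have "less N (cl g) (cl ?h)" "sat N p ((\<lambda>i. cl (F i))(v := cl g))"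
        unfolding Ev_conj using N_less[OF g(1) h(1)] los_upd[OF 6(3) _ g(1), of F v] F by blast+
      then show ?l using g(1) by (auto simp: h N_simps)
    qed
  qed
next
  case (7 v t p)
  show ?case unfolding los_def
  proof (intro allI impI)
    fix F :: "nat \<Rightarrow> 'a \<Rightarrow> 'a" assume F: "\<forall>i. FN (F i)"
    let ?h = "\<lambda>x. eval M (\<lambda>i. F i x) t"
    have h: "FN ?h" "eval N (\<lambda>i. cl (F i)) t = cl ?h" using F by (simp_all add: FN_eval eval_N)
    show "sat N (BAll v t p) (\<lambda>i. cl (F i)) = Ev (\<lambda>x. sat M (BAll v t p) (\<lambda>i. F i x))" (is "?l = ?r")
    proof
      assume ?l
      show ?r
      proof (rule ccontr)
        assume "\<not> ?r"
        have "delta0 (BAll v t p)" using 7(1,2) by (rule delta0.intros)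
        \<comment> \<open>The truth set is coded, so if it is not in the filter its complement is;
          bounded counterexamples can then be chosen by a coded function.\<close>
        then have "Ev (\<lambda>x. \<not> sat M (BAll v t p) (\<lambda>i. F i x))"
          using Ev_sat_decide[of 0 "BAll v t p" F] F sigma_fm_pi_fm.intros(1) \<open>\<not> ?r\<close> by blast
        moreover have "delta0 (Neg p)" using 7(2) by (rule delta0.intros)
        then obtain g where g: "FN g" "\<And>x y. x \<prec> L \<Longrightarrow> y \<prec> ?h x \<Longrightarrow> sat M (Neg p) ((\<lambda>i. F i x)(v := y)) \<Longrightarrow>
            g x \<prec> ?h x \<and> sat M (Neg p) ((\<lambda>i. F i x)(v := g x))"
          using witness_bounded[OF _ _ h(1), of "Neg p" F v] F by blast
        ultimately have "Ev (\<lambda>x. g x \<prec> ?h x \<and> \<not> sat M p ((\<lambda>i. F i x)(v := g x)))"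
          by (elim Ev_mono) auto
        then have "less N (cl g) (cl ?h)" "\<not> sat N p ((\<lambda>i. cl (F i))(v := cl g))"
          unfolding Ev_conj using N_less[OF g(1) h(1)] los_upd[OF 7(3) _ g(1), of F v] F Ev_not by blast+
        then show False using \<open>?l\<close> g(1) by (auto simp: h N_simps)
      qed
    next
      assume r: ?r
      have "sat N p ((\<lambda>i. cl (F i))(v := cl g))" if g: "FN g" "less N (cl g) (cl ?h)" for g
      proof -
        have "Ev (\<lambda>x. g x \<prec> ?h x)" using g N_less h by blast
        from Ev_mono2[OF r this] have "Ev (\<lambda>x. sat M p ((\<lambda>i. F i x)(v := g x)))" by (auto simp: full)
        then show ?thesis using los_upd[OF 7(3) _ g(1), of F v] F by blast
      qed
      then show ?l by (auto simp: h N_simps)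
    qed
  qed
qed

text \<open>Existential witnesses come from \<open>witness_Sigma\<close>. For a universal
  quantifier, failure is first decided by \<open>Ev_sat_decide\<close> and then turned into a coded
  function of counterexamples.\<close>

lemma los_sigma_pi:
  "sigma_fm m p \<Longrightarrow> m \<le> n \<longrightarrow> los p" "pi_fm m p \<Longrightarrow> m \<le> n \<longrightarrow> los p"
proof (induction rule: sigma_fm_pi_fm.inducts)
  case (4 m p v)
  show ?case
  proof (intro impI, unfold los_def, intro allI impI)
    fix F :: "nat \<Rightarrow> 'a \<Rightarrow> 'a" assume m: "Suc m \<le> n" and F: "\<forall>i. FN (F i)"
    have lp: "los p" using 4 m by blast
    show "sat N (Ex v p) (\<lambda>i. cl (F i)) = Ev (\<lambda>x. sat M (Ex v p) (\<lambda>i. F i x))" (is "?l = ?r")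
    proof
      assume ?l
      then obtain g where g: "FN g" "sat N p ((\<lambda>i. cl (F i))(v := cl g))" by (auto simp: N_simps)
      then have "Ev (\<lambda>x. sat M p ((\<lambda>i. F i x)(v := g x)))" using los_upd[OF lp] F by blast
      then show ?r by (rule Ev_mono) (auto simp: full)
    next
      assume ?r
      obtain g where g: "FN g" "\<And>x y. x \<prec> L \<Longrightarrow> sat M p ((\<lambda>i. F i x)(v := y)) \<Longrightarrow>
          sat M p ((\<lambda>i. F i x)(v := g x))"
        using witness_Sigma[OF 4(1) m, of F v] F by blast
      from \<open>?r\<close> have "Ev (\<lambda>x. sat M p ((\<lambda>i. F i x)(v := g x)))"
        by (rule Ev_mono) (use g(2) in auto)
      then have "sat N p ((\<lambda>i. cl (F i))(v := cl g))" using los_upd[OF lp _ g(1), of F v] F by blast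
      then show ?l using g(1) by (auto simp: N_simps)
    qed
  qed
next
  case (6 m p v)
  show ?case
  proof (intro impI, unfold los_def, intro allI impI)
    fix F :: "nat \<Rightarrow> 'a \<Rightarrow> 'a" assume m: "Suc m \<le> n" and F: "\<forall>i. FN (F i)"
    have lp: "los p" using 6 m by blast
    obtain p' where p': "sigma_fm (Suc m) p'" "\<And>s. sat M p' s \<longleftrightarrow> \<not> sat M p s"
      using neg_sigma_pi(2)[OF 6(1)] by blast
    show "sat N (All v p) (\<lambda>i. cl (F i)) = Ev (\<lambda>x. sat M (All v p) (\<lambda>i. F i x))" (is "?l = ?r")
    proof
      assume ?l
      show ?r
      proof (rule ccontr)
        assume "\<not> ?r"
        have "pi_fm (Suc m) (All v p)" using 6(1) by (rule sigma_fm_pi_fm.intros)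
        then have "Ev (\<lambda>x. \<not> sat M (All v p) (\<lambda>i. F i x))"
          using Ev_sat_decide[of "Suc m" "All v p" F] F m \<open>\<not> ?r\<close> by blast
        moreover obtain g where g: "FN g" "\<And>x y. x \<prec> L \<Longrightarrow> \<not> sat M p ((\<lambda>i. F i x)(v := y)) \<Longrightarrow>
            \<not> sat M p ((\<lambda>i. F i x)(v := g x))"
          using witness_Sigma[OF p'(1) m, of F v] F unfolding p'(2) by blast
        ultimately have "Ev (\<lambda>x. \<not> sat M p ((\<lambda>i. F i x)(v := g x)))"
          by (elim Ev_mono) auto
        then have "\<not> sat N p ((\<lambda>i. cl (F i))(v := cl g))"
          using los_upd[OF lp _ g(1), of F v] F Ev_not by blast
        then show False using \<open>?l\<close> g(1) by (auto simp: N_simps)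
      qed
    next
      assume r: ?r
      have "sat N p ((\<lambda>i. cl (F i))(v := cl g))" if g: "FN g" for g
      proof -
        have "Ev (\<lambda>x. sat M p ((\<lambda>i. F i x)(v := g x)))" by (rule Ev_mono[OF r]) (auto simp: full)
        then show ?thesis using los_upd[OF lp _ g(1), of F v] F by blast
      qed
      then show ?l by (auto simp: N_simps)
    qed
  qed
qed (use los_delta0 in auto)

lemma PAminus_N: "PAminus N"
proof (rule PAminus_of_matrix)
  fix s assume "assign N s"
  then obtain F where F: "\<And>i. FN (F i)" "s = (\<lambda>i. cl (F i))" using assign_N by blast
  show "sat N PAminus_matrix s" unfolding F(2)
    by (subst losD[OF los_delta0[OF delta0_PAminus_matrix]]) (simp_all add: F(1) sat_PAminus_matrix PAminus wf_full assign_def full)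
qed (use wf_N in \<open>simp add: wf_struc_def\<close>)

text \<open>If induction fails at the class of \<open>f\<close>, then for almost all
  \<open>x\<close> the property holds at zero and fails at \<open>f x\<close>. In the ground model
  there is a jump between the two, and a coded choice \<open>h\<close> of jumps gives a class that
  violates the induction step.\<close>

lemma ISigma_N: "ISigma n N"
  unfolding ISigma_def
proof (intro allI impI ballI, rule ccontr)
  fix p v s y
  assume p: "sigma_fm n p" and s: "assign N s" and z: "sat N p (s(v := zero N))"
    and st: "\<forall>y\<in>carrier N. sat N p (s(v := y)) \<longrightarrow> sat N p (s(v := plus N y (one N)))"
    and y: "y \<in> carrier N" "\<not> sat N p (s(v := y))"
  obtain F where F: "\<And>i. FN (F i)" "s = (\<lambda>i. cl (F i))" using s assign_N by blast
  obtain f where f: "FN f" "y = cl f" using y(1) unfolding N_simps by blast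
  have lp: "los p" using los_sigma_pi(1) p by blast
  have U: "sat N p ((\<lambda>i. cl (F i))(v := cl g)) \<longleftrightarrow> Ev (\<lambda>x. sat M p ((\<lambda>i. F i x)(v := g x)))"
    if "FN g" for g v by (rule los_upd[OF lp _ that]) (rule F(1))
  obtain R where R: "bS n (\<lambda>s. R (s 0) (s (Suc 0)))"
    "\<And>x y. x \<prec> L \<Longrightarrow> R x y = sat M p ((\<lambda>i. F i x)(v := y))"
    using sat_rel[OF p, of F v] F(1) by blast
  have "Ev (\<lambda>x. R x \<zero>)" using z U[of "\<lambda>_. \<zero>" v] unfolding F(2) N_simps
    by (auto intro: Ev_mono simp: R(2))
  have "\<not> Ev (\<lambda>x. sat M p ((\<lambda>i. F i x)(v := f x)))" using y(2) U[OF f(1), of v] unfolding F(2) f(2) by blast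
  then have "Ev (\<lambda>x. \<not> sat M p ((\<lambda>i. F i x)(v := f x)))"
    using Ev_sat_decide[of n p "F(v := f)", unfolded F_upd] p F(1) f(1) by simp
  then have "Ev (\<lambda>x. \<not> R x (f x))" by (rule Ev_mono) (simp add: R(2))
  obtain t where "\<And>x y. E (pr x y) t \<longleftrightarrow> x \<prec> L \<and> f x = y" and t: "\<And>x. x \<prec> L \<Longrightarrow> f x \<prec> t"
    using FN_code[OF f(1)] by blast
  \<comment> \<open>Being a jump combines a Sigma_n and a Pi_n condition. Coding \<open>R\<close> on
    the relevant rectangle first makes it Delta_0. The bound \<open>t \<oplus> \<one>\<close> leaves
    room for the successor of a jump.\<close>
  obtain g where g: "\<And>x y. E (pr x y) g \<longleftrightarrow> x \<prec> L \<and> y \<prec> t \<oplus> \<one> \<and> R x y"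
    using rel_comprehension_Sigma[OF In R(1), of L "t \<oplus> \<one>"] by blast
  have "bD (\<lambda>s. E (pr (s 0) (s (Suc 0))) g \<and> \<not> E (pr (s 0) (s (Suc 0) \<oplus> \<one>)) g)"
    by (intro bD_E bD_intros)
  from rel_comprehension[OF this, of L t] obtain d where
    d: "\<And>x y. E (pr x y) d \<longleftrightarrow> x \<prec> L \<and> y \<prec> t \<and> E (pr x y) g \<and> \<not> E (pr x (y \<oplus> \<one>)) g" by blast
  have ex: "\<exists>y. E (pr x y) d" if x: "x \<prec> L" "R x \<zero>" "\<not> R x (f x)" for x
  proof -
    \<comment> \<open>The conjunct \<open>s 0 \<preceq> f x\<close> forces the jump to occur before
      \<open>f x\<close>, hence below \<open>t\<close>.\<close>
    have "bS 0 (\<lambda>s. E (pr x (s 0)) g \<and> s 0 \<preceq> f x)" unfolding bS.simps by (intro bD_E bD_intros)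
    moreover have "E (pr x \<zero>) g \<and> \<zero> \<preceq> f x" unfolding g using x by (simp add: lt_Suc_iff)
    moreover have "\<not> (E (pr x (f x)) g \<and> f x \<preceq> f x)" unfolding g using x by blast
    ultimately obtain y where y: "E (pr x y) g \<and> y \<preceq> f x" "\<not> (E (pr x (y \<oplus> \<one>)) g \<and> y \<oplus> \<one> \<preceq> f x)"
      using bS_last[OF ISigma0, of "\<lambda>y. E (pr x y) g \<and> y \<preceq> f x" "f x"] by blast
    have "y \<noteq> f x" using y(1) x(3) unfolding g by blast
    then have "y \<prec> f x" using y(1) unfolding leq_def by blast
    then have "\<not> E (pr x (y \<oplus> \<one>)) g" using y(2) Suc_le_iff by blast
    moreover have "y \<prec> t" using \<open>y \<prec> f x\<close> t[OF x(1)] by order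
    ultimately show ?thesis using d x(1) y(1) by blast
  qed
  obtain h where h: "FN h" "\<And>x. x \<prec> L \<Longrightarrow> \<exists>y. E (pr x y) d \<Longrightarrow> E (pr x (h x)) d"
    using FN_choose_code[of d] by blast
  have "Ev (\<lambda>x. R x (h x) \<and> \<not> R x (h x \<oplus> \<one>))"
  proof (rule Ev_mono2[OF \<open>Ev (\<lambda>x. R x \<zero>)\<close> \<open>Ev (\<lambda>x. \<not> R x (f x))\<close>])
    fix x assume x: "x \<prec> L" "R x \<zero>" "\<not> R x (f x)"
    then have "E (pr x (h x)) d" using h ex by blast
    then have "h x \<prec> t" "E (pr x (h x)) g" "\<not> E (pr x (h x \<oplus> \<one>)) g" unfolding d by blast+
    moreover have "h x \<oplus> \<one> \<prec> t \<oplus> \<one>" using calculation(1) by simp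
    ultimately show "R x (h x) \<and> \<not> R x (h x \<oplus> \<one>)" unfolding g using x(1) by blast
  qed
  then have 1: "Ev (\<lambda>x. R x (h x))" and 2: "Ev (\<lambda>x. \<not> R x (h x \<oplus> \<one>))" unfolding Ev_conj by blast+
  have "sat N p (s(v := cl h))" unfolding F(2) U[OF h(1)] by (rule Ev_mono[OF 1]) (simp add: R(2))
  then have "sat N p (s(v := plus N (cl h) (one N)))" using st h(1) unfolding N_simps by blast
  then have "Ev (\<lambda>x. sat M p ((\<lambda>i. F i x)(v := h x \<oplus> \<one>)))"
    unfolding F(2) N_simps N_plus[OF h(1) FN_const] U[OF FN_plus[OF h(1) FN_const]] .
  then have "Ev (\<lambda>x. R x (h x \<oplus> \<one>))" by (rule Ev_mono) (simp add: R(2))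
  then show False using 2 Ev_not by blast
qed

section \<open>The diagonal embedding\<close>

definition emb :: "'a \<Rightarrow> 'b" where "emb d = cl (\<lambda>_. d)"

lemma emb_hom:
  "emb d \<in> carrier N" "emb d = emb e \<longleftrightarrow> d = e" "zero N = emb \<zero>" "one N = emb \<one>"
  "plus N (emb d) (emb e) = emb (d \<oplus> e)" "times N (emb d) (emb e) = emb (d \<otimes> e)"
  "less N (emb d) (emb e) \<longleftrightarrow> d \<prec> e"
  unfolding emb_def by (simp_all add: N_simps cl_eq N_plus N_times N_less)

text \<open>The half of Los's theorem that survives at level n+1. The outer witnesses need not be
  chosen, as truth in \<open>N\<close> provides them as coded functions; after their substitution a
  Pi_n formula remains, whose truth set is coded. The set of all indices satisfying \<open>p\<close>
  is merely Sigma_{n+1}, so a coded subset of it is what one gets.\<close>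

lemma sigma_Suc_N:
  assumes "sigma_fm m p" "m = Suc n" "\<And>i. FN (F i)" "sat N p (\<lambda>i. cl (F i))"
  shows "\<exists>A. coded A \<and> A \<subseteq> {x. x \<prec> L} \<and> Ev (\<lambda>x. x \<in> A) \<and> (\<forall>x\<in>A. sat M p (\<lambda>i. F i x))"
  using assms
proof (induction m p arbitrary: F rule: sigma_fm_pi_fm.inducts(1)[where ?P2.0 = "\<lambda>_ _. True"])
  case (3 m p)
  then have p: "pi_fm n p" by simp
  obtain p' where p': "sigma_fm n p'" "\<And>s. sat M p' s \<longleftrightarrow> \<not> sat M p s"
    using neg_sigma_pi(2)[OF p] by blast
  have c: "coded {x. x \<prec> L \<and> sat M p' (\<lambda>i. F i x)}"
    by (rule coded_sat[OF p'(1)]) (use 3 in auto)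
  have "coded {x. x \<prec> L \<and> x \<notin> {x. x \<prec> L \<and> sat M p' (\<lambda>i. F i x)}}"
    by (intro codedI bD.neg bD_mem c tmf.var)
  moreover have "{x. x \<prec> L \<and> x \<notin> {x. x \<prec> L \<and> sat M p' (\<lambda>i. F i x)}} = {x. x \<prec> L \<and> sat M p (\<lambda>i. F i x)}"
    unfolding p'(2) by blast
  moreover have "Ev (\<lambda>x. sat M p (\<lambda>i. F i x))"
    using losD[of p F] los_sigma_pi(2)[OF p] 3 by blast
  then have "Ev (\<lambda>x. x \<in> {x. x \<prec> L \<and> sat M p (\<lambda>i. F i x)})" by (rule Ev_mono) simp
  ultimately show ?case by (intro exI[of _ "{x. x \<prec> L \<and> sat M p (\<lambda>i. F i x)}"]) auto
next
  case (4 m p v)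
  then obtain g where g: "FN g" "sat N p (\<lambda>i. cl ((F(v := g)) i))" by (auto simp: N_simps cl_upd)
  have "\<exists>A. coded A \<and> A \<subseteq> {x. x \<prec> L} \<and> Ev (\<lambda>x. x \<in> A) \<and> (\<forall>x\<in>A. sat M p (\<lambda>i. (F(v := g)) i x))"
    using "4.IH"[of "F(v := g)"] "4.prems" g by simp
  then show ?case unfolding F_upd by (auto simp: full)
qed simp_all

lemma sigma_Suc_up:
  assumes "sigma_fm m p" "m = Suc n" "sat M p s"
  shows "sat N p (\<lambda>i. emb (s i))"
  using assms
proof (induction m p arbitrary: s rule: sigma_fm_pi_fm.inducts(1)[where ?P2.0 = "\<lambda>_ _. True"])
  case (3 m p)
  then have "los p" using los_sigma_pi(2)[of n p] by simp
  from losD[OF this, of "\<lambda>i _. s i"] 3 show ?case by (simp add: emb_def)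
next
  case (4 m p v)
  then obtain d where "sat M p (s(v := d))" by auto
  then have "sat N p (\<lambda>i. emb ((s(v := d)) i))" using 4 by blast
  moreover have "(\<lambda>i. emb ((s(v := d)) i)) = (\<lambda>i. emb (s i))(v := emb d)" by auto
  ultimately show ?case using emb_hom(1) by auto
qed simp_all

lemma sigma_elem: "sigma_fm (Suc n) p \<Longrightarrow> sat N p (\<lambda>i. emb (s i)) \<longleftrightarrow> sat M p s"
proof
  assume p: "sigma_fm (Suc n) p" "sat N p (\<lambda>i. emb (s i))"
  have "\<exists>A. coded A \<and> A \<subseteq> {x. x \<prec> L} \<and> Ev (\<lambda>x. x \<in> A) \<and> (\<forall>x\<in>A. sat M p (\<lambda>i. (\<lambda>i _. s i) i x))"
    by (rule sigma_Suc_N[OF p(1) refl]) (use p(2) in \<open>auto simp: emb_def\<close>)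
  then show "sat M p s" using Ev_ex by blast
qed (rule sigma_Suc_up, simp_all)

lemma cofinal_N: assumes "y \<in> carrier N" shows "\<exists>d. less N y (emb d)"
proof -
  obtain f where f: "FN f" "y = cl f" using assms unfolding N_simps by blast
  obtain t where "\<And>x y. E (pr x y) t \<longleftrightarrow> x \<prec> L \<and> f x = y" "\<And>x. x \<prec> L \<Longrightarrow> f x \<prec> t"
    using FN_code[OF f(1)] by blast
  then have "Ev (\<lambda>x. f x \<prec> t)" by (intro Ev_all)
  then show ?thesis unfolding f(2) emb_def using N_less[OF f(1) FN_const] by blast
qed

lemma initial_N: assumes "y \<in> carrier N" "less N y (emb a)" shows "\<exists>d. y = emb d"
proof -
  obtain f where f: "FN f" "y = cl f" using assms unfolding N_simps by blast
  have lt: "Ev (\<lambda>x. f x \<prec> a)" using assms(2) N_less[OF f(1) FN_const] unfolding f(2) emb_def by blast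
  obtain t where t: "\<And>x y. E (pr x y) t \<longleftrightarrow> x \<prec> L \<and> f x = y" and "\<And>x. x \<prec> L \<Longrightarrow> f x \<prec> t"
    using FN_code[OF f(1)] by blast
  \<comment> \<open>Values not below \<open>a\<close> are replaced by zero, so that
    \<open>S_const\<close> applies; almost everywhere nothing changes.\<close>
  let ?R = "\<lambda>x y. E (pr x y) t \<or> y = \<zero> \<and> \<not> (\<exists>z. z \<prec> a \<and> E (pr x z) t)"
  have "bD (\<lambda>s. ?R (s 0) (s (Suc 0)))" by (intro bD_E bD_intros)
  from rel_comprehension[OF this, of L a] obtain u where
    u: "\<And>x y. E (pr x y) u \<longleftrightarrow> x \<prec> L \<and> y \<prec> a \<and> ?R x y" by blast
  have "\<zero> \<prec> a" using a ar.zero_less_one by order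
  then have "\<exists>i. i \<prec> a \<and> E (pr x i) u" if "x \<prec> L" for x unfolding u using that by blast
  from S_const[OF this] obtain k i where "\<forall>x\<in>S k. E (pr x i) u" by blast
  then have "Ev (\<lambda>x. E (pr x i) u)" unfolding Ev_def by blast
  from this lt have "Ev (\<lambda>x. f x = i)" by (rule Ev_mono2) (auto simp: u t)
  then show ?thesis unfolding f(2) emb_def using cl_eq[OF f(1) FN_const] by blast
qed

text \<open>The class of the identity is the element outside the domain of every \<open>\<Sigma>\<^sub>n\<^sub>+\<^sub>1\<close> injection.\<close>
lemma kill_N:
  "\<exists>d\<in>carrier N. less N d (emb L) \<and> (\<forall>p s. sigma_fm (Suc n) p \<longrightarrow>
     inj_graph M L b (\<lambda>u v. sat M p (s(0 := u, 1 := v))) \<longrightarrow>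
     (\<forall>v\<in>carrier N. \<not> sat N p ((\<lambda>i. emb (s i))(0 := d, 1 := v))))"
proof (intro bexI conjI allI impI ballI notI)
  show "cl (\<lambda>x. x) \<in> carrier N" using FN_id unfolding N_simps by blast
  show "less N (cl (\<lambda>x. x)) (emb L)" unfolding emb_def N_less[OF FN_id FN_const] by (rule Ev_all)
next
  fix p s v
  assume p: "sigma_fm (Suc n) p" and inj: "inj_graph M L b (\<lambda>u v. sat M p (s(0 := u, 1 := v)))"
    and v: "v \<in> carrier N" and sat: "sat N p ((\<lambda>i. emb (s i))(0 := cl (\<lambda>x. x), 1 := v))"
  obtain f where f: "FN f" "v = cl f" using v unfolding N_simps by blast
  let ?F = "((\<lambda>i _. s i)(0 := (\<lambda>x. x), 1 := f)) :: nat \<Rightarrow> 'a \<Rightarrow> 'a"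
  have e: "(\<lambda>i. emb (s i))(0 := cl (\<lambda>x. x), 1 := v) = (\<lambda>i. cl (?F i))"
    unfolding f(2) emb_def by auto
  have "\<exists>A. coded A \<and> A \<subseteq> {x. x \<prec> L} \<and> Ev (\<lambda>x. x \<in> A) \<and> (\<forall>x\<in>A. sat M p (\<lambda>i. ?F i x))"
    by (rule sigma_Suc_N[OF p refl]) (use sat e f(1) FN_id in auto)
  then obtain A where A: "coded A" "A \<subseteq> {x. x \<prec> L}" "Ev (\<lambda>x. x \<in> A)" "\<forall>x\<in>A. sat M p (\<lambda>i. ?F i x)"
    by blast
  have "(\<lambda>i. ?F i x) = s(0 := x, 1 := f x)" for x by auto
  then have graph: "sat M p (s(0 := x, 1 := f x))" if "x \<in> A" for x using A(4) that by metis
  obtain t where t: "\<And>x y. E (pr x y) t \<longleftrightarrow> x \<prec> L \<and> f x = y" and "\<And>x. x \<prec> L \<Longrightarrow> f x \<prec> t"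
    using FN_code[OF f(1)] by blast
  \<comment> \<open>The injection defined by \<open>p\<close> need not be coded, but on
    \<open>A\<close> it agrees with the coded \<open>f\<close>. So \<open>A\<close> is one of the
    avoided sets, contrary to its being in the filter.\<close>
  have "small A b"
  proof (rule smallI[of "\<lambda>x y. E (pr x y) t" _ L])
    show "bD (\<lambda>s. E (pr (s 0) (s (Suc 0))) t)" by (intro bD_E tm_intros)
    show "\<forall>x\<in>A. x \<prec> L" using A(2) by blast
    show "\<exists>y. y \<prec> b \<and> E (pr x y) t" if "x \<in> A" for x
      using graph[OF that] inj A(2) that unfolding inj_graph_def t by blast
    show "x = x'" if "x \<in> A" "x' \<in> A" "y \<prec> b" "E (pr x y) t" "E (pr x' y) t" for x x' y
    proof -
      have "f x = f x'" using that(4,5) t by simp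
      then show ?thesis using graph[OF that(1)] graph[OF that(2)] inj unfolding inj_graph_def by metis
    qed
  qed
  from S_avoid[OF A(1) this] have "Ev (\<lambda>x. x \<notin> A)" unfolding Ev_def by blast
  then show False using A(3) Ev_not by blast
qed

lemma holds_N:
  assumes "delta0 p" "FN f" "FN g"
  shows "holds N p [cl f, cl g] \<longleftrightarrow> Ev (\<lambda>x. holds M p [f x, g x])"
proof -
  let ?F = "\<lambda>i. if i < length [f, g] then [f, g] ! i else (\<lambda>_. \<zero>)"
  have "FN (?F i)" for i using assms by (auto simp: less_Suc_eq)
  from losD[OF los_delta0[OF assms(1)], of ?F, OF this]
  have "sat N p (\<lambda>i. cl (?F i)) \<longleftrightarrow> Ev (\<lambda>x. sat M p (\<lambda>i. ?F i x))" .
  moreover have "(\<lambda>i. cl (?F i)) = (\<lambda>i. if i < length [cl f, cl g] then [cl f, cl g] ! i else zero N)"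
    by (auto simp: less_Suc_eq N_simps)
  moreover have "(\<lambda>i. ?F i x) = (\<lambda>i. if i < length [f x, g x] then [f x, g x] ! i else \<zero>)" for x
    by (auto simp: less_Suc_eq)
  ultimately show ?thesis unfolding holds_def by simp
qed

lemma FN_pw: assumes "FN f" shows "FN (\<lambda>x. pw (f x))"
proof -
  obtain t where t: "\<And>x y. E (pr x y) t \<longleftrightarrow> x \<prec> L \<and> f x = y" "\<And>x. x \<prec> L \<Longrightarrow> f x \<prec> t"
    using FN_code[OF assms] by blast
  show ?thesis
  proof (rule FN_I[where B = "pw t \<oplus> \<one>"])
    show "bD (\<lambda>s. \<exists>v. v \<prec> t \<and> E (pr (s 0) v) t \<and> pw v = s (Suc 0))"
      by (intro bD_E bD_pw bD_intros)
    show "pw (f x) \<prec> pw t \<oplus> \<one>" if "x \<prec> L" for x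
      unfolding lt_Suc_iff using t(2)[OF that] by (intro pw_mono) simp
  qed (use t in auto)
qed

text \<open>Totality is not a Delta_0 statement and does not follow from Los's theorem for
  \<open>\<theta>\<close>; it is witnessed by composing coded functions with \<open>pw\<close>. The
  other clauses are checked pointwise.\<close>

lemma pow2_N: "pow2_graph N \<theta>"
proof -
  have th: "delta0 \<theta>" "fv \<theta> \<subseteq> {0, 1}" using pow2 unfolding pow2_graph_def by blast+
  have H: "holds N \<theta> [cl f, cl g] \<longleftrightarrow> Ev (\<lambda>x. pw (f x) = g x)" if "FN f" "FN g" for f g
    using holds_N[OF th(1) that] unfolding pw_eq .
  show ?thesis
    unfolding pow2_graph_def N_simps
  proof (intro conjI th ballI impI)
    fix y assume "y \<in> cl ` Collect FN"
    then obtain f where "FN f" "y = cl f" by blast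
    then show "\<exists>z\<in>cl ` Collect FN. holds N \<theta> [y, z]"
      using H[OF _ FN_pw, of f f] FN_pw[of f] by (auto intro: Ev_all)
  next
    fix y z z' assume "y \<in> cl ` Collect FN" "z \<in> cl ` Collect FN" "z' \<in> cl ` Collect FN"
      and *: "holds N \<theta> [y, z] \<and> holds N \<theta> [y, z']"
    then obtain f g g' where f: "FN f" "y = cl f" "FN g" "z = cl g" "FN g'" "z' = cl g'" by blast
    have "Ev (\<lambda>x. pw (f x) = g x)" "Ev (\<lambda>x. pw (f x) = g' x)" using * H f by auto
    then have "Ev (\<lambda>x. g x = g' x)" by (rule Ev_mono2) simp
    then show "z = z'" using cl_eq f by blast
  next
    show "holds N \<theta> [cl (\<lambda>_. \<zero>), cl (\<lambda>_. \<one>)]" using H[OF FN_const FN_const] by simp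
  next
    fix y z assume "y \<in> cl ` Collect FN" "z \<in> cl ` Collect FN" and *: "holds N \<theta> [y, z]"
    then obtain f g where f: "FN f" "y = cl f" "FN g" "z = cl g" by blast
    have "Ev (\<lambda>x. pw (f x) = g x)" using * H f by auto
    then have "Ev (\<lambda>x. pw (f x \<oplus> \<one>) = g x \<oplus> g x)" by (rule Ev_mono) (simp add: pw_Suc)
    then show "holds N \<theta> [plus N y (cl (\<lambda>_. \<one>)), plus N z z]"
      unfolding f using f(1,3) by (simp add: N_plus H FN_plus)
  qed
qed

end

section \<open>One extension step\<close>

text \<open>Classes of constants keep their old names \<open>j d\<close>; all others are named
  injectively in \<open>Z\<close>. There are enough names: although functions differing outside
  \<open>L\<close> are uncountably many, a class is determined by the code of any of its
  members.\<close>

lemma (in generic) exists_classes: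
  fixes j :: "'a \<Rightarrow> 'b"
  assumes "countable (UNIV :: 'a set)" "inj j" "infinite Z" "Z \<inter> range j = {}"
  shows "\<exists>cl. (\<forall>f g. FN f \<longrightarrow> FN g \<longrightarrow> (cl f = cl g \<longleftrightarrow> Ev (\<lambda>x. f x = g x))) \<and>
    (\<forall>d. cl (\<lambda>_. d) = j d) \<and> cl ` Collect FN \<subseteq> range j \<union> Z"
proof -
  define ec where "ec f = {g. FN g \<and> Ev (\<lambda>x. f x = g x)}" for f
  have ec_eq: "ec f = ec g \<longleftrightarrow> Ev (\<lambda>x. f x = g x)" if "FN f" "FN g" for f g
  proof
    assume "ec f = ec g"
    moreover have "g \<in> ec g" using that by (simp add: ec_def)
    ultimately have "g \<in> ec f" by simp
    then show "Ev (\<lambda>x. f x = g x)" by (simp add: ec_def)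
  next
    assume e: "Ev (\<lambda>x. f x = g x)"
    have "Ev (\<lambda>x. f x = h x) \<longleftrightarrow> Ev (\<lambda>x. g x = h x)" for h
      using Ev_mono2[OF e, of "\<lambda>x. f x = h x" "\<lambda>x. g x = h x"]
        Ev_mono2[OF e, of "\<lambda>x. g x = h x" "\<lambda>x. f x = h x"] by auto
    then show "ec f = ec g" by (simp add: ec_def)
  qed
  have "ec ` Collect FN \<subseteq> range (\<lambda>t. {g. FN g \<and> Ev (\<lambda>x. E (pr x (g x)) t)})"
  proof
    fix q assume "q \<in> ec ` Collect FN"
    then obtain f where f: "FN f" "q = ec f" by blast
    obtain t where t: "\<And>x y. E (pr x y) t \<longleftrightarrow> x \<prec> L \<and> f x = y" using f(1) unfolding FN_def by blast
    have "Ev (\<lambda>x. f x = g x) \<longleftrightarrow> Ev (\<lambda>x. E (pr x (g x)) t)" for g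
      unfolding t using Ev_mono[of "\<lambda>x. f x = g x" "\<lambda>x. x \<prec> L \<and> f x = g x"]
        Ev_mono[of "\<lambda>x. x \<prec> L \<and> f x = g x" "\<lambda>x. f x = g x"] by blast
    then have "q = {g. FN g \<and> Ev (\<lambda>x. E (pr x (g x)) t)}" unfolding f(2) ec_def by simp
    then show "q \<in> range (\<lambda>t. {g. FN g \<and> Ev (\<lambda>x. E (pr x (g x)) t)})" by (rule range_eqI)
  qed
  then have cnt: "countable (ec ` Collect FN)"
    by (rule countable_subset) (rule countable_image[OF assms(1)])
  obtain e :: "nat \<Rightarrow> 'b" where e: "inj e" "range e \<subseteq> Z"
    using infinite_countable_subset[OF assms(3)] by blast
  define \<kappa> where "\<kappa> q = e (to_nat_on (ec ` Collect FN) q)" for q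
  have \<kappa>: "\<kappa> (ec f) = \<kappa> (ec g) \<longleftrightarrow> Ev (\<lambda>x. f x = g x)" if "FN f" "FN g" for f g
    unfolding \<kappa>_def using that by (simp add: inj_eq[OF e(1)] cnt ec_eq)
  have \<kappa>Z: "\<kappa> q \<in> Z" for q unfolding \<kappa>_def using e(2) by blast
  have j\<kappa>: "j d \<noteq> \<kappa> q" for d q
  proof
    assume "j d = \<kappa> q"
    then have "\<kappa> q \<in> range j" by (intro range_eqI[of _ _ d]) simp
    then show False using \<kappa>Z[of q] assms(4) by blast
  qed
  define cl where "cl f = (if \<exists>d. Ev (\<lambda>x. f x = d) then j (THE d. Ev (\<lambda>x. f x = d)) else \<kappa> (ec f))" for f
  have uniq: "d = d'" if "Ev (\<lambda>x. f x = d)" "Ev (\<lambda>x. f x = d')" for f d d'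
    using Ev_mono2[OF that, of "\<lambda>_. d = d'"] by simp
  have cl1: "cl f = j d" if "Ev (\<lambda>x. f x = d)" for f d
  proof -
    have "(THE d. Ev (\<lambda>x. f x = d)) = d" by (rule the_equality, rule that, rule uniq[OF _ that])
    then show ?thesis unfolding cl_def using that by auto
  qed
  have cl2: "cl f = \<kappa> (ec f)" if "\<not> (\<exists>d. Ev (\<lambda>x. f x = d))" for f
    unfolding cl_def using that by simp
  have tr: "Ev (\<lambda>x. g x = d)" if "Ev (\<lambda>x. f x = d)" "Ev (\<lambda>x. f x = g x)" for f g d
    by (rule Ev_mono2[OF that]) simp
  have sym: "Ev (\<lambda>x. f x = g x) \<longleftrightarrow> Ev (\<lambda>x. g x = f x)" for f g by (simp add: eq_commute)
  have "cl f = cl g \<longleftrightarrow> Ev (\<lambda>x. f x = g x)" if "FN f" "FN g" for f g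
  proof (cases "\<exists>d. Ev (\<lambda>x. f x = d)")
    case True
    then obtain d where d: "Ev (\<lambda>x. f x = d)" by blast
    show ?thesis
    proof (cases "\<exists>d. Ev (\<lambda>x. g x = d)")
      case True
      then obtain d' where d': "Ev (\<lambda>x. g x = d')" by blast
      have "j d = j d' \<longleftrightarrow> d = d'" using assms(2) by (simp add: inj_eq)
      moreover have "Ev (\<lambda>x. f x = g x)" if "d = d'" using Ev_mono2[OF d d'] that by auto
      moreover have "d = d'" if "Ev (\<lambda>x. f x = g x)" using uniq[OF tr[OF d that] d'] .
      ultimately show ?thesis using cl1[OF d] cl1[OF d'] by auto
    next
      case False
      then show ?thesis using cl1[OF d] cl2[of g] j\<kappa>[of d "ec g"] tr[OF d, of g] by auto
    qed
  next
    case no: False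
    show ?thesis
    proof (cases "\<exists>d. Ev (\<lambda>x. g x = d)")
      case True
      then obtain d' where d': "Ev (\<lambda>x. g x = d')" by blast
      then show ?thesis using cl1[OF d'] cl2[OF no] j\<kappa>[of d' "ec f"] tr[OF d', of f] no sym[of f g] by metis
    next
      case False
      then show ?thesis using cl2[OF no] cl2[of g] \<kappa>[OF that] by simp
    qed
  qed
  moreover have "cl (\<lambda>_. d) = j d" for d by (rule cl1) simp
  moreover have "cl ` Collect FN \<subseteq> range j \<union> Z" using \<kappa>Z unfolding cl_def by auto
  ultimately show ?thesis by blast
qed

text \<open>Used twice: to move a countable model onto the natural numbers, as the locales above
  require, and to replace the given model by its copy under \<open>Inl\<close>.\<close>

definition pullback :: "'a set \<Rightarrow> ('a \<Rightarrow> 'b) \<Rightarrow> 'b struc \<Rightarrow> 'a struc" where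
  "pullback A j K = \<lparr>carrier = A, zero = inv_into A j (zero K), one = inv_into A j (one K),
     plus = (\<lambda>x y. inv_into A j (plus K (j x) (j y))), times = (\<lambda>x y. inv_into A j (times K (j x) (j y))),
     less = (\<lambda>x y. less K (j x) (j y))\<rparr>"

context
  fixes A :: "'a set" and j :: "'a \<Rightarrow> 'b" and K :: "'b struc"
  assumes j: "bij_betw j A (carrier K)" and wfK: "wf_struc K"
begin

lemma carrier_j: "carrier K = j ` A"
  using j unfolding bij_betw_def by blast

lemma j_in: "x \<in> A \<Longrightarrow> j x \<in> carrier K"
  using carrier_j by blast

lemma inj_j: "x \<in> A \<Longrightarrow> y \<in> A \<Longrightarrow> j x = j y \<longleftrightarrow> x = y"
  using j unfolding bij_betw_def inj_on_def by blast

lemma j_inv: "y \<in> carrier K \<Longrightarrow> j (inv_into A j y) = y" "y \<in> carrier K \<Longrightarrow> inv_into A j y \<in> A"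
  unfolding carrier_j by (rule f_inv_into_f, assumption) (rule inv_into_into)

lemma pullback_hom:
  "carrier (pullback A j K) = A"
  "j (zero (pullback A j K)) = zero K" "zero (pullback A j K) \<in> A"
  "j (one (pullback A j K)) = one K" "one (pullback A j K) \<in> A"
  "x \<in> A \<Longrightarrow> y \<in> A \<Longrightarrow> j (plus (pullback A j K) x y) = plus K (j x) (j y)"
  "x \<in> A \<Longrightarrow> y \<in> A \<Longrightarrow> plus (pullback A j K) x y \<in> A"
  "x \<in> A \<Longrightarrow> y \<in> A \<Longrightarrow> j (times (pullback A j K) x y) = times K (j x) (j y)"
  "x \<in> A \<Longrightarrow> y \<in> A \<Longrightarrow> times (pullback A j K) x y \<in> A"
  "less (pullback A j K) x y = less K (j x) (j y)"
  using wfK j_in unfolding wf_struc_def pullback_def by (simp_all add: j_inv)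

lemma wf_pullback: "wf_struc (pullback A j K)"
  unfolding wf_struc_def by (simp add: pullback_hom)

lemma eval_pullback:
  assumes "\<And>i. s i \<in> A"
  shows "eval (pullback A j K) s t \<in> A \<and> j (eval (pullback A j K) s t) = eval K (\<lambda>i. j (s i)) t"
  using assms by (induction t) (simp_all add: pullback_hom)

lemma j_upd: "(\<lambda>i. j ((s(v := d)) i)) = (\<lambda>i. j (s i))(v := j d)"
  by auto

lemma sat_pullback: "(\<And>i. s i \<in> A) \<Longrightarrow> sat (pullback A j K) p s = sat K p (\<lambda>i. j (s i))"
proof (induction p arbitrary: s)
  case (Eq t u)
  then show ?case
    using inj_j[of "eval (pullback A j K) s t" "eval (pullback A j K) s u"]
      eval_pullback[of s t] eval_pullback[of s u] by simp
next
  case (Lt t u)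
  then show ?case using eval_pullback[of s t] eval_pullback[of s u] by (simp add: pullback_hom)
next
  case (Ex v p)
  have "sat (pullback A j K) p (s(v := d)) = sat K p ((\<lambda>i. j (s i))(v := j d))" if "d \<in> A" for d
    unfolding j_upd[symmetric] by (rule Ex.IH) (use Ex.prems that in auto)
  then show ?case by (simp add: pullback_hom carrier_j)
next
  case (All v p)
  have "sat (pullback A j K) p (s(v := d)) = sat K p ((\<lambda>i. j (s i))(v := j d))" if "d \<in> A" for d
    unfolding j_upd[symmetric] by (rule All.IH) (use All.prems that in auto)
  then show ?case by (simp add: pullback_hom carrier_j)
next
  case (BEx v t p)
  have "sat (pullback A j K) p (s(v := d)) = sat K p ((\<lambda>i. j (s i))(v := j d))" if "d \<in> A" for d
    unfolding j_upd[symmetric] by (rule BEx.IH) (use BEx.prems that in auto)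
  then show ?case using eval_pullback[of s t] BEx.prems by (simp add: pullback_hom carrier_j)
next
  case (BAll v t p)
  have "sat (pullback A j K) p (s(v := d)) = sat K p ((\<lambda>i. j (s i))(v := j d))" if "d \<in> A" for d
    unfolding j_upd[symmetric] by (rule BAll.IH) (use BAll.prems that in auto)
  then show ?case using eval_pullback[of s t] BAll.prems by (simp add: pullback_hom carrier_j)
qed simp_all

lemma assign_pullback: "assign (pullback A j K) s \<longleftrightarrow> (\<forall>i. s i \<in> A)"
  by (simp add: assign_def pullback_hom)

lemma assign_j: "(\<And>i. s i \<in> A) \<Longrightarrow> assign K (\<lambda>i. j (s i))"
  by (simp add: assign_def j_in)

lemma PAminus_pullback: "PAminus K \<Longrightarrow> PAminus (pullback A j K)"
  by (rule PAminus_of_matrix)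
    (simp_all add: sat_pullback sat_PAminus_matrix wfK assign_j assign_pullback pullback_hom)

lemma ISigma_pullback:
  assumes "ISigma n K" shows "ISigma n (pullback A j K)"
  unfolding ISigma_def assign_pullback
proof (intro allI impI)
  fix p x and s :: "nat \<Rightarrow> 'a"
  let ?P = "pullback A j K" and ?s = "\<lambda>i. j (s i)"
  assume p: "sigma_fm n p" and s: "\<forall>i. s i \<in> A" and z: "sat ?P p (s(x := zero ?P))"
    and st: "\<forall>y\<in>carrier ?P. sat ?P p (s(x := y)) \<longrightarrow> sat ?P p (s(x := plus ?P y (one ?P)))"
  have eq: "sat ?P p (s(x := d)) = sat K p (?s(x := j d))" if "d \<in> A" for d
    unfolding j_upd[symmetric] by (rule sat_pullback) (use s that in auto)
  have "sat K p (?s(x := zero K))" using z unfolding eq[OF pullback_hom(3)] pullback_hom(2) .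
  moreover have "\<forall>y\<in>carrier K. sat K p (?s(x := y)) \<longrightarrow> sat K p (?s(x := plus K y (one K)))"
    unfolding carrier_j using st by (simp add: eq pullback_hom)
  ultimately have "\<forall>y\<in>carrier K. sat K p (?s(x := y))"
    using assms[unfolded ISigma_def] p assign_j s by blast
  then show "\<forall>y\<in>carrier ?P. sat ?P p (s(x := y))" by (simp add: eq pullback_hom j_in)
qed

lemma holds_pullback:
  assumes "x \<in> A" "y \<in> A" shows "holds (pullback A j K) p [x, y] = holds K p [j x, j y]"
proof -
  let ?s = "\<lambda>i. if i < length [x, y] then [x, y] ! i else zero (pullback A j K)"
  have "(\<lambda>i. j (?s i)) = (\<lambda>i. if i < length [j x, j y] then [j x, j y] ! i else zero K)"
    by (auto simp: less_Suc_eq pullback_hom)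
  moreover have "?s i \<in> A" for i using assms by (auto simp: less_Suc_eq pullback_hom)
  ultimately show ?thesis unfolding holds_def by (subst sat_pullback) simp_all
qed

lemma pow2_pullback:
  assumes "pow2_graph K \<theta>" shows "pow2_graph (pullback A j K) \<theta>"
  using assms unfolding pow2_graph_def carrier_j pullback_hom(1)
  by (simp add: holds_pullback pullback_hom) (metis inj_j)

lemma inj_graph_pullback:
  assumes "inj_graph K (j x) (j y) R"
  shows "inj_graph (pullback A j K) x y (\<lambda>u v. u \<in> A \<and> v \<in> A \<and> R (j u) (j v))"
proof -
  have R: "\<And>u v. R u v \<Longrightarrow> v \<in> carrier K \<and> less K u (j x) \<and> less K v (j y)"
    "\<And>u. u \<in> carrier K \<Longrightarrow> less K u (j x) \<Longrightarrow> \<exists>v. R u v"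
    "\<And>u v v'. R u v \<Longrightarrow> R u v' \<Longrightarrow> v = v'" "\<And>u u' v. R u v \<Longrightarrow> R u' v \<Longrightarrow> u = u'"
    using assms unfolding inj_graph_def by blast+
  have "\<exists>v. v \<in> A \<and> R (j u) (j v)" if u: "u \<in> A" "less K (j u) (j x)" for u
  proof -
    obtain v where "R (j u) v" using R(2) j_in u by blast
    moreover have "v \<in> j ` A" using R(1)[OF calculation] carrier_j by blast
    ultimately show ?thesis by blast
  qed
  moreover have "v = v'" if "v \<in> A" "v' \<in> A" "R (j u) (j v)" "R (j u) (j v')" for u v v'
    using R(3) inj_j that by blast
  moreover have "u = u'" if "u \<in> A" "u' \<in> A" "R (j u) (j v)" "R (j u') (j v)" for u u' v
    using R(4) inj_j that by blast
  ultimately show ?thesis using R(1) unfolding inj_graph_def pullback_hom by blast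
qed

end

text \<open>The successor map is injective and misses zero. Infinity is what yields a bijection of a
  countable model with all natural numbers.\<close>

lemma infinite_carrier:
  assumes "PAminus K" "wf_struc K" shows "infinite (carrier K)"
proof
  assume fin: "finite (carrier K)"
  note P = PAminusD[OF assms(1)]
  have c: "zero K \<in> carrier K" "one K \<in> carrier K" using assms(2) unfolding wf_struc_def by auto
  let ?f = "\<lambda>x. plus K x (one K)"
  have im: "?f ` carrier K \<subseteq> carrier K" using assms(2) c unfolding wf_struc_def by auto
  have "x = y" if "x \<in> carrier K" "y \<in> carrier K" "?f x = ?f y" for x y
  proof -
    have "?f x \<in> carrier K" using im that(1) by blast
    then have "\<not> less K (?f x) (?f y)" "\<not> less K (?f y) (?f x)" using P(9) that(3) by simp_all
    then show ?thesis using P(11)[OF that(1,2)] P(12)[OF that(1,2) c(2)] P(12)[OF that(2,1) c(2)] by blast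
  qed
  then have "inj_on ?f (carrier K)" by (rule inj_onI)
  then have "?f ` carrier K = carrier K" using fin im by (simp add: endo_inj_surj)
  then have "zero K \<in> ?f ` carrier K" using c(1) by simp
  then obtain x where x: "x \<in> carrier K" "?f x = zero K" by fastforce
  have "less K (one K) (zero K) \<or> one K = zero K"
    using P(17)[OF x(1)] P(12)[OF c(1) x(1) c(2)] x(2) P(2)[OF c] P(6)[OF c(2)] by auto
  then show False using P(15) P(10)[OF c(1) c(2) c(1)] P(9)[OF c(1)] by metis
qed

definition good :: "nat \<Rightarrow> fm \<Rightarrow> 'b struc \<Rightarrow> bool" where
  "good n \<theta> K \<longleftrightarrow> wf_struc K \<and> PAminus K \<and> ISigma n K \<and> pow2_graph K \<theta> \<and> countable (carrier K)"

text \<open>Extension by inclusion rather than by an embedding, so that the limit of a chain is a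
  plain union. Agreement of the operations is part of elementarity for atomic formulas, see
  \<open>elem_ext_ops\<close>.\<close>

definition elem_ext :: "nat \<Rightarrow> 'b \<Rightarrow> 'b struc \<Rightarrow> 'b struc \<Rightarrow> bool" where
  "elem_ext n a K N \<longleftrightarrow> carrier K \<subseteq> carrier N \<and>
     (\<forall>p s. sigma_fm (Suc n) p \<longrightarrow> assign K s \<longrightarrow> sat K p s = sat N p s) \<and>
     (\<forall>y\<in>carrier N. \<exists>x\<in>carrier K. less N y x) \<and>
     (\<forall>y\<in>carrier N. less N y a \<longrightarrow> y \<in> carrier K)"

text \<open>\<open>C k\<close> plays the role of \<open>a\<^sup>e\<^sup>-\<^sup>k\<close> for a nonstandard \<open>e\<close>.\<close>
lemma one_step:
  fixes K :: "'b struc" and C :: "nat \<Rightarrow> 'b"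
  assumes good: "good n \<theta> K" and a: "a \<in> carrier K" "less K (one K) a"
    and Z: "infinite Z" "countable Z" "Z \<inter> carrier K = {}"
    and C: "\<And>k. C k \<in> carrier K" "\<And>k. C k = times K a (C (Suc k))" "C 0 \<noteq> zero K"
    and b: "b \<in> carrier K" "less K (zero K) b"
  shows "\<exists>N. good n \<theta> N \<and> elem_ext n a K N \<and> carrier N \<subseteq> carrier K \<union> Z \<and>
    (\<exists>d\<in>carrier N. less N d (times K (C 0) b) \<and>
      (\<forall>p s. sigma_fm (Suc n) p \<longrightarrow> assign K s \<longrightarrow>
         inj_graph K (times K (C 0) b) b (\<lambda>u v. u \<in> carrier K \<and> v \<in> carrier K \<and> sat K p (s(0 := u, 1 := v))) \<longrightarrow>
         (\<forall>v\<in>carrier N. \<not> sat N p (s(0 := d, 1 := v)))))"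
proof -
  have K: "wf_struc K" "PAminus K" "ISigma n K" "pow2_graph K \<theta>" "countable (carrier K)"
    using good unfolding good_def by blast+
  \<comment> \<open>The ultrapower is formed over a copy \<open>M\<close> of \<open>K\<close> on the
    natural numbers; naming its classes through \<open>j\<close> returns to the type of
    \<open>K\<close>.\<close>
  have "infinite (carrier K)" using infinite_carrier K by blast
  then have "bij_betw (from_nat_into (carrier K)) UNIV (carrier K)"
    using K(5) by (intro bij_betw_from_nat_into)
  then obtain j :: "nat \<Rightarrow> 'b" where j: "bij_betw j UNIV (carrier K)" by blast
  note jj = j K(1)
  define M where "M = pullback UNIV j K"
  interpret cm: coded_model M \<theta>
    unfolding M_def
    using ISigma_0[OF ISigma_pullback[OF jj K(3)]] PAminus_pullback[OF jj K(2)] pow2_pullback[OF jj K(4)]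
    by unfold_locales (simp_all add: pullback_hom[OF jj])
  have hom: "j (zero M) = zero K" "j (one M) = one K" "j (plus M x y) = plus K (j x) (j y)"
    "j (times M x y) = times K (j x) (j y)" "less M x y = less K (j x) (j y)" for x y
    unfolding M_def by (simp_all add: pullback_hom[OF jj])
  have satM: "sat M p s = sat K p (\<lambda>i. j (s i))" for p s unfolding M_def by (rule sat_pullback[OF jj]) simp
  define i where "i = inv_into UNIV j"
  have ji: "j (i y) = y" if "y \<in> carrier K" for y unfolding i_def by (rule j_inv(1)[OF jj that])
  have inj: "j x = j y \<longleftrightarrow> x = y" for x y by (rule inj_j[OF jj]) simp_all
  have rng: "range j = carrier K" using carrier_j[OF jj] by simp
  define L where "L = times M (i (C 0)) (i b)"
  have jL: "j L = times K (C 0) b" unfolding L_def hom ji[OF b(1)] ji[OF C(1)] ..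
  have 1: "i (C k) = times M (i a) (i (C (Suc k)))" for k
    unfolding inj[symmetric] hom ji[OF a(1)] ji[OF C(1)] by (rule C(2))
  have 2: "i (C 0) \<noteq> zero M" unfolding inj[symmetric] hom ji[OF C(1)] by (rule C(3))
  have 3: "less M (one M) (i a)" unfolding hom ji[OF a(1)] by (rule a(2))
  have 4: "less M (zero M) (i b)" unfolding hom ji[OF b(1)] by (rule b(2))
  obtain S where S: "\<forall>k. S (Suc k) \<subseteq> S k" "\<forall>k. S k \<noteq> {}" "\<forall>k. S k \<subseteq> {x. less M x L}"
    "\<forall>t. (\<forall>x. less M x L \<longrightarrow> (\<exists>u. less M u (i a) \<and> cm.E (cm.pr x u) t)) \<longrightarrow>
         (\<exists>k u. less M u (i a) \<and> (\<forall>x\<in>S k. cm.E (cm.pr x u) t))"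
    "\<forall>B. cm.coded B \<longrightarrow> cm.small B (i b) \<longrightarrow> (\<exists>k. S k \<inter> B = {})"
    using cm.shrinking_sequence[of "\<lambda>k. i (C k)" "i a" "i b", OF 1 2 3 4] unfolding L_def by auto
  interpret gen: generic M \<theta> n "i a" "i b" L S
    by unfold_locales (use S 3 ISigma_pullback[OF jj K(3)] in \<open>auto simp: M_def\<close>)
  have "inj j" using inj by (intro injI) blast
  moreover have "countable (UNIV :: nat set)" by simp
  ultimately obtain cl where cl: "\<And>f g. gen.FN f \<Longrightarrow> gen.FN g \<Longrightarrow> cl f = cl g \<longleftrightarrow> gen.Ev (\<lambda>x. f x = g x)"
    "\<And>d. cl (\<lambda>_. d) = j d" "cl ` Collect gen.FN \<subseteq> carrier K \<union> Z"
    using gen.exists_classes[of j Z] Z rng by metis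
  interpret q: generic_quotient M \<theta> n "i a" "i b" L S cl
    by unfold_locales (rule cl(1))
  have emb: "q.emb d = j d" for d unfolding q.emb_def by (rule cl(2))
  have carN: "carrier q.N \<subseteq> carrier K \<union> Z" unfolding q.N_simps by (rule cl(3))
  have sub: "carrier K \<subseteq> carrier q.N" using q.emb_hom(1) unfolding emb rng[symmetric] by (rule image_subsetI)
  have asg: "s = (\<lambda>u. j (i (s u)))" if "assign K s" for s
    using that ji unfolding assign_def by auto
  have ns: "sat q.N p s \<longleftrightarrow> sat K p s" if "sigma_fm (Suc n) p" "assign K s" for p s
    using q.sigma_elem[OF that(1), of "\<lambda>u. i (s u)"] unfolding emb satM asg[OF that(2), symmetric] .
  have "good n \<theta> q.N"
    unfolding good_def using q.wf_N q.PAminus_N q.ISigma_N q.pow2_N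
      countable_subset[OF carN countable_Un[OF K(5) Z(2)]] by blast
  moreover have "elem_ext n a K q.N"
    unfolding elem_ext_def
  proof (intro conjI ballI allI impI sub)
    fix p s assume "sigma_fm (Suc n) p" "assign K s"
    then show "sat K p s = sat q.N p s" using ns by blast
  next
    fix y assume y: "y \<in> carrier q.N"
    show "\<exists>x\<in>carrier K. less q.N y x" using q.cofinal_N[OF y] rng unfolding emb by blast
    show "y \<in> carrier K" if "less q.N y a"
      using q.initial_N[OF y] that rng unfolding emb ji[OF a(1)] by blast
  qed
  moreover have "\<exists>d\<in>carrier q.N. less q.N d (times K (C 0) b) \<and>
      (\<forall>p s. sigma_fm (Suc n) p \<longrightarrow> assign K s \<longrightarrow>
         inj_graph K (times K (C 0) b) b (\<lambda>u v. u \<in> carrier K \<and> v \<in> carrier K \<and> sat K p (s(0 := u, 1 := v))) \<longrightarrow>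
         (\<forall>v\<in>carrier q.N. \<not> sat q.N p (s(0 := d, 1 := v))))"
  proof -
    obtain d where d: "d \<in> carrier q.N" "less q.N d (j L)"
      "\<And>p s v. sigma_fm (Suc n) p \<Longrightarrow> inj_graph M L (i b) (\<lambda>u v. sat M p (s(0 := u, 1 := v))) \<Longrightarrow>
        v \<in> carrier q.N \<Longrightarrow> \<not> sat q.N p ((\<lambda>u. j (s u))(0 := d, 1 := v))"
      using q.kill_N unfolding emb by blast
    have "\<not> sat q.N p (s(0 := d, 1 := v))"
      if p: "sigma_fm (Suc n) p" and s: "assign K s" and v: "v \<in> carrier q.N"
        and g: "inj_graph K (times K (C 0) b) b (\<lambda>u v. u \<in> carrier K \<and> v \<in> carrier K \<and> sat K p (s(0 := u, 1 := v)))" for p s v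
    proof -
      have "inj_graph K (j L) (j (i b)) (\<lambda>u v. u \<in> carrier K \<and> v \<in> carrier K \<and> sat K p (s(0 := u, 1 := v)))"
        using g unfolding jL ji[OF b(1)] .
      from inj_graph_pullback[OF jj this]
      have "inj_graph M L (i b) (\<lambda>u v. sat K p (s(0 := j u, 1 := j v)))"
        unfolding M_def by (simp add: j_in[OF jj])
      moreover have "(\<lambda>w. j (((\<lambda>u. i (s u))(0 := u, 1 := v)) w)) = s(0 := j u, 1 := j v)" for u v
        using asg[OF s] by (auto simp: fun_eq_iff)
      ultimately have "inj_graph M L (i b) (\<lambda>u v. sat M p ((\<lambda>u. i (s u))(0 := u, 1 := v)))"
        unfolding satM by simp
      from d(3)[OF p this v] show ?thesis unfolding asg[OF s, symmetric] .
    qed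
    then show ?thesis using d(1,2) unfolding jL by blast
  qed
  ultimately show ?thesis using carN by blast
qed

section \<open>Elementary chains\<close>

lemma assign_upd: "assign K s \<Longrightarrow> d \<in> carrier K \<Longrightarrow> assign K (s(v := d))"
  by (simp add: assign_def)

lemma goodD:
  assumes "good n \<theta> K"
  shows "wf_struc K" "PAminus K" "ISigma n K" "pow2_graph K \<theta>" "countable (carrier K)"
    "zero K \<in> carrier K" "one K \<in> carrier K"
    "\<And>x y. x \<in> carrier K \<Longrightarrow> y \<in> carrier K \<Longrightarrow> plus K x y \<in> carrier K"
    "\<And>x y. x \<in> carrier K \<Longrightarrow> y \<in> carrier K \<Longrightarrow> times K x y \<in> carrier K"
  using assms unfolding good_def wf_struc_def by blast+

lemma elem_ext_sat:
  assumes "elem_ext n a K N" "k \<le> Suc n" "sigma_fm k p \<or> pi_fm k p" "assign K s"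
  shows "sat K p s = sat N p s"
proof -
  have *: "sat K p s = sat N p s" if "sigma_fm k p" for p
    using assms(1,4) sigma_pi_mono(1)[OF assms(2) that] unfolding elem_ext_def by blast
  show ?thesis
  proof (cases "sigma_fm k p")
    case False
    then obtain p' where "sigma_fm k p'" "\<forall>M s. sat (M :: 'a struc) p' s \<longleftrightarrow> \<not> sat M p s"
      using assms(3) neg_sigma_pi(2) by blast
    then show ?thesis using * by blast
  qed (rule *)
qed

lemma elem_ext_delta0:
  assumes "elem_ext n a K N" "delta0 p" "assign K s" shows "sat K p s = sat N p s"
  using elem_ext_sat[OF assms(1), of 0 p s] assms(2,3) sigma_fm_pi_fm.intros(1) by blast

lemma elem_ext_ops:
  assumes e: "elem_ext n a K N" and g: "good n \<theta> K"
  shows "zero N = zero K" "one N = one K"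
    "\<And>x y. x \<in> carrier K \<Longrightarrow> y \<in> carrier K \<Longrightarrow> plus N x y = plus K x y"
    "\<And>x y. x \<in> carrier K \<Longrightarrow> y \<in> carrier K \<Longrightarrow> times N x y = times K x y"
    "\<And>x y. x \<in> carrier K \<Longrightarrow> y \<in> carrier K \<Longrightarrow> less N x y = less K x y"
proof -
  note D = goodD[OF g]
  have A: "assign K (x ## y ## (\<lambda>_. w))" if "x \<in> carrier K" "y \<in> carrier K" "w \<in> carrier K" for x y w
    using that by (auto simp: assign_def split: nat.split)
  show "zero N = zero K"
    using elem_ext_delta0[OF e delta0.intros(1)[of "Var 0" Zero] A[OF D(6) D(6) D(6)]] by simp
  show "one N = one K"
    using elem_ext_delta0[OF e delta0.intros(1)[of "Var 0" One] A[OF D(7) D(7) D(7)]] by simp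
  fix x y assume xy: "x \<in> carrier K" "y \<in> carrier K"
  show "plus N x y = plus K x y"
    using elem_ext_delta0[OF e delta0.intros(1)[of "Plus (Var 0) (Var 1)" "Var 2"] A[OF xy D(8)[OF xy]]]
    by (simp add: numeral_2_eq_2)
  show "times N x y = times K x y"
    using elem_ext_delta0[OF e delta0.intros(1)[of "Times (Var 0) (Var 1)" "Var 2"] A[OF xy D(9)[OF xy]]]
    by (simp add: numeral_2_eq_2)
  show "less N x y = less K x y"
    using elem_ext_delta0[OF e delta0.intros(2)[of "Var 0" "Var 1"] A[OF xy xy(1)]] by simp
qed

lemma elem_ext_refl:
  assumes "good n \<theta> K" shows "elem_ext n a K K"
proof -
  note D = goodD[OF assms] and P = PAminusD[OF goodD(2)[OF assms]]
  have "less K y (plus K y (one K))" if y: "y \<in> carrier K" for y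
    using P(12)[OF D(6,7) y P(15)] P(2)[OF D(6) y] P(2)[OF D(7) y] P(6)[OF y] by simp
  then show ?thesis unfolding elem_ext_def using D(7,8) by blast
qed

lemma elem_ext_trans:
  assumes e: "elem_ext n a K N" "elem_ext n a N N'" and g: "good n \<theta> N" "good n \<theta> N'" and a: "a \<in> carrier K"
  shows "elem_ext n a K N'"
proof -
  have sub: "carrier K \<subseteq> carrier N" "carrier N \<subseteq> carrier N'" using e unfolding elem_ext_def by blast+
  have "\<exists>x\<in>carrier K. less N' y x" if y: "y \<in> carrier N'" for y
  proof -
    obtain x where x: "x \<in> carrier N" "less N' y x" using e(2) y unfolding elem_ext_def by blast
    obtain w where w: "w \<in> carrier K" "less N x w" using e(1) x(1) unfolding elem_ext_def by blast
    have "less N' x w" using elem_ext_ops(5)[OF e(2) g(1) x(1)] w sub by blast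
    then have "less N' y w" using PAminusD(10)[OF goodD(2)[OF g(2)] y] x w sub by blast
    then show ?thesis using w(1) by blast
  qed
  moreover have "y \<in> carrier K" if y: "y \<in> carrier N'" "less N' y a" for y
  proof -
    have yN: "y \<in> carrier N" using e(2) y unfolding elem_ext_def by blast
    then have "less N y a" using elem_ext_ops(5)[OF e(2) g(1) yN] y(2) a sub by blast
    then show ?thesis using e(1) yN unfolding elem_ext_def by blast
  qed
  moreover have "sat K p s = sat N' p s" if "sigma_fm (Suc n) p" "assign K s" for p s
  proof -
    have "assign N s" using that(2) sub(1) unfolding assign_def by blast
    then show ?thesis using e that unfolding elem_ext_def by blast
  qed
  ultimately show ?thesis unfolding elem_ext_def using sub by blast
qed

text \<open>The descent is required inside \<open>K\<close>, because the shrinking sequence is built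
  over \<open>K\<close>. \<open>no_def_inj_U\<close> shows that a descent in the union already lies
  in such a stage.\<close>

definition killable :: "'b \<Rightarrow> 'b struc \<Rightarrow> 'b \<Rightarrow> 'b \<Rightarrow> bool" where
  "killable a K c b \<longleftrightarrow> (\<exists>C. C 0 = c \<and> (\<forall>k :: nat. C k \<in> carrier K \<and> C k = times K a (C (Suc k)))) \<and>
     c \<noteq> zero K \<and> b \<in> carrier K \<and> less K (zero K) b"

text \<open>One element \<open>d\<close> serves all formulas and all parameters from
  \<open>K\<close> at once, so a stage is assigned to a pair \<open>c\<close>, \<open>b\<close> and
  not to a formula.\<close>

definition killed :: "nat \<Rightarrow> 'b struc \<Rightarrow> 'b struc \<Rightarrow> 'b \<Rightarrow> 'b \<Rightarrow> bool" where
  "killed n K N c b \<longleftrightarrow> (\<exists>d\<in>carrier N. less N d (times K c b) \<and>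
      (\<forall>p s. sigma_fm (Suc n) p \<longrightarrow> assign K s \<longrightarrow>
         inj_graph K (times K c b) b (\<lambda>u v. u \<in> carrier K \<and> v \<in> carrier K \<and> sat K p (s(0 := u, 1 := v))) \<longrightarrow>
         (\<forall>v\<in>carrier N. \<not> sat N p (s(0 := d, 1 := v)))))"

lemma kill_step:
  assumes "good n \<theta> K" "a \<in> carrier K" "less K (one K) a" "infinite Z" "countable Z" "Z \<inter> carrier K = {}"
  shows "\<exists>N. good n \<theta> N \<and> elem_ext n a K N \<and> carrier N \<subseteq> carrier K \<union> Z \<and>
    (killable a K c b \<longrightarrow> killed n K N c b)"
proof (cases "killable a K c b")
  case True
  then obtain C where c: "C 0 = c" and CC: "\<forall>k :: nat. C k \<in> carrier K \<and> C k = times K a (C (Suc k))"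
    and nz: "c \<noteq> zero K" and b: "b \<in> carrier K" "less K (zero K) b"
    unfolding killable_def by blast
  have C: "\<And>k. C k \<in> carrier K" "\<And>k. C k = times K a (C (Suc k))" "C 0 \<noteq> zero K"
    using CC nz c by blast+
  show ?thesis using one_step[OF assms C b] unfolding killed_def c by blast
next
  case False
  then show ?thesis using assms(1) elem_ext_refl[OF assms(1), of a] by (intro exI[of _ K]) simp
qed

lemma nonstandard_pred:
  assumes "nonstandard N e" "PAminus N" "wf_struc N"
  shows "\<exists>e'. nonstandard N e' \<and> e = plus N e' (one N)"
proof -
  note P = PAminusD[OF assms(2)]
  have c: "zero N \<in> carrier N" "one N \<in> carrier N" using assms(3) unfolding wf_struc_def by auto
  have e: "e \<in> carrier N" "\<And>k. e \<noteq> std_num N k" using assms(1) unfolding nonstandard_def by blast+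
  have "e \<noteq> zero N" using e(2)[of 0] by (simp add: std_num_def)
  moreover have "e \<noteq> one N"
    using e(2)[of 1] P(2)[OF c] P(6)[OF c(2)] by (simp add: std_num_def)
  ultimately have "less N (one N) e" using P(16,17)[OF e(1)] by blast
  then obtain w where w: "w \<in> carrier N" "plus N (one N) w = e" using P(14)[OF c(2) e(1)] by blast
  then have we: "e = plus N w (one N)" using P(2)[OF c(2) w(1)] by simp
  moreover have "w \<noteq> std_num N k" for k
    using e(2)[of "Suc k"] we by (auto simp: std_num_def)
  ultimately show ?thesis using w(1) unfolding nonstandard_def by blast
qed

text \<open>The only consequence of \<open>c = a\<^sup>e\<close> with \<open>e\<close> nonstandard that matters: \<open>c\<close> is a nonzero
  element that can be divided by \<open>a\<close> infinitely often.\<close>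
lemma power_descent:
  assumes N: "PAminus N" "wf_struc N" "ISigma 0 N" and a: "a \<in> carrier N" "less N (one N) a"
    and e: "nonstandard N e" and c: "is_power N a e c"
  shows "c \<noteq> zero N \<and> (\<exists>C. C 0 = c \<and> (\<forall>k :: nat. C k \<in> carrier N \<and> C k = times N a (C (Suc k))))"
proof -
  note P = PAminusD[OF N(1)]
  have cN: "zero N \<in> carrier N" "one N \<in> carrier N" "c \<in> carrier N"
    using N(2) c unfolding wf_struc_def is_power_def by auto
  have cl: "x \<in> carrier N \<Longrightarrow> y \<in> carrier N \<Longrightarrow> plus N x y \<in> carrier N"
    "x \<in> carrier N \<Longrightarrow> y \<in> carrier N \<Longrightarrow> times N x y \<in> carrier N" for x y
    using N(2) unfolding wf_struc_def by auto
  obtain \<phi> where ph: "power_graph N \<phi>" "holds N \<phi> [a, e, c]" using c unfolding is_power_def by blast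
  have tot: "y \<in> carrier N \<Longrightarrow> \<exists>z\<in>carrier N. holds N \<phi> [a, y, z]"
    and uniq: "y \<in> carrier N \<Longrightarrow> z \<in> carrier N \<Longrightarrow> z' \<in> carrier N \<Longrightarrow>
      holds N \<phi> [a, y, z] \<Longrightarrow> holds N \<phi> [a, y, z'] \<Longrightarrow> z = z'"
    and base: "holds N \<phi> [a, zero N, one N]"
    and step: "y \<in> carrier N \<Longrightarrow> z \<in> carrier N \<Longrightarrow> holds N \<phi> [a, y, z] \<Longrightarrow>
      holds N \<phi> [a, plus N y (one N), times N z a]" for y z z'
    using ph(1) a(1) unfolding power_graph_def by blast+
  have a0: "less N (zero N) a" using P(10)[OF cN(1,2) a(1) P(15) a(2)] .
  \<comment> \<open>By Delta_0 induction on the exponent no power of \<open>a\<close> is zero; the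
    graph \<open>\<phi>\<close> is bounded, so \<open>Neg \<phi>\<close> is an admissible induction
    formula.\<close>
  have nz: "\<not> holds N \<phi> [a, y, zero N]" if "y \<in> carrier N" for y
  proof -
    let ?s = "(\<lambda>_. zero N)(0 := a)"
    have h: "holds N \<phi> [a, y, zero N] = sat N \<phi> (?s(1 := y))" for y
    proof -
      have "(\<lambda>i. if i < length [a, y, zero N] then [a, y, zero N] ! i else zero N) = ?s(1 := y)"
        by (auto simp: less_Suc_eq numeral_3_eq_3)
      then show ?thesis unfolding holds_def by simp
    qed
    have "sigma_fm 0 (Neg \<phi>)"
      using ph(1) unfolding power_graph_def by (intro sigma_fm_pi_fm.intros delta0.intros) blast
    moreover have "assign N ?s" using a cN by (simp add: assign_def)
    moreover have "sat N (Neg \<phi>) (?s(1 := zero N))"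
      using uniq[OF cN(1) cN(1) cN(2)] base P(9)[OF cN(1)] P(15) unfolding sat.simps h[symmetric] by metis
    moreover have "sat N (Neg \<phi>) (?s(1 := plus N y (one N)))"
      if y: "y \<in> carrier N" "sat N (Neg \<phi>) (?s(1 := y))" for y
    proof -
      obtain z where z: "z \<in> carrier N" "holds N \<phi> [a, y, z]" using tot[OF y(1)] by blast
      have "z \<noteq> zero N" using y(2) z(2) unfolding sat.simps h[symmetric] by blast
      then have "less N (zero N) z" using P(17)[OF z(1)] by blast
      then have "less N (times N (zero N) a) (times N z a)" using P(13)[OF cN(1) z(1) a(1) a0] by blast
      then have "times N z a \<noteq> zero N" using P(4)[OF cN(1) a(1)] P(7)[OF a(1)] P(9)[OF cN(1)] by auto
      then show ?thesis unfolding sat.simps h[symmetric]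
        using step[OF y(1) z] uniq[OF cl(1)[OF y(1) cN(2)] cl(2)[OF z(1) a(1)] cN(1)] by blast
    qed
    ultimately have "sat N (Neg \<phi>) (?s(1 := y))" using N(3)[unfolded ISigma_def] that by blast
    then show ?thesis unfolding sat.simps h by blast
  qed
  have "e \<in> carrier N" using e unfolding nonstandard_def by blast
  then have "c \<noteq> zero N" using nz ph(2) by blast
  \<comment> \<open>The external sequence of exponents e, e-1, e-2, ..., which never ends because
    the predecessor of a nonstandard number is nonstandard.\<close>
  have "\<exists>f. \<forall>k. nonstandard N (f k) \<and> (k = 0 \<longrightarrow> f k = e) \<and> f k = plus N (f (Suc k)) (one N)"
  proof -
    have "\<exists>f. \<forall>k. (nonstandard N (f k) \<and> (k = 0 \<longrightarrow> f k = e)) \<and> f k = plus N (f (Suc k)) (one N)"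
      by (rule dependent_nat_choice) (use e nonstandard_pred[OF _ N(1,2)] in auto)
    then show ?thesis by simp
  qed
  then obtain f where f: "\<And>k. nonstandard N (f k)" "f 0 = e" "\<And>k. f k = plus N (f (Suc k)) (one N)" by blast
  have fc: "f k \<in> carrier N" for k using f(1) unfolding nonstandard_def by blast
  define C where "C k = (SOME z. z \<in> carrier N \<and> holds N \<phi> [a, f k, z])" for k
  have C: "C k \<in> carrier N" "holds N \<phi> [a, f k, C k]" for k
    using someI_ex[of "\<lambda>z. z \<in> carrier N \<and> holds N \<phi> [a, f k, z]"] tot[OF fc] unfolding C_def by blast+
  have "C 0 = c" using uniq[OF fc C(1) cN(3) C(2)] ph(2) f(2) by simp
  moreover have "C k = times N a (C (Suc k))" for k
  proof -
    have "holds N \<phi> [a, f k, times N (C (Suc k)) a]" using step[OF fc C, of "Suc k"] f(3)[of k] by simp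
    then have "C k = times N (C (Suc k)) a" using uniq[OF fc C(1) cl(2)[OF C(1) a(1)] C(2)] by blast
    then show ?thesis using P(4)[OF C(1) a(1)] by simp
  qed
  ultimately show ?thesis using \<open>c \<noteq> zero N\<close> C(1) by blast
qed

section \<open>The union of an elementary chain\<close>

locale elem_chain =
  fixes n :: nat and \<theta> :: fm and a :: 'b and X :: "nat \<Rightarrow> 'b struc"
  assumes X_good: "\<And>i. good n \<theta> (X i)" and X_ext: "\<And>i. elem_ext n a (X i) (X (Suc i))"
    and a_in: "a \<in> carrier (X 0)"
begin

lemma ext: "i \<le> k \<Longrightarrow> elem_ext n a (X i) (X k) \<and> a \<in> carrier (X k)"
proof (induction k)
  case 0
  then show ?case using elem_ext_refl[OF X_good] a_in by simp
next
  case (Suc k)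
  have a: "a \<in> carrier (X k)" for k
  proof (induction k)
    case (Suc k)
    then show ?case using X_ext[of k] unfolding elem_ext_def by blast
  qed (rule a_in)
  show ?case
  proof (cases "i = Suc k")
    case True
    then show ?thesis using elem_ext_refl[OF X_good] a by simp
  next
    case False
    then have "elem_ext n a (X i) (X k)" using Suc by simp
    then show ?thesis using elem_ext_trans[OF _ X_ext X_good X_good] a by blast
  qed
qed

lemma X_mono: "i \<le> k \<Longrightarrow> carrier (X i) \<subseteq> carrier (X k)"
  using ext unfolding elem_ext_def by blast

text \<open>The operations of the union are read off at the first stage containing both arguments;
  \<open>U_ops\<close> shows that any later stage gives the same result.\<close>

definition idx :: "'b \<Rightarrow> 'b \<Rightarrow> nat" where
  "idx x y = (LEAST i. x \<in> carrier (X i) \<and> y \<in> carrier (X i))"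

definition U :: "'b struc" where
  "U = \<lparr>carrier = (\<Union>i. carrier (X i)), zero = zero (X 0), one = one (X 0),
    plus = (\<lambda>x y. plus (X (idx x y)) x y), times = (\<lambda>x y. times (X (idx x y)) x y),
    less = (\<lambda>x y. less (X (idx x y)) x y)\<rparr>"

lemma carrier_U: "carrier U = (\<Union>i. carrier (X i))"
  by (simp add: U_def)

lemma in_U: "x \<in> carrier (X i) \<Longrightarrow> x \<in> carrier U"
  unfolding carrier_U by blast

lemma U_ops:
  "zero U = zero (X i)" "one U = one (X i)"
  "x \<in> carrier (X i) \<Longrightarrow> y \<in> carrier (X i) \<Longrightarrow> plus U x y = plus (X i) x y"
  "x \<in> carrier (X i) \<Longrightarrow> y \<in> carrier (X i) \<Longrightarrow> times U x y = times (X i) x y"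
  "x \<in> carrier (X i) \<Longrightarrow> y \<in> carrier (X i) \<Longrightarrow> less U x y = less (X i) x y"
proof -
  show "zero U = zero (X i)" "one U = one (X i)"
    using elem_ext_ops(1,2)[OF conjunct1[OF ext[of 0 i]] X_good] unfolding U_def by simp_all
  assume xy: "x \<in> carrier (X i)" "y \<in> carrier (X i)"
  then have m: "x \<in> carrier (X (idx x y))" "y \<in> carrier (X (idx x y))"
    using LeastI[of "\<lambda>i. x \<in> carrier (X i) \<and> y \<in> carrier (X i)" i] unfolding idx_def by blast+
  have "idx x y \<le> i" unfolding idx_def by (rule Least_le) (use xy in blast)
  note O = elem_ext_ops[OF conjunct1[OF ext[OF this]] X_good]
  show "plus U x y = plus (X i) x y" "times U x y = times (X i) x y" "less U x y = less (X i) x y"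
    using O(3-5)[OF m] unfolding U_def by simp_all
qed

lemma U_two: assumes "x \<in> carrier U" "y \<in> carrier U" obtains i where "x \<in> carrier (X i)" "y \<in> carrier (X i)"
proof -
  obtain i k where "x \<in> carrier (X i)" "y \<in> carrier (X k)" using assms unfolding carrier_U by blast
  then have "x \<in> carrier (X (max i k))" "y \<in> carrier (X (max i k))"
    using X_mono[of i "max i k"] X_mono[of k "max i k"] by auto
  then show ?thesis using that by blast
qed

lemma U_finite: assumes "finite F" "F \<subseteq> carrier U" shows "\<exists>i. F \<subseteq> carrier (X i)"
  using assms
proof (induction F rule: finite_induct)
  case (insert x F)
  then obtain i k where "F \<subseteq> carrier (X i)" "x \<in> carrier (X k)" unfolding carrier_U by auto
  then have "insert x F \<subseteq> carrier (X (max i k))"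
    using X_mono[of i "max i k"] X_mono[of k "max i k"] by auto
  then show ?case by blast
qed simp

lemma wf_U: "wf_struc U"
  unfolding wf_struc_def
proof (intro conjI ballI)
  note D = goodD[OF X_good]
  show "zero U \<in> carrier U" "one U \<in> carrier U" using in_U[OF D(6)] in_U[OF D(7)] U_ops by metis+
  fix x y assume "x \<in> carrier U" "y \<in> carrier U"
  then obtain i where i: "x \<in> carrier (X i)" "y \<in> carrier (X i)" by (rule U_two)
  show "plus U x y \<in> carrier U" "times U x y \<in> carrier U"
    using in_U[OF D(8)[OF i]] in_U[OF D(9)[OF i]] U_ops(3,4)[OF i] by simp_all
qed

lemma eval_U:
  assumes "assign (X i) s"
  shows "eval (X i) s t \<in> carrier (X i) \<and> eval U s t = eval (X i) s t"
proof -
  note D = goodD[OF X_good[of i]]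
  show ?thesis
    using assms unfolding assign_def by (induction t) (auto simp: D U_ops(1)[of i] U_ops(2)[of i] U_ops(3,4)[where i = i])
qed

lemma assign_mono: "assign (X i) s \<Longrightarrow> i \<le> k \<Longrightarrow> assign (X k) s"
  using X_mono unfolding assign_def by blast

lemma lift_U: "d \<in> carrier U \<Longrightarrow> \<exists>k\<ge>i. d \<in> carrier (X k)"
proof -
  assume "d \<in> carrier U"
  then obtain k where "d \<in> carrier (X k)" unfolding carrier_U by blast
  then have "d \<in> carrier (X (max i k))" using X_mono[of k "max i k"] by auto
  then show ?thesis by (intro exI[of _ "max i k"]) simp
qed

text \<open>A witness in the union occurs at some later stage, and \<open>up\<close> brings the
  existential statement back to stage \<open>i\<close>. Elementarity is assumed for this one
  formula, so that \<open>p\<close> may be a negation lying outside the prenex classes.\<close>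

lemma sat_U_ex:
  assumes IH: "\<And>i s. assign (X i) s \<Longrightarrow> sat U p s = sat (X i) p s"
    and up: "\<And>k. i \<le> k \<Longrightarrow> sat (X i) (Ex v p) s = sat (X k) (Ex v p) s" and s: "assign (X i) s"
  shows "sat U (Ex v p) s = sat (X i) (Ex v p) s"
proof
  assume "sat U (Ex v p) s"
  then obtain d where d: "d \<in> carrier U" "sat U p (s(v := d))" by auto
  obtain k where k: "i \<le> k" "d \<in> carrier (X k)" using lift_U[OF d(1)] by blast
  have "sat (X k) p (s(v := d))" using IH[OF assign_upd[OF assign_mono[OF s k(1)] k(2)]] d(2) by blast
  then have "sat (X k) (Ex v p) s" using k(2) by auto
  then show "sat (X i) (Ex v p) s" using up k(1) by blast
next
  assume "sat (X i) (Ex v p) s"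
  then obtain d where d: "d \<in> carrier (X i)" "sat (X i) p (s(v := d))" by auto
  then show "sat U (Ex v p) s" using IH[OF assign_upd[OF s d(1)]] in_U by auto
qed

lemma sat_U_delta0: "delta0 p \<Longrightarrow> assign (X i) s \<Longrightarrow> sat U p s = sat (X i) p s"
proof (induction arbitrary: i s rule: delta0.induct)
  case (1 t u)
  then show ?case using eval_U by simp
next
  case (2 t u)
  then show ?case using eval_U[OF 2, of t] eval_U[OF 2, of u] U_ops(5) by simp
next
  case (6 v t p)
  have dl: "delta0 (BEx v t p)" using 6(1,2) by (rule delta0.intros)
  show ?case
  proof
    assume "sat U (BEx v t p) s"
    then obtain d where d: "d \<in> carrier U" "less U d (eval U s t)" "sat U p (s(v := d))" by auto
    obtain k where k: "i \<le> k" "d \<in> carrier (X k)" using lift_U[OF d(1)] by blast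
    have sk: "assign (X k) s" using assign_mono 6(4) k(1) by blast
    have "sat (X k) p (s(v := d))" using 6(3)[OF assign_upd[OF sk k(2)]] d(3) by blast
    moreover have "less (X k) d (eval (X k) s t)" using d(2) eval_U[OF sk, of t] U_ops(5)[OF k(2)] by simp
    ultimately have "sat (X k) (BEx v t p) s" using k(2) by auto
    then show "sat (X i) (BEx v t p) s" using elem_ext_delta0[OF conjunct1[OF ext[OF k(1)]] dl 6(4)] by blast
  next
    assume "sat (X i) (BEx v t p) s"
    then obtain d where d: "d \<in> carrier (X i)" "less (X i) d (eval (X i) s t)" "sat (X i) p (s(v := d))" by auto
    then have "sat U p (s(v := d))" using 6(3)[OF assign_upd[OF 6(4) d(1)]] by blast
    moreover have "less U d (eval U s t)" using d(1,2) eval_U[OF 6(4), of t] U_ops(5)[OF d(1)] by simp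
    ultimately show "sat U (BEx v t p) s" using in_U[OF d(1)] by auto
  qed
next
  case (7 v t p)
  have dl: "delta0 (BAll v t p)" using 7(1,2) by (rule delta0.intros)
  show ?case
  proof
    assume l: "sat U (BAll v t p) s"
    have "sat (X i) p (s(v := d))" if d: "d \<in> carrier (X i)" "less (X i) d (eval (X i) s t)" for d
    proof -
      have "less U d (eval U s t)" using d eval_U[OF 7(4), of t] U_ops(5)[OF d(1)] by simp
      then have "sat U p (s(v := d))" using l in_U[OF d(1)] by simp
      then show ?thesis using 7(3)[OF assign_upd[OF 7(4) d(1)]] by blast
    qed
    then show "sat (X i) (BAll v t p) s" by simp
  next
    assume r: "sat (X i) (BAll v t p) s"
    have "sat U p (s(v := d))" if d: "d \<in> carrier U" "less U d (eval U s t)" for d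
    proof -
      obtain k where k: "i \<le> k" "d \<in> carrier (X k)" using lift_U[OF d(1)] by blast
      have sk: "assign (X k) s" using assign_mono 7(4) k(1) by blast
      have "sat (X k) (BAll v t p) s" using r elem_ext_delta0[OF conjunct1[OF ext[OF k(1)]] dl 7(4)] by blast
      moreover have "less (X k) d (eval (X k) s t)" using d(2) eval_U[OF sk, of t] U_ops(5)[OF k(2)] by simp
      ultimately have "sat (X k) p (s(v := d))" using k(2) by simp
      then show ?thesis using 7(3)[OF assign_upd[OF sk k(2)]] by blast
    qed
    then show "sat U (BAll v t p) s" by simp
  qed
qed simp_all

lemma sat_U:
  "sigma_fm m p \<Longrightarrow> m \<le> Suc n \<longrightarrow> (\<forall>i s. assign (X i) s \<longrightarrow> sat U p s = sat (X i) p s)"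
  "pi_fm m p \<Longrightarrow> m \<le> Suc n \<longrightarrow> (\<forall>i s. assign (X i) s \<longrightarrow> sat U p s = sat (X i) p s)"
proof (induction rule: sigma_fm_pi_fm.inducts)
  case (4 m p v)
  show ?case
  proof (intro impI allI)
    fix i s assume m: "Suc m \<le> Suc n" and s: "assign (X i) s"
    have "sigma_fm (Suc m) (Ex v p)" using 4(1) by (rule sigma_fm_pi_fm.intros)
    then have "sat (X i) (Ex v p) s = sat (X k) (Ex v p) s" if "i \<le> k" for k
      using elem_ext_sat[OF conjunct1[OF ext[OF that]] m _ s] by blast
    then show "sat U (Ex v p) s = sat (X i) (Ex v p) s"
      using 4(2) m s by (intro sat_U_ex) blast+
  qed
next
  case (6 m p v)
  show ?case
  proof (intro impI allI)
    fix i s assume m: "Suc m \<le> Suc n" and s: "assign (X i) s"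
    have "pi_fm (Suc m) (All v p)" using 6(1) by (rule sigma_fm_pi_fm.intros)
    then have up: "sat (X i) (All v p) s = sat (X k) (All v p) s" if "i \<le> k" for k
      using elem_ext_sat[OF conjunct1[OF ext[OF that]] m _ s] by blast
    \<comment> \<open>The universal quantifier is handled as a negated existential one.\<close>
    have "sat U (Ex v (Neg p)) s = sat (X i) (Ex v (Neg p)) s"
    proof (rule sat_U_ex[OF _ _ s])
      show "sat U (Neg p) s = sat (X i) (Neg p) s" if "assign (X i) s" for i s using 6(2) m that by simp
      show "sat (X i) (Ex v (Neg p)) s = sat (X k) (Ex v (Neg p)) s" if "i \<le> k" for k
        using up[OF that] by auto
    qed
    then show "sat U (All v p) s = sat (X i) (All v p) s" by auto
  qed
qed (use sat_U_delta0 in auto)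

lemma sat_U_sigma: "sigma_fm (Suc n) p \<Longrightarrow> assign (X i) s \<Longrightarrow> sat U p s = sat (X i) p s"
  using sat_U(1) by blast

text \<open>The infinitely many values of an assignment need not occur at one stage. Those of the
  free variables do, together with finitely many further elements.\<close>

lemma assign_U:
  assumes "assign U s" "finite F" "F \<subseteq> carrier U"
  shows "\<exists>i s'. assign (X i) s' \<and> F \<subseteq> carrier (X i) \<and> (\<forall>v\<in>fv p. s v = s' v)"
proof -
  have "s ` fv p \<union> F \<subseteq> carrier U" using assms unfolding assign_def by blast
  moreover have "finite (s ` fv p \<union> F)" using finite_fv assms(2) by blast
  ultimately obtain i where i: "s ` fv p \<union> F \<subseteq> carrier (X i)" using U_finite by metis
  let ?s = "\<lambda>v. if v \<in> fv p then s v else zero (X i)"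
  have "assign (X i) ?s" using i goodD(6)[OF X_good] by (auto simp: assign_def)
  then show ?thesis using i by (intro exI[of _ i] exI[of _ ?s]) auto
qed

lemma PAminus_U: "PAminus U"
proof (rule PAminus_of_matrix)
  fix s assume "assign U s"
  then obtain i s' where s': "assign (X i) s'" "\<forall>v\<in>fv PAminus_matrix. s v = s' v"
    using assign_U[of s "{}"] by blast
  have "sat U PAminus_matrix s = sat U PAminus_matrix s'" using s'(2) by (intro sat_cong) blast
  then show "sat U PAminus_matrix s"
    using sat_U_delta0[OF delta0_PAminus_matrix s'(1)]
      sat_PAminus_matrix[OF goodD(2)[OF X_good] goodD(1)[OF X_good] s'(1)] by blast
qed (use wf_U in \<open>simp add: wf_struc_def\<close>)

text \<open>The relevant parameters and \<open>y\<close> lie in one stage. The induction hypotheses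
  restrict to that stage by elementarity, and its own induction reaches \<open>y\<close>.\<close>

lemma ISigma_U: "ISigma n U"
  unfolding ISigma_def
proof (intro allI impI ballI)
  fix p v s y
  assume p: "sigma_fm n p" and s: "assign U s" and z: "sat U p (s(v := zero U))"
    and st: "\<forall>y\<in>carrier U. sat U p (s(v := y)) \<longrightarrow> sat U p (s(v := plus U y (one U)))"
    and y: "y \<in> carrier U"
  obtain i s' where s': "assign (X i) s'" "y \<in> carrier (X i)" "\<forall>v\<in>fv p. s v = s' v"
    using assign_U[OF s, of "{y}" p] y by auto
  note D = goodD[OF X_good[of i]]
  have eq: "sat U p (s(v := d)) = sat (X i) p (s'(v := d))" if "d \<in> carrier (X i)" for d
  proof -
    have "sat U p (s(v := d)) = sat U p (s'(v := d))" using s'(3) by (intro sat_cong) auto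
    then show ?thesis
      using sat_U(1)[OF p] assign_upd[OF s'(1) that] by auto
  qed
  have "sat (X i) p (s'(v := zero (X i)))" using z eq[OF D(6)] U_ops(1)[of i] by simp
  moreover have "sat (X i) p (s'(v := plus (X i) d (one (X i))))"
    if d: "d \<in> carrier (X i)" "sat (X i) p (s'(v := d))" for d
  proof -
    have "sat U p (s(v := plus U d (one U)))" using st in_U[OF d(1)] d(2) eq[OF d(1)] by blast
    then show ?thesis unfolding U_ops(2)[of i] U_ops(3)[OF d(1) D(7)] using eq[OF D(8)[OF d(1) D(7)]] by blast
  qed
  ultimately have "sat (X i) p (s'(v := y))"
    using D(3)[unfolded ISigma_def] p s'(1,2) by blast
  then show "sat U p (s(v := y))" using eq[OF s'(2)] by blast
qed

lemma holds_U:
  assumes "delta0 p" "x \<in> carrier (X i)" "y \<in> carrier (X i)"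
  shows "holds U p [x, y] = holds (X i) p [x, y]"
proof -
  have "assign (X i) (\<lambda>k. if k < length [x, y] then [x, y] ! k else zero (X i))"
    using assms(2,3) goodD(6)[OF X_good] by (auto simp: assign_def less_Suc_eq)
  from sat_U_delta0[OF assms(1) this] show ?thesis unfolding holds_def U_ops(1)[of i] .
qed

lemma pow2_U: "pow2_graph U \<theta>"
proof -
  have th: "delta0 \<theta>" "fv \<theta> \<subseteq> {0, 1}" using goodD(4)[OF X_good] unfolding pow2_graph_def by blast+
  note H = holds_U[OF th(1)]
  have P: "x \<in> carrier (X i) \<Longrightarrow> \<exists>y\<in>carrier (X i). holds (X i) \<theta> [x, y]"
    "x \<in> carrier (X i) \<Longrightarrow> y \<in> carrier (X i) \<Longrightarrow> y' \<in> carrier (X i) \<Longrightarrow> holds (X i) \<theta> [x, y] \<Longrightarrow>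
       holds (X i) \<theta> [x, y'] \<Longrightarrow> y = y'"
    "holds (X i) \<theta> [zero (X i), one (X i)]"
    "x \<in> carrier (X i) \<Longrightarrow> y \<in> carrier (X i) \<Longrightarrow> holds (X i) \<theta> [x, y] \<Longrightarrow>
       holds (X i) \<theta> [plus (X i) x (one (X i)), plus (X i) y y]" for i x y y'
    using goodD(4)[OF X_good[of i]] unfolding pow2_graph_def by blast+
  show ?thesis unfolding pow2_graph_def
  proof (intro conjI th ballI impI)
    fix x assume "x \<in> carrier U"
    then obtain i where i: "x \<in> carrier (X i)" unfolding carrier_U by blast
    then obtain y where "y \<in> carrier (X i)" "holds (X i) \<theta> [x, y]" using P(1) by blast
    then show "\<exists>y\<in>carrier U. holds U \<theta> [x, y]" using H[OF i] in_U by blast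
  next
    fix x y y' assume *: "x \<in> carrier U" "y \<in> carrier U" "y' \<in> carrier U"
      "holds U \<theta> [x, y] \<and> holds U \<theta> [x, y']"
    then obtain i where "{x, y, y'} \<subseteq> carrier (X i)" using U_finite[of "{x, y, y'}"] by auto
    then have i: "x \<in> carrier (X i)" "y \<in> carrier (X i)" "y' \<in> carrier (X i)" by auto
    show "y = y'" using P(2)[OF i] * H[OF i(1,2)] H[OF i(1,3)] by blast
  next
    show "holds U \<theta> [zero U, one U]"
      unfolding U_ops(1,2)[of 0] H[OF goodD(6,7)[OF X_good], of 0] by (rule P(3))
  next
    fix x y assume *: "x \<in> carrier U" "y \<in> carrier U" "holds U \<theta> [x, y]"
    obtain i where i: "x \<in> carrier (X i)" "y \<in> carrier (X i)" by (rule U_two[OF *(1,2)])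
    note D = goodD[OF X_good[of i]]
    have "holds (X i) \<theta> [plus (X i) x (one (X i)), plus (X i) y y]"
      using P(4)[OF i] * H[OF i] by blast
    then show "holds U \<theta> [plus U x (one U), plus U y y]"
      unfolding U_ops(2)[of i] U_ops(3)[OF i(1) D(7)] U_ops(3)[OF i(2) i(2)]
      using H[OF D(8)[OF i(1) D(7)] D(8)[OF i(2) i(2)]] by blast
  qed
qed

lemma model_U: "model_ISigma_exp n U"
  unfolding model_ISigma_exp_def exp_ax_def
  using wf_U PAminus_U ISigma_U pow2_U wf_U[unfolded wf_struc_def] by blast

text \<open>Take a late stage \<open>m\<close> that contains \<open>c\<close>, \<open>b\<close> and
  the parameters and treats this pair. By elementarity the formula still defines an injection there,
  so the next stage contains some \<open>d\<close> below \<open>cb\<close> without a value. But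
  \<open>d\<close> has a value in the union, and this Sigma_{n+1} fact reflects to the next
  stage.\<close>

lemma no_def_inj_U:
  assumes a: "less U (one U) a"
    and tasks: "\<And>i c b. c \<in> carrier U \<Longrightarrow> b \<in> carrier U \<Longrightarrow>
      \<exists>m\<ge>i. killable a (X m) c b \<longrightarrow> killed n (X m) (X (Suc m)) c b"
    and e: "nonstandard U e" and b: "b \<in> carrier U" "less U (zero U) b" and c: "is_power U a e c"
  shows "no_def_inj (Suc n) U (times U c b) b"
  unfolding no_def_inj_def
proof
  assume "\<exists>p s. sigma_fm (Suc n) p \<and> assign U s \<and>
    inj_graph U (times U c b) b (\<lambda>u v. sat U p (s(0 := u, 1 := v)))"
  then obtain p s where p: "sigma_fm (Suc n) p" and s: "assign U s"
    and g: "inj_graph U (times U c b) b (\<lambda>u v. sat U p (s(0 := u, 1 := v)))" by blast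
  have aU: "a \<in> carrier U" using in_U[OF a_in] .
  have cU: "c \<in> carrier U" using c unfolding is_power_def by blast
  note P = PAminusD[OF PAminus_U]
  have zU: "zero U \<in> carrier U" "one U \<in> carrier U" using wf_U unfolding wf_struc_def by blast+
  obtain C where C: "c \<noteq> zero U" "C 0 = c" "\<And>k :: nat. C k \<in> carrier U" "\<And>k. C k = times U a (C (Suc k))"
    using power_descent[OF PAminus_U wf_U ISigma_0[OF ISigma_U] aU a e c] by blast
  obtain i s' where i: "assign (X i) s'" "c \<in> carrier (X i)" "b \<in> carrier (X i)" "\<forall>v\<in>fv p. s v = s' v"
    using assign_U[OF s, of "{c, b}" p] b(1) cU by auto
  have eq: "sat U p (s(0 := u, 1 := v)) = sat U p (s'(0 := u, 1 := v))" for u v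
    using i(4) by (intro sat_cong) auto
  note g' = g[unfolded eq inj_graph_def]
  have R: "\<And>u v. sat U p (s'(0 := u, 1 := v)) \<Longrightarrow> v \<in> carrier U \<and> less U u (times U c b) \<and> less U v b"
    "\<And>u. u \<in> carrier U \<Longrightarrow> less U u (times U c b) \<Longrightarrow> \<exists>v. sat U p (s'(0 := u, 1 := v))"
    "\<And>u v v'. sat U p (s'(0 := u, 1 := v)) \<Longrightarrow> sat U p (s'(0 := u, 1 := v')) \<Longrightarrow> v = v'"
    "\<And>u u' v. sat U p (s'(0 := u, 1 := v)) \<Longrightarrow> sat U p (s'(0 := u', 1 := v)) \<Longrightarrow> u = u'"
    using g' by blast+
  obtain m where m: "i \<le> m" "killable a (X m) c b \<longrightarrow> killed n (X m) (X (Suc m)) c b"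
    using tasks[OF cU b(1)] by blast
  have sm: "assign (X m) s'" "assign (X (Suc m)) s'" using assign_mono[OF i(1)] m(1) by simp_all
  have am: "a \<in> carrier (X m)" using ext[of m m] by blast
  have cm: "c \<in> carrier (X m)" "b \<in> carrier (X m)" using X_mono[OF m(1)] i(2,3) by blast+
  note D = goodD[OF X_good[of m]]
  \<comment> \<open>Quantifying the value does not leave Sigma_{n+1}, so having a value is absolute
    between the union and every stage.\<close>
  have Ex1: "sigma_fm (Suc n) (Ex 1 p)" using p by (rule sigma_fm_pi_fm.intros)
  have dom: "\<exists>v\<in>carrier (X k). sat (X k) p (s'(0 := u, 1 := v))"
    if k: "assign (X k) s'" and u: "u \<in> carrier (X k)" "less U u (times U c b)" for k u
  proof -
    obtain v where v: "sat U p (s'(0 := u, 1 := v))" using R(2)[OF in_U[OF u(1)] u(2)] by blast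
    then have "sat U (Ex 1 p) (s'(0 := u))" using R(1)[OF v] by auto
    then have "sat (X k) (Ex 1 p) (s'(0 := u))"
      using sat_U_sigma[OF Ex1 assign_upd[OF k u(1)]] by blast
    then show ?thesis by auto
  qed
  \<comment> \<open>Divisibility of \<open>C k\<close> by \<open>a\<close> is an existential
    statement about elements of stage \<open>m\<close>. A quotient found there equals
    \<open>C (Suc k)\<close> by cancellation, so the whole descent stays in the stage.\<close>
  have Cm: "C k \<in> carrier (X m)" for k
  proof (induction k)
    case 0
    then show ?case using C(2) cm by simp
  next
    case (Suc k)
    have "sigma_fm (Suc n) (Ex 2 (Eq (Times (Var 0) (Var 2)) (Var 1)))"
      by (intro sigma_fm_pi_fm.intros(4) delta0_sigma delta0.intros)
    moreover have "assign (X m) (s'(0 := a, 1 := C k))" using sm am Suc by (simp add: assign_upd)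
    moreover have "sat U (Ex 2 (Eq (Times (Var 0) (Var 2)) (Var 1))) (s'(0 := a, 1 := C k))"
      using C(3)[of "Suc k"] C(4)[of k] by auto
    ultimately have "sat (X m) (Ex 2 (Eq (Times (Var 0) (Var 2)) (Var 1))) (s'(0 := a, 1 := C k))"
      using sat_U_sigma by blast
    then obtain z where z: "z \<in> carrier (X m)" "times (X m) a z = C k" by auto
    have zu: "z \<in> carrier U" using in_U[OF z(1)] .
    have "times U a z = times U a (C (Suc k))" using U_ops(4)[OF am z(1)] z(2) C(4)[of k] by simp
    moreover have "less U (zero U) a" using P(10)[OF zU aU P(15) a] .
    ultimately have "z = C (Suc k)"
      using P(11)[OF zu C(3)] P(13)[OF zu C(3) aU, of "Suc k"] P(13)[OF C(3) zu aU, of "Suc k"]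
        P(4)[OF aU zu] P(4)[OF aU C(3), of "Suc k"] P(9)[of "times U z a"] wf_U zu aU
      unfolding wf_struc_def by metis
    then show ?case using z(1) by simp
  qed
  have "killable a (X m) c b"
    unfolding killable_def
  proof (intro conjI exI[of _ C] allI)
    show "C k = times (X m) a (C (Suc k))" for k using C(4)[of k] U_ops(4)[OF am Cm] by simp
    show "c \<noteq> zero (X m)" using C(1) U_ops(1)[of m] by simp
    show "less (X m) (zero (X m)) b" using b(2) U_ops(1)[of m] U_ops(5)[OF D(6) cm(2)] by simp
  qed (use C(2) Cm cm in auto)
  then have "killed n (X m) (X (Suc m)) c b" using m(2) by blast
  then obtain d where d: "d \<in> carrier (X (Suc m))" "less (X (Suc m)) d (times (X m) c b)"
    and k: "\<And>p s v. sigma_fm (Suc n) p \<Longrightarrow> assign (X m) s \<Longrightarrow>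
       inj_graph (X m) (times (X m) c b) b
         (\<lambda>u v. u \<in> carrier (X m) \<and> v \<in> carrier (X m) \<and> sat (X m) p (s(0 := u, 1 := v))) \<Longrightarrow>
       v \<in> carrier (X (Suc m)) \<Longrightarrow> \<not> sat (X (Suc m)) p (s(0 := d, 1 := v))"
    unfolding killed_def by blast
  have cb: "times U c b = times (X m) c b" "times (X m) c b \<in> carrier (X m)"
    using U_ops(4)[OF cm] D(9)[OF cm] by blast+
  have sU: "sat (X m) p (s'(0 := u, 1 := v)) = sat U p (s'(0 := u, 1 := v))"
    if "u \<in> carrier (X m)" "v \<in> carrier (X m)" for u v
    using sat_U_sigma[OF p assign_upd[OF assign_upd[OF sm(1)]]] that by simp
  have "inj_graph (X m) (times (X m) c b) b
         (\<lambda>u v. u \<in> carrier (X m) \<and> v \<in> carrier (X m) \<and> sat (X m) p (s'(0 := u, 1 := v)))"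
    unfolding inj_graph_def
  proof (intro conjI allI ballI impI)
    fix u v assume uv: "u \<in> carrier (X m) \<and> v \<in> carrier (X m) \<and> sat (X m) p (s'(0 := u, 1 := v))"
    then have "less U u (times U c b) \<and> less U v b" using R(1)[of u v] sU by blast
    then show "less (X m) u (times (X m) c b)" "less (X m) v b"
      using U_ops(5)[OF _ cb(2), of u] U_ops(5)[OF _ cm(2), of v] uv cb(1) by simp_all
    show "u \<in> carrier (X m)" "v \<in> carrier (X m)" using uv by blast+
  next
    fix u assume u: "u \<in> carrier (X m)" "less (X m) u (times (X m) c b)"
    then have "less U u (times U c b)" using U_ops(5)[OF u(1) cb(2)] cb(1) by simp
    then show "\<exists>v. u \<in> carrier (X m) \<and> v \<in> carrier (X m) \<and> sat (X m) p (s'(0 := u, 1 := v))"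
      using dom[OF sm(1) u(1)] u(1) by blast
  qed (use R(3,4) sU in blast)+
  then have no: "\<And>v. v \<in> carrier (X (Suc m)) \<Longrightarrow> \<not> sat (X (Suc m)) p (s'(0 := d, 1 := v))"
    using k[OF p sm(1)] by blast
  have "times (X m) c b \<in> carrier (X (Suc m))" using cb(2) X_mono[of m "Suc m"] by auto
  then have "less U d (times U c b)" using d(2) U_ops(5)[OF d(1)] cb(1) by simp
  then show False using dom[OF sm(2) d(1)] no by blast
qed

end

section \<open>Assembling the chain\<close>

theorem theorem5p4:
  fixes n :: nat and M :: "'a struc" and a :: 'a
  assumes "model_ISigma_exp n M"
    and "countable (carrier M)"
    and "a \<in> carrier M"
    and "less M (one M) a"
  shows "\<exists>N :: ('a + nat) struc.
           model_ISigma_exp n N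
         \<and> extends_via Inl M N
         \<and> sigma_elem_via (Suc n) Inl M N
         \<and> cofinal_via Inl M N
         \<and> {y \<in> carrier N. leq N y (Inl a)} = Inl ` {x \<in> carrier M. leq M x a}
         \<and> (\<forall>e b c. nonstandard N e \<longrightarrow> b \<in> carrier N \<longrightarrow> less N (zero N) b \<longrightarrow>
              is_power N (Inl a) e c \<longrightarrow> no_def_inj (Suc n) N (times N c b) b)"
proof -
  obtain \<theta> where M: "wf_struc M" "PAminus M" "ISigma n M" "pow2_graph M \<theta>"
    using assms(1) unfolding model_ISigma_exp_def exp_ax_def by blast
  let ?A = "Inl ` carrier M :: ('a + nat) set" and ?a = "Inl a :: 'a + nat"
  \<comment> \<open>The given model is copied into the left summand; the right summand supplies
    names for all new elements.\<close>
  define M0 where "M0 = pullback ?A projl M"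
  have bij: "bij_betw projl ?A (carrier M)"
    unfolding bij_betw_def by (auto simp: inj_on_def image_image)
  note B = bij M(1)
  note H = pullback_hom[OF B, folded M0_def]
  have car0: "carrier M0 = ?A" by (rule H(1))
  have Inl_eq: "y = Inl (projl y)" if "y \<in> ?A" for y using that by auto
  have ops0: "zero M0 = Inl (zero M)" "one M0 = Inl (one M)"
    "x \<in> carrier M \<Longrightarrow> y \<in> carrier M \<Longrightarrow> plus M0 (Inl x) (Inl y) = Inl (plus M x y)"
    "x \<in> carrier M \<Longrightarrow> y \<in> carrier M \<Longrightarrow> times M0 (Inl x) (Inl y) = Inl (times M x y)"
    "less M0 (Inl x) (Inl y) = less M x y" for x y
    using Inl_eq[OF H(3)] Inl_eq[OF H(5)] Inl_eq[OF H(7), of "Inl x" "Inl y"]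
      Inl_eq[OF H(9), of "Inl x" "Inl y"] by (simp_all add: H)
  have sat0: "sat M0 p (Inl \<circ> s) = sat M p s" if "assign M s" for p s
    using sat_pullback[OF B, of "Inl \<circ> s" p] that unfolding M0_def assign_def by simp
  have good0: "good n \<theta> M0"
    unfolding good_def car0
    using wf_pullback[OF B] PAminus_pullback[OF B M(2)] ISigma_pullback[OF B M(3)] pow2_pullback[OF B M(4)]
      assms(2) unfolding M0_def by simp
  let ?W = "?A \<union> range Inr"
  \<comment> \<open>All pairs of potential names are enumerated in advance, including those of
    elements that appear only later; a pair that is not killable at its stage is skipped.\<close>
  define task where "task = from_nat_into (?W \<times> ?W)"
  \<comment> \<open>Disjoint infinite supplies of names, one for each stage: stage \<open>i\<close>
    owns the right summands whose code has first component \<open>i\<close>.\<close>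
  define Z where "Z i = (Inr ` range (\<lambda>k. prod_encode (i, k)) :: ('a + nat) set)" for i
  define W where "W i = ?A \<union> (\<Union>k<i. Z k)" for i
  have Z: "infinite (Z i)" "countable (Z i)" "Z i \<inter> W i = {}" for i
  proof -
    have "inj (\<lambda>k. Inr (prod_encode (i, k)) :: 'a + nat)" by (auto intro!: injI)
    then show "infinite (Z i)" unfolding Z_def image_image using range_inj_infinite by blast
    show "countable (Z i)" unfolding Z_def by simp
    show "Z i \<inter> W i = {}" unfolding W_def Z_def by auto
  qed
  define inv where "inv i K \<longleftrightarrow> good n \<theta> K \<and> carrier K \<subseteq> W i \<and> ?a \<in> carrier K \<and> less K (one K) ?a \<and>
    (i = 0 \<longrightarrow> K = M0)" for i K
  \<comment> \<open>Reading the stage number as a pair presents each task infinitely often. This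
    matters because a stage deals only with injections whose parameters it already contains, and
    more parameters keep appearing.\<close>
  define nxt where "nxt i K N \<longleftrightarrow> elem_ext n ?a K N \<and>
    (case task (fst (prod_decode i)) of (c, b) \<Rightarrow> killable ?a K c b \<longrightarrow> killed n K N c b)" for i K N
  have "\<exists>X. \<forall>i. inv i (X i) \<and> nxt i (X i) (X (Suc i))"
  proof (rule dependent_nat_choice)
    show "\<exists>K. inv 0 K" unfolding inv_def using good0 assms(3,4) by (auto simp: car0 W_def ops0)
  next
    fix K i assume K: "inv i K"
    obtain c b where cb: "task (fst (prod_decode i)) = (c, b)" by (rule prod.exhaust)
    have KD: "good n \<theta> K" "?a \<in> carrier K" "less K (one K) ?a" "carrier K \<subseteq> W i"
      using K unfolding inv_def by simp_all
    have "Z i \<inter> carrier K = {}" using Z(3)[of i] KD(4) by blast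
    from kill_step[OF KD(1-3) Z(1,2) this, of c b]
    obtain N where N: "good n \<theta> N" "elem_ext n ?a K N" "carrier N \<subseteq> carrier K \<union> Z i"
      "killable ?a K c b \<longrightarrow> killed n K N c b"
      by blast
    have "?a \<in> carrier N" using N(2) KD(2) unfolding elem_ext_def by blast
    moreover have "less N (one N) ?a"
      using elem_ext_ops(2,5)[OF N(2) KD(1)] goodD(7)[OF KD(1)] KD(2,3) by simp
    moreover have "carrier N \<subseteq> W (Suc i)" using N(3) KD(4) unfolding W_def lessThan_Suc by auto
    ultimately have "inv (Suc i) N" unfolding inv_def using N(1) by simp
    moreover have "nxt i K N" unfolding nxt_def using N cb by simp
    ultimately show "\<exists>N. inv (Suc i) N \<and> nxt i K N" by blast
  qed
  then obtain X where X: "\<And>i. inv i (X i)" "\<And>i. nxt i (X i) (X (Suc i))" by blast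
  have X0: "X 0 = M0" using X(1)[of 0] unfolding inv_def by blast
  interpret ch: elem_chain n \<theta> ?a X
    by unfold_locales (use X in \<open>auto simp: inv_def nxt_def\<close>)
  let ?N = "ch.U"
  have inN: "Inl x \<in> carrier ?N" if "x \<in> carrier M" for x
    using ch.in_U[of "Inl x" 0] that unfolding X0 car0 by blast
  note O = ch.U_ops[where i = 0, unfolded X0 car0]
  have less: "less ?N (Inl x) (Inl y) = less M x y" if "x \<in> carrier M" "y \<in> carrier M" for x y
    using O(5)[of "Inl x" "Inl y"] that ops0(5) by auto
  have ext: "extends_via Inl M ?N"
    unfolding extends_via_def
    using ch.U_ops(1,2)[of 0] O(3,4) inN less by (auto simp: X0 ops0 inj_on_def)
  have elem: "sigma_elem_via (Suc n) Inl M ?N"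
    unfolding sigma_elem_via_def
  proof (intro allI impI)
    fix p s assume p: "sigma_fm (Suc n) p" and s: "assign M s"
    have "assign (X 0) (Inl \<circ> s)" using s unfolding X0 assign_def car0 by simp
    from ch.sat_U_sigma[OF p this] show "sat M p s = sat ?N p (Inl \<circ> s)"
      unfolding X0 sat0[OF s] by (rule sym)
  qed
  have low: "\<exists>x\<in>carrier M. less ?N y (Inl x)" "less ?N y ?a \<Longrightarrow> y \<in> ?A" if y: "y \<in> carrier ?N" for y
  proof -
    obtain i where i: "y \<in> carrier (X i)" using y unfolding ch.carrier_U by blast
    have e: "elem_ext n ?a M0 (X i)" and a: "?a \<in> carrier (X i)"
      using ch.ext[of 0 i] unfolding X0 by simp_all
    obtain x where x: "x \<in> carrier M" "less (X i) y (Inl x)"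
      using e i unfolding elem_ext_def car0 by blast
    have "Inl x \<in> carrier (X i)" using e x(1) unfolding elem_ext_def car0 by blast
    then show "\<exists>x\<in>carrier M. less ?N y (Inl x)" using x ch.U_ops(5)[OF i] by blast
    show "y \<in> ?A" if "less ?N y ?a"
      using that e i ch.U_ops(5)[OF i a] unfolding elem_ext_def car0 by blast
  qed
  have cof: "cofinal_via Inl M ?N"
    unfolding cofinal_via_def leq_def using low(1) by blast
  have init: "{y \<in> carrier ?N. leq ?N y ?a} = Inl ` {x \<in> carrier M. leq M x a}"
  proof
    show "{y \<in> carrier ?N. leq ?N y ?a} \<subseteq> Inl ` {x \<in> carrier M. leq M x a}"
    proof
      fix y assume y: "y \<in> {y \<in> carrier ?N. leq ?N y ?a}"
      then have "y \<in> ?A" using low(2) assms(3) unfolding leq_def by blast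
      then obtain x where "x \<in> carrier M" "y = Inl x" by blast
      then show "y \<in> Inl ` {x \<in> carrier M. leq M x a}" using y less assms(3) unfolding leq_def by auto
    qed
    show "Inl ` {x \<in> carrier M. leq M x a} \<subseteq> {y \<in> carrier ?N. leq ?N y ?a}"
      using inN less assms(3) unfolding leq_def by auto
  qed
  have one_a: "less ?N (one ?N) ?a"
    using less[of "one M" a] assms(3,4) M(1) ch.U_ops(2)[of 0] unfolding X0 ops0 wf_struc_def by simp
  have cW: "countable (?W \<times> ?W)" using assms(2) by simp
  have tasks: "\<exists>m\<ge>i. killable ?a (X m) c b \<longrightarrow> killed n (X m) (X (Suc m)) c b"
    if c: "c \<in> carrier ?N" "b \<in> carrier ?N" for i c b
  proof -
    have "carrier ?N \<subseteq> ?W" using X(1) unfolding ch.carrier_U inv_def W_def Z_def by blast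
    then have "(c, b) \<in> ?W \<times> ?W" using c by blast
    then obtain k where k: "task k = (c, b)" unfolding task_def using from_nat_into_surj[OF cW] by blast
    \<comment> \<open>The first component selects the task; the second only pushes the stage beyond
      \<open>i\<close>.\<close>
    let ?m = "prod_encode (k, i)"
    have "i \<le> ?m" by (rule le_prod_encode_2)
    moreover have "killable ?a (X ?m) c b \<longrightarrow> killed n (X ?m) (X (Suc ?m)) c b"
      using X(2)[of ?m] k unfolding nxt_def by simp
    ultimately show ?thesis by blast
  qed
  show ?thesis
    using ch.model_U ext elem cof init ch.no_def_inj_U[OF one_a tasks] by blast
qed

end
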